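(* Let $\mathbb I=\{\,1\le i\le d-1 \mid i\notin\{a_1,\dots,a_{k-1}\},\ \delta_1(\mathbf w_i)>\deg(\mathbf w_i)\,\}$, and assume that $K[S]$ is not Cohen--Macaulay. Then for each $i\in\mathbb I$ we have $\delta_2(\mathbf w_i)-\deg(\mathbf w_i)-1\ge 0$, and for each integer $0\le n_1\le\delta_2(\mathbf w_i)-\deg(\mathbf w_i)-1$ we have $\delta_1(\omega_1(i)+n_1d)-\deg(\mathbf w_i)-n_1-1\ge 0$. Let $$\mathcal L=\{\mathbf w_i+(n_1d,n_2d)\mid i\in\mathbb I,\ 0\le n_1\le\delta_2(\mathbf w_i)-\deg(\mathbf w_i)-1,\ n_2=\delta_1(\omega_1(i)+n_1d)-\deg(\mathbf w_i)-n_1-1\},$$ $$\mathcal L'=\{\mathbf w_i+(n_1d,n_2d)\mid i\in\mathbb I,\ 0\le n_1\le\delta_2(\mathbf w_i)-\deg(\mathbf w_i)-1,\ 0\le n_2\le\delta_1(\omega_1(i)+n_1d)-\deg(\mathbf w_i)-n_1-1\},$$ where $n_1,n_2$ are integers. Then $H^1_{\mathfrak m}(K[S])\cong\bigoplus_{\mathbf w\in\mathcal L'}K\mathbf w$ as graded $K$-vector spaces. In particular, $a_1(K[S])=\max_{\mathbf u\in\mathcal L}\deg(\mathbf u)$ and $\ell(H^1_{\mathfrak m}(K[S]))=\sharp(\mathcal L')$.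
   Context: Let $K$ be a field, $\mathbb N$ the set of non-negative integers, $k\ge 3$, and let $0=:a_0<a_1<\cdots<a_k=:d$ be integers with $\gcd(a_1,\dots,a_k)=1$ and $k<d$. Put $A_1=\{0,a_1,\dots,a_k\}$, $A_2=\{d-a_i\mid 0\le i\le k\}$, and $\mathbf e_h=(h,d-h)$ for integers $0\le h\le d$. Let $S\subset\mathbb N^2$ be the additive monoid generated by $\mathbf e_{a_0},\dots,\mathbf e_{a_k}$, and $K[S]$ its semigroup ring (isomorphic to $K[s^{a_i}t^{d-a_i}\mid 0\le i\le k]$), graded by $\deg(u_1,u_2)=(u_1+u_2)/d$; $\mathfrak m$ is the maximal homogeneous ideal generated by $S\setminus\{0\}$. $H^i_{\mathfrak m}$ denotes local cohomology, $\ell$ denotes length, and $a_i(K[S]):=\sup\{n\mid H^i_{\mathfrak m}(K[S])_n\ne 0\}$ (not to be confused with the integers $a_i$). For $i\in\{1,2\}$ let $\langle A_i\rangle$ be the submonoid of $\mathbb N$ generated by $A_i$. For $0\le j\le d-1$ let $\omega_i(j)=\min\{\alpha\in\langle A_i\rangle\mid\alpha\equiv j \bmod d\}$, and set $\omega_i(d):=0$. For $n\in\langle A_i\rangle$ let $\delta_i(n)$ be the minimum of $\sum_{a}x_a$ over all representations $n=\sum_{a\in A_i\setminus\{0\}}x_a a$ with $x_a\in\mathbb N$. For $0\le j\le d-1$ put $\mathbf w_j=(\omega_1(j),\omega_2(d-j))$, so $\deg(\mathbf w_j)=(\omega_1(j)+\omega_2(d-j))/d$, and write $\delta_1(\mathbf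 w_j)=\delta_1(\omega_1(j))$, $\delta_2(\mathbf w_j)=\delta_2(\omega_2(d-j))$. *)

theory Defs
  imports
    "HOL-Algebra.Algebra"
    "HOL-Library.Poly_Mapping"
    "HOL-Library.Product_Plus"
    "HOL-Library.Extended_Real"
begin

section \<open>Chain conditions on commutative rings and modules\<close>

definition krull_dim :: "('a, 'c) ring_scheme \<Rightarrow> enat" where
  "krull_dim R = Sup {enat n | n. \<exists>P :: nat \<Rightarrow> 'a set.
     (\<forall>i\<le>n. primeideal (P i) R) \<and> (\<forall>i<n. P i \<subset> P (Suc i))}"

definition regular_sequence :: "('a, 'c) ring_scheme \<Rightarrow> 'a list \<Rightarrow> bool" where
  "regular_sequence R xs \<longleftrightarrow> set xs \<subseteq> carrier R
     \<and> (\<forall>i<length xs. \<forall>r\<in>carrier R.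
          xs ! i \<otimes>\<^bsub>R\<^esub> r \<in> Idl\<^bsub>R\<^esub> (set (take i xs)) \<longrightarrow> r \<in> Idl\<^bsub>R\<^esub> (set (take i xs)))
     \<and> Idl\<^bsub>R\<^esub> (set xs) \<noteq> carrier R"

definition depth :: "('a, 'c) ring_scheme \<Rightarrow> 'a set \<Rightarrow> enat" where
  "depth R I = Sup {enat (length xs) | xs. set xs \<subseteq> I \<and> regular_sequence R xs}"

text \<open>
  The notion for a positively graded, finitely generated algebra \<open>R\<close> over a field with maximal
  homogeneous ideal \<open>m\<close>; the depth of \<open>R\<close> is the depth of \<open>m\<close> on \<open>R\<close>.
\<close>
definition graded_cohen_macaulay :: "('a, 'c) ring_scheme \<Rightarrow> 'a set \<Rightarrow> bool" where
  "graded_cohen_macaulay R m \<longleftrightarrow> depth R m = krull_dim R"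

definition module_length :: "('a, 'c) ring_scheme \<Rightarrow> ('a, 'b, 'e) module_scheme \<Rightarrow> enat" where
  "module_length R M = Sup {enat n | n. \<exists>N :: nat \<Rightarrow> 'b set.
     (\<forall>i\<le>n. submodule (N i) R M) \<and> (\<forall>i<n. N i \<subset> N (Suc i))}"

primrec ideal_power :: "('a, 'c) ring_scheme \<Rightarrow> 'a set \<Rightarrow> nat \<Rightarrow> 'a set" where
  "ideal_power R I 0 = carrier R"
| "ideal_power R I (Suc n) = I \<cdot>\<^bsub>R\<^esub> ideal_power R I n"


section \<open>Graded modules\<close>

record ('a, 'b) gmodule = "('a, 'b) module" +
  gpart :: "int \<Rightarrow> 'b set"

text \<open>\<open>G n\<close> is the homogeneous component of degree \<open>n\<close> of the graded ring \<open>R\<close>.\<close>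
definition graded_module ::
  "('a, 'c) ring_scheme \<Rightarrow> (int \<Rightarrow> 'a set) \<Rightarrow> ('a, 'b) gmodule \<Rightarrow> bool" where
  "graded_module R G M \<longleftrightarrow> module R M
     \<and> (\<forall>n. subgroup (gpart M n) (add_monoid M))
     \<and> (\<forall>x\<in>carrier M. \<exists>!c. (\<forall>n. c n \<in> gpart M n) \<and> finite {n. c n \<noteq> \<zero>\<^bsub>M\<^esub>}
          \<and> x = (\<Oplus>\<^bsub>M\<^esub>n\<in>{n. c n \<noteq> \<zero>\<^bsub>M\<^esub>}. c n))
     \<and> (\<forall>i j. \<forall>r\<in>G i. \<forall>x\<in>gpart M j. r \<odot>\<^bsub>M\<^esub> x \<in> gpart M (i + j))"

definition graded_hom ::
  "('a, 'c) ring_scheme \<Rightarrow> ('a, 'b) gmodule \<Rightarrow> ('a, 'd) gmodule \<Rightarrow> ('b \<Rightarrow> 'd) set" where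
  "graded_hom R M N = {f \<in> carrier M \<rightarrow> carrier N.
     (\<forall>x\<in>carrier M. \<forall>y\<in>carrier M. f (x \<oplus>\<^bsub>M\<^esub> y) = f x \<oplus>\<^bsub>N\<^esub> f y)
     \<and> (\<forall>r\<in>carrier R. \<forall>x\<in>carrier M. f (r \<odot>\<^bsub>M\<^esub> x) = r \<odot>\<^bsub>N\<^esub> f x)
     \<and> (\<forall>n. f ` gpart M n \<subseteq> gpart N n)}"

definition graded_isomorphic ::
  "('a, 'c) ring_scheme \<Rightarrow> ('a, 'b) gmodule \<Rightarrow> ('a, 'd) gmodule \<Rightarrow> bool" where
  "graded_isomorphic R M N \<longleftrightarrow> (\<exists>f\<in>graded_hom R M N. bij_betw f (carrier M) (carrier N)
     \<and> (\<forall>n. f ` gpart M n = gpart N n))"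

text \<open>
  Injective objects of the category of graded \<open>R\<close>-modules and degree-preserving homomorphisms.
  The test modules have their carriers in the type of \<open>E\<close>.  By Baer's criterion this is no
  restriction as soon as \<open>R\<close> embeds into that type, since all \<open>R(n)\<close> and their graded submodules
  are then available as test modules; in a resolution of \<open>R\<close> the augmentation is such an embedding.
\<close>
definition graded_injective ::
  "('a, 'c) ring_scheme \<Rightarrow> (int \<Rightarrow> 'a set) \<Rightarrow> ('a, 'b) gmodule \<Rightarrow> bool" where
  "graded_injective R G E \<longleftrightarrow> graded_module R G E
     \<and> (\<forall>(M :: ('a, 'b) gmodule) (N :: ('a, 'b) gmodule) i g.
          graded_module R G M \<and> graded_module R G N
          \<and> i \<in> graded_hom R N M \<and> inj_on i (carrier N) \<and> g \<in> graded_hom R N E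
          \<longrightarrow> (\<exists>h\<in>graded_hom R M E. \<forall>x\<in>carrier N. h (i x) = g x))"

text \<open>The sequence \<open>0 \<rightarrow> M \<rightarrow> E 0 \<rightarrow> E 1 \<rightarrow> \<dots>\<close> with augmentation \<open>\<epsilon>\<close> and differentials \<open>D\<close>
  is exact and every \<open>E n\<close> is injective.\<close>
definition graded_injective_resolution ::
  "('a, 'c) ring_scheme \<Rightarrow> (int \<Rightarrow> 'a set) \<Rightarrow> ('a, 'b) gmodule \<Rightarrow> ('b \<Rightarrow> 'd)
    \<Rightarrow> (nat \<Rightarrow> ('a, 'd) gmodule) \<Rightarrow> (nat \<Rightarrow> 'd \<Rightarrow> 'd) \<Rightarrow> bool" where
  "graded_injective_resolution R G M \<epsilon> E D \<longleftrightarrow>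
     (\<forall>n. graded_injective R G (E n))
     \<and> \<epsilon> \<in> graded_hom R M (E 0) \<and> (\<forall>n. D n \<in> graded_hom R (E n) (E (Suc n)))
     \<and> inj_on \<epsilon> (carrier M)
     \<and> \<epsilon> ` carrier M = {x \<in> carrier (E 0). D 0 x = \<zero>\<^bsub>E 1\<^esub>}
     \<and> (\<forall>n. D n ` carrier (E n) = {x \<in> carrier (E (Suc n)). D (Suc n) x = \<zero>\<^bsub>E (Suc (Suc n))\<^esub>})"


section \<open>Local cohomology\<close>

definition torsion :: "('a, 'c) ring_scheme \<Rightarrow> 'a set \<Rightarrow> ('a, 'b) gmodule \<Rightarrow> 'b set" where
  "torsion R I M = {x \<in> carrier M. \<exists>n. \<forall>r\<in>ideal_power R I n. r \<odot>\<^bsub>M\<^esub> x = \<zero>\<^bsub>M\<^esub>}"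

text \<open>
  The quotient of the graded submodule \<open>Z\<close> of \<open>M\<close> by the graded submodule \<open>B \<subseteq> Z\<close>; its elements
  are cosets of \<open>B\<close>.  The ring multiplication fields of the record are irrelevant for modules.
\<close>
definition graded_subquotient ::
  "('a, 'b) gmodule \<Rightarrow> 'b set \<Rightarrow> 'b set \<Rightarrow> ('a, 'b set) gmodule" where
  "graded_subquotient M Z B =
     \<lparr>carrier = (\<lambda>x. B +>\<^bsub>M\<^esub> x) ` Z, monoid.mult = undefined, monoid.one = undefined,
      ring.zero = B, add = (<+>\<^bsub>M\<^esub>),
      smult = (\<lambda>r C. \<Union>x\<in>C. B +>\<^bsub>M\<^esub> (r \<odot>\<^bsub>M\<^esub> x)),
      gpart = (\<lambda>n. (\<lambda>x. B +>\<^bsub>M\<^esub> x) ` (Z \<inter> gpart M n))\<rparr>"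

text \<open>
  The \<open>i\<close>-th right derived functor of the \<open>I\<close>-torsion functor, computed from an injective
  resolution \<open>(E, D)\<close>: the \<open>i\<close>-th cohomology of the subcomplex of \<open>I\<close>-torsion elements.
\<close>
definition local_cohomology ::
  "('a, 'c) ring_scheme \<Rightarrow> 'a set \<Rightarrow> (nat \<Rightarrow> ('a, 'b) gmodule) \<Rightarrow> (nat \<Rightarrow> 'b \<Rightarrow> 'b)
    \<Rightarrow> nat \<Rightarrow> ('a, 'b set) gmodule" where
  "local_cohomology R I E D i = graded_subquotient (E i)
     {x \<in> torsion R I (E i). D i x = \<zero>\<^bsub>E (Suc i)\<^esub>}
     (case i of 0 \<Rightarrow> {\<zero>\<^bsub>E 0\<^esub>} | Suc j \<Rightarrow> D j ` torsion R I (E j))"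

text \<open>The largest degree of a nonzero component, with value \<open>-\<infinity>\<close> for the zero module.\<close>
definition top_degree :: "('a, 'b) gmodule \<Rightarrow> ereal" where
  "top_degree M = Sup {ereal (of_int n) | n. gpart M n \<noteq> {\<zero>\<^bsub>M\<^esub>}}"


section \<open>Semigroup rings\<close>

inductive_set generated_monoid :: "'a::comm_monoid_add set \<Rightarrow> 'a set" for A where
  zero: "0 \<in> generated_monoid A"
| gen: "x \<in> A \<Longrightarrow> x \<in> generated_monoid A"
| add: "x \<in> generated_monoid A \<Longrightarrow> y \<in> generated_monoid A \<Longrightarrow> x + y \<in> generated_monoid A"

text \<open>\<open>K[S]\<close> for a submonoid \<open>S\<close>; multiplication of finitely supported functions is convolution.\<close>
definition semigroup_ring :: "'s::comm_monoid_add set \<Rightarrow> ('s \<Rightarrow>\<^sub>0 'k::field) ring" where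
  "semigroup_ring S =
     \<lparr>carrier = {f. Poly_Mapping.keys f \<subseteq> S},
      monoid.mult = (*), monoid.one = 1, ring.zero = 0, add = (+)\<rparr>"

definition semigroup_ring_irrelevant :: "'s::comm_monoid_add set \<Rightarrow> ('s \<Rightarrow>\<^sub>0 'k::field) set" where
  "semigroup_ring_irrelevant S =
     Idl\<^bsub>semigroup_ring S :: ('s \<Rightarrow>\<^sub>0 'k) ring\<^esub> ((\<lambda>u. Poly_Mapping.single u 1) ` (S - {0}))"

definition homogeneous_part ::
  "('s \<Rightarrow> real) \<Rightarrow> 's set \<Rightarrow> int \<Rightarrow> ('s \<Rightarrow>\<^sub>0 'k::zero) set" where
  "homogeneous_part wt S n =
     {f. Poly_Mapping.keys f \<subseteq> S \<and> (\<forall>u\<in>Poly_Mapping.keys f. wt u = of_int n)}"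

definition semigroup_ring_module ::
  "('s \<Rightarrow> real) \<Rightarrow> 's::comm_monoid_add set \<Rightarrow> ('s \<Rightarrow>\<^sub>0 'k::field, 's \<Rightarrow>\<^sub>0 'k) gmodule" where
  "semigroup_ring_module wt S =
     \<lparr>carrier = {f. Poly_Mapping.keys f \<subseteq> S},
      monoid.mult = (*), monoid.one = 1, ring.zero = 0, add = (+),
      smult = (*), gpart = homogeneous_part wt S\<rparr>"

definition field_ring :: "'k::field ring" where
  "field_ring = \<lparr>carrier = UNIV, monoid.mult = (*), monoid.one = 1, ring.zero = 0, add = (+)\<rparr>"

text \<open>The graded \<open>K\<close>-vector space with basis \<open>L\<close>, where \<open>w \<in> L\<close> is placed in degree \<open>wt w\<close>.\<close>
definition graded_vector_space_on :: "('s \<Rightarrow> real) \<Rightarrow> 's set \<Rightarrow> ('k::field, 's \<Rightarrow>\<^sub>0 'k) gmodule" where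
  "graded_vector_space_on wt L =
     \<lparr>carrier = {f. Poly_Mapping.keys f \<subseteq> L},
      monoid.mult = undefined, monoid.one = undefined, ring.zero = 0, add = (+),
      smult = (\<lambda>c f. Poly_Mapping.map ((*) c) f), gpart = homogeneous_part wt L\<rparr>"

text \<open>Restriction of scalars along \<open>K \<rightarrow> K[S]\<close>.\<close>
definition as_vector_space ::
  "('s::comm_monoid_add \<Rightarrow>\<^sub>0 'k::field, 'b) gmodule \<Rightarrow> ('k, 'b) gmodule" where
  "as_vector_space M =
     \<lparr>carrier = carrier M,
      monoid.mult = (\<otimes>\<^bsub>M\<^esub>), monoid.one = \<one>\<^bsub>M\<^esub>,
      ring.zero = \<zero>\<^bsub>M\<^esub>, add = (\<oplus>\<^bsub>M\<^esub>),
      smult = (\<lambda>c x. Poly_Mapping.single 0 c \<odot>\<^bsub>M\<^esub> x), gpart = gpart M\<rparr>"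


section \<open>Numerical data of a projective monomial curve\<close>

definition monomial_degree :: "nat \<Rightarrow> nat \<times> nat \<Rightarrow> real" where
  "monomial_degree d u = (real (fst u) + real (snd u)) / real d"

definition omega :: "nat \<Rightarrow> nat set \<Rightarrow> nat \<Rightarrow> nat" where
  "omega d A j =
     (if j = d then 0 else (LEAST \<alpha>. \<alpha> \<in> generated_monoid A \<and> \<alpha> mod d = j mod d))"

definition delta :: "nat set \<Rightarrow> nat \<Rightarrow> nat" where
  "delta A n = (LEAST s. \<exists>x :: nat \<Rightarrow> nat.
     n = (\<Sum>a\<in>A - {0}. x a * a) \<and> s = (\<Sum>a\<in>A - {0}. x a))"

end

(*
  Put S' = saturation: the monomials u with u + n(0,d) and u + n(d,0) in S for large n.  A minimal
  element w_i fails to lie in S exactly when delta_1(w_i) > deg(w_i), and comparing delta_1 and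
  delta_2 with the degree along w_i + (n_1 d, n_2 d) identifies L' with S' - S.

  In a graded injective resolution E of K[S], a class in H^1 is represented by D_0 y with y in E_0
  such that high powers of t^d and s^d carry y into K[S].  Dividing by these powers assigns to y an
  element of K[S'], and injectivity of E_0 extends the augmentation to K[S'] -> E_0; therefore
  H^1 = K[S'] / K[S].  The degree, length and vector space statements follow from the monomial basis
  S' - S of this quotient.

  If S' = S, then t^d, s^d is a regular sequence, so the depth is at least 2.  Neither the depth nor
  the Krull dimension exceeds 2: any three elements x, y, z of K[S] are algebraically dependent, and
  factoring out the lexicographically lowest monomial of a relation gives an identity
  x^i (y^j (z^l (c + z ..) + y ..) + x ..) = 0 with a nonzero constant c, which excludes both a chain
  of four primes and a regular sequence of length 3.  Hence L' is nonempty when K[S] is not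
  Cohen-Macaulay.
*)
theory Submission
  imports Defs "HOL-Library.Product_Lexorder"
begin

section \<open>Finitely supported functions and semigroup rings\<close>

text \<open>The point (a, b) stands for the monomial s^a t^b, so \<open>X0\<close> and
  \<open>X1\<close> below are t^d and s^d. All generators of S have coordinate sum d, so an element
  of level n is a sum of exactly n generators, and copies of (0, d) can pad a shorter representation
  of its first coordinate. Hence membership in S depends only on the first coordinate and the level,
  and by the symmetry h -> d - h equally on the second coordinate and the level. Switching between
  the two criteria produces the bounds in L'.

  The homological obstacle is that the resolution is arbitrary, while
  \<open>graded_injective\<close> offers only test modules whose carriers lie in the type of E. So
  monomial ideals of K[S] are copied into E 0 along \<epsilon>, with a degree shift, and K[S']
  enters as its translate by a power of t^d. One power suffices because S' - S is finite. Torsion is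
  tested on powers of t^d and s^d alone, since the ideal generated by any two such powers contains a
  power of m.\<close>

definition supported :: "'s set \<Rightarrow> ('s \<Rightarrow>\<^sub>0 'k::zero) set" where
  "supported T = {f. Poly_Mapping.keys f \<subseteq> T}"

lift_definition restrict_to :: "'s set \<Rightarrow> ('s \<Rightarrow>\<^sub>0 'k::zero) \<Rightarrow> ('s \<Rightarrow>\<^sub>0 'k)"
  is "\<lambda>T f u. if u \<in> T then f u else 0"
  by (rule finite_subset) auto

lemma lookup_restrict_to:
  "Poly_Mapping.lookup (restrict_to T f) u = (if u \<in> T then Poly_Mapping.lookup f u else 0)"
  by transfer simp

lemma keys_restrict_to: "Poly_Mapping.keys (restrict_to T f) = Poly_Mapping.keys f \<inter> T"
  by (auto simp: in_keys_iff lookup_restrict_to split: if_splits)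

lemma restrict_to_split:
  fixes f :: "'s \<Rightarrow>\<^sub>0 'k::comm_monoid_add"
  shows "f = restrict_to T f + restrict_to (- T) f"
  by (rule poly_mapping_eqI) (simp add: lookup_add lookup_restrict_to)

lemma restrict_to_in_supported: "f \<in> supported U \<Longrightarrow> restrict_to T f \<in> supported (U \<inter> T)"
  by (auto simp: supported_def keys_restrict_to)

lemma supported_mono: "T \<subseteq> U \<Longrightarrow> supported T \<subseteq> supported U"
  by (auto simp: supported_def)

lemma supported_zero [simp]: "0 \<in> supported T"
  by (simp add: supported_def)

lemma supported_add:
  fixes f g :: "'s \<Rightarrow>\<^sub>0 'k::comm_monoid_add"
  shows "f \<in> supported T \<Longrightarrow> g \<in> supported T \<Longrightarrow> f + g \<in> supported T"
  using Poly_Mapping.keys_add[of f g] by (auto simp: supported_def)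

lemma supported_uminus:
  fixes f :: "'s \<Rightarrow>\<^sub>0 'k::ab_group_add"
  shows "f \<in> supported T \<Longrightarrow> - f \<in> supported T"
  by (auto simp: supported_def in_keys_iff)

lemma supported_diff:
  fixes f g :: "'s \<Rightarrow>\<^sub>0 'k::ab_group_add"
  shows "f \<in> supported T \<Longrightarrow> g \<in> supported T \<Longrightarrow> f - g \<in> supported T"
  using supported_add[of f T "- g"] supported_uminus[of g T] by simp

lemma supported_sum:
  fixes f :: "'i \<Rightarrow> 's \<Rightarrow>\<^sub>0 'k::comm_monoid_add"
  shows "(\<And>i. i \<in> I \<Longrightarrow> f i \<in> supported T) \<Longrightarrow> sum f I \<in> supported T"
  by (induction I rule: infinite_finite_induct) (auto intro: supported_add)

lemma supported_single: "u \<in> T \<Longrightarrow> Poly_Mapping.single u c \<in> supported T"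
  by (simp add: supported_def)

lemma supported_mult:
  fixes f g :: "'s::monoid_add \<Rightarrow>\<^sub>0 'k::semiring_0"
  assumes "f \<in> supported T" "g \<in> supported U" "\<And>t u. t \<in> T \<Longrightarrow> u \<in> U \<Longrightarrow> t + u \<in> V"
  shows "f * g \<in> supported V"
  using Poly_Mapping.keys_mult[of f g] assms by (fastforce simp: supported_def)

lemma supported_Int_disjoint:
  "f \<in> supported T \<Longrightarrow> f \<in> supported U \<Longrightarrow> T \<inter> U = {} \<Longrightarrow> f = 0"
  by (auto simp: supported_def simp flip: keys_eq_empty)

lemma lookup_single_mult:
  fixes f :: "'s::cancel_comm_monoid_add \<Rightarrow>\<^sub>0 'k::semiring_0"
  shows "Poly_Mapping.lookup (Poly_Mapping.single v c * f) (v + u) = c * Poly_Mapping.lookup f u"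
proof -
  have "(\<Sum>q. Poly_Mapping.lookup f q when v + u = v + q) = Poly_Mapping.lookup f u"
    by (simp add: when_def if_distrib eq_commute cong: if_cong)
  then show ?thesis
    by (simp add: lookup_mult lookup_single when_mult)
qed

lemma keys_single_one_mult:
  fixes f :: "'s::cancel_comm_monoid_add \<Rightarrow>\<^sub>0 'k::semiring_1"
  shows "Poly_Mapping.keys (Poly_Mapping.single v 1 * f) = (+) v ` Poly_Mapping.keys f"
proof
  show "Poly_Mapping.keys (Poly_Mapping.single v 1 * f) \<subseteq> (+) v ` Poly_Mapping.keys f"
    using Poly_Mapping.keys_mult[of "Poly_Mapping.single v 1" f]
    by (auto split: if_splits)
  show "(+) v ` Poly_Mapping.keys f \<subseteq> Poly_Mapping.keys (Poly_Mapping.single v 1 * f)"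
    by (auto simp: in_keys_iff lookup_single_mult)
qed

lemma single_one_mult_cancel:
  fixes f g :: "'s::cancel_comm_monoid_add \<Rightarrow>\<^sub>0 'k::semiring_1"
  assumes "Poly_Mapping.single v 1 * f = Poly_Mapping.single v 1 * g"
  shows "f = g"
proof (rule poly_mapping_eqI)
  fix u
  show "Poly_Mapping.lookup f u = Poly_Mapping.lookup g u"
    using arg_cong[OF assms, of "\<lambda>h. Poly_Mapping.lookup h (v + u)"]
    by (simp add: lookup_single_mult)
qed

text \<open>Exact division by a monomial. It stands in for localisation: a quotient such as f /
  t^(Nd) is formed only once all exponents of f are known to be translates.\<close>

lemma supported_translateE:
  fixes f :: "'s::cancel_comm_monoid_add \<Rightarrow>\<^sub>0 'k::semiring_1"
  assumes "f \<in> supported ((+) v ` T)"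
  obtains g where "g \<in> supported T" "f = Poly_Mapping.single v 1 * g"
proof
  let ?g = "Poly_Mapping.map_key ((+) v) f"
  have inj: "inj ((+) v)" by (simp add: inj_on_def)
  have look: "Poly_Mapping.lookup ?g u = Poly_Mapping.lookup f (v + u)" for u
    by (simp add: map_key.rep_eq[OF inj])
  show "?g \<in> supported T"
    using assms by (fastforce simp: supported_def in_keys_iff look)
  show "f = Poly_Mapping.single v 1 * ?g"
  proof (rule poly_mapping_eqI)
    fix w
    show "Poly_Mapping.lookup f w = Poly_Mapping.lookup (Poly_Mapping.single v 1 * ?g) w"
    proof (cases "w \<in> range ((+) v)")
      case True
      then show ?thesis by (auto simp: lookup_single_mult look)
    next
      case False
      then have "w \<notin> Poly_Mapping.keys f" "w \<notin> Poly_Mapping.keys (Poly_Mapping.single v 1 * ?g)"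
        using assms by (auto simp: supported_def keys_single_one_mult)
      then show ?thesis by (simp add: in_keys_iff)
    qed
  qed
qed

lemma single_one_mult_single_one:
  "Poly_Mapping.single u 1 * Poly_Mapping.single v 1 = Poly_Mapping.single (u + v) (1::'k::semiring_1)"
  by (simp add: mult_single)

lemma poly_mapping_sum_singles:
  fixes f :: "'s \<Rightarrow>\<^sub>0 'k::comm_monoid_add"
  shows "f = (\<Sum>u\<in>Poly_Mapping.keys f. Poly_Mapping.single u (Poly_Mapping.lookup f u))"
  by (rule poly_mapping_eqI)
    (auto simp: lookup_sum lookup_single when_def in_keys_iff)

section \<open>Semigroup rings of submonoids\<close>

locale submonoid_set =
  fixes S :: "'s::comm_monoid_add set"
  assumes zero_mem [simp]: "0 \<in> S" and add_mem: "u \<in> S \<Longrightarrow> v \<in> S \<Longrightarrow> u + v \<in> S"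
begin

abbreviation R :: "('s \<Rightarrow>\<^sub>0 'k::field) ring" where "R \<equiv> semigroup_ring S"

lemma carrier_semigroup_ring: "carrier R = supported S"
  by (simp add: semigroup_ring_def supported_def)

lemma semigroup_ring_simps [simp]:
  "\<zero>\<^bsub>R\<^esub> = 0" "\<one>\<^bsub>R\<^esub> = 1" "f \<oplus>\<^bsub>R\<^esub> g = f + g" "f \<otimes>\<^bsub>R\<^esub> g = f * g"
  by (simp_all add: semigroup_ring_def)

lemma supported_mult_closed:
  fixes f g :: "'s \<Rightarrow>\<^sub>0 'k::semiring_0"
  shows "f \<in> supported S \<Longrightarrow> g \<in> supported S \<Longrightarrow> f * g \<in> supported S"
  by (rule supported_mult) (auto intro: add_mem)

lemma supported_one [simp]: "(1 :: 's \<Rightarrow>\<^sub>0 'k::semiring_1) \<in> supported S"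
  by (simp add: supported_def)

lemma supported_power:
  fixes f :: "'s \<Rightarrow>\<^sub>0 'k::semiring_1"
  shows "f \<in> supported S \<Longrightarrow> f ^ n \<in> supported S"
  by (induction n) (auto intro: supported_mult_closed)

lemma cring_semigroup_ring: "cring (R :: ('s \<Rightarrow>\<^sub>0 'k::field) ring)"
proof (rule cringI)
  show "abelian_group (R :: ('s \<Rightarrow>\<^sub>0 'k::field) ring)"
  proof (rule abelian_groupI)
    fix x :: "'s \<Rightarrow>\<^sub>0 'k" assume "x \<in> carrier R"
    then show "\<exists>y\<in>carrier R. y \<oplus>\<^bsub>R\<^esub> x = \<zero>\<^bsub>R\<^esub>"
      by (intro bexI[of _ "- x"]) (auto simp: carrier_semigroup_ring supported_uminus)
  qed (auto simp: carrier_semigroup_ring supported_add ac_simps)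
  show "comm_monoid (R :: ('s \<Rightarrow>\<^sub>0 'k::field) ring)"
    by (rule comm_monoidI) (auto simp: carrier_semigroup_ring supported_mult_closed ac_simps)
qed (auto simp: carrier_semigroup_ring algebra_simps)

end

text \<open>One layer of the nested factorisation in \<open>lombardi_relation\<close>, where the
  coefficients \<open>p i\<close> are themselves polynomials in the remaining elements.\<close>

lemma (in submonoid_set) factor_lowest_power:
  fixes p :: "nat \<Rightarrow> 's \<Rightarrow>\<^sub>0 'k::comm_ring_1"
  assumes "\<And>i. p i \<in> supported S" "x \<in> supported S" "n \<le> N" "\<And>i. i < n \<Longrightarrow> p i = 0"
  obtains a where "a \<in> supported S" "(\<Sum>i\<le>N. p i * x ^ i) = x ^ n * (p n + x * a)"
proof
  let ?a = "\<Sum>i\<in>{n<..N}. p i * x ^ (i - Suc n)"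
  show "?a \<in> supported S"
    using assms by (intro supported_sum supported_mult_closed supported_power) auto
  have N: "{..N} = {..<n} \<union> {n} \<union> {n<..N}" using assms(3) by auto
  have "(\<Sum>i\<le>N. p i * x ^ i) = (\<Sum>i\<in>{..<n} \<union> {n}. p i * x ^ i) + (\<Sum>i\<in>{n<..N}. p i * x ^ i)"
    unfolding N by (rule sum.union_disjoint) auto
  also have "(\<Sum>i\<in>{..<n} \<union> {n}. p i * x ^ i) = x ^ n * p n"
    using assms(4) by (simp add: ac_simps)
  also have "(\<Sum>i\<in>{n<..N}. p i * x ^ i) = (\<Sum>i\<in>{n<..N}. x ^ n * x * (p i * x ^ (i - Suc n)))"
  proof (rule sum.cong)
    fix i assume "i \<in> {n<..N}"
    then obtain m where "i = n + Suc m" by (auto simp: less_iff_Suc_add)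
    then have "x ^ i = x ^ n * x * x ^ (i - Suc n)" by (simp add: power_add ac_simps)
    then show "p i * x ^ i = x ^ n * x * (p i * x ^ (i - Suc n))" by (simp add: ac_simps)
  qed simp
  also have "\<dots> = x ^ n * x * ?a" by (simp add: sum_distrib_left)
  finally show "(\<Sum>i\<le>N. p i * x ^ i) = x ^ n * (p n + x * ?a)" by (simp add: algebra_simps)
qed

section \<open>Krull dimension and depth of plane semigroup rings\<close>

text \<open>With a translation-invariant linear order on exponents, extreme terms multiply without
  cancellation, so K[N^2] has no zero divisors; \<open>face_primeideal\<close> rests on
  this.\<close>

instance prod :: ("{linorder, ordered_cancel_comm_monoid_add}", "{linorder, ordered_cancel_comm_monoid_add}")
  ordered_cancel_comm_monoid_add
proof
  fix a b c :: "'a \<times> 'b"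
  show "a \<le> b \<Longrightarrow> c + a \<le> c + b"
    by (auto simp: less_eq_prod_def add_strict_left_mono add_left_mono)
qed

section \<open>Linear algebra over K and algebraic dependence\<close>

interpretation poly_mapping: vector_space
  "\<lambda>(c::'k::field) (f :: 's::comm_monoid_add \<Rightarrow>\<^sub>0 'k). Poly_Mapping.single 0 c * f"
  by standard (simp_all add: algebra_simps single_add mult_single flip: mult.assoc)

lemma single_eq_scaled: "Poly_Mapping.single u (c::'k::semiring_1) = Poly_Mapping.single 0 c * Poly_Mapping.single u 1"
  by (simp add: mult_single)

lemma supported_span: "supported T \<subseteq> poly_mapping.span ((\<lambda>u. Poly_Mapping.single u (1::'k::field)) ` T)"
proof
  fix f :: "'a \<Rightarrow>\<^sub>0 'k"
  assume f: "f \<in> supported T"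
  have "(\<Sum>u\<in>Poly_Mapping.keys f. Poly_Mapping.single u (Poly_Mapping.lookup f u))
      \<in> poly_mapping.span ((\<lambda>u. Poly_Mapping.single u (1::'k)) ` T)"
    using f by (subst single_eq_scaled)
      (intro poly_mapping.span_sum poly_mapping.span_scale poly_mapping.span_base,
        auto simp: supported_def)
  then show "f \<in> poly_mapping.span ((\<lambda>u. Poly_Mapping.single u (1::'k)) ` T)"
    using poly_mapping_sum_singles[of f] by simp
qed

text \<open>Stated for indexed families because the monomials in x, y, z to which it is applied may
  coincide as elements, and a repetition must also count as a dependence.\<close>

lemma (in vector_space) family_dependent:
  assumes "finite I" "finite B" "\<And>i. i \<in> I \<Longrightarrow> f i \<in> span B" "card B < card I"
  shows "\<exists>c. (\<exists>i\<in>I. c i \<noteq> 0) \<and> (\<Sum>i\<in>I. c i *s f i) = 0"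
proof (cases "inj_on f I")
  case True
  have "dependent (f ` I)"
  proof (rule ccontr)
    assume "independent (f ` I)"
    with assms(2) have "card (f ` I) \<le> card B"
      using independent_span_bound[of B "f ` I"] assms(3) by blast
    with assms(4) show False by (simp add: card_image[OF True])
  qed
  then obtain u where u: "\<exists>v\<in>f ` I. u v \<noteq> 0" "(\<Sum>v\<in>f ` I. u v *s v) = 0"
    using dependent_finite[of "f ` I"] assms(1) by auto
  then show ?thesis
    by (intro exI[of _ "u \<circ> f"]) (auto simp: sum.reindex[OF True])
next
  case False
  then obtain i j where ij: "i \<in> I" "j \<in> I" "i \<noteq> j" "f i = f j" by (auto simp: inj_on_def)
  let ?c = "\<lambda>l. if l = i then 1 else if l = j then -1 else 0"
  have "(\<Sum>l\<in>I. ?c l *s f l) = (\<Sum>l\<in>{i, j}. ?c l *s f l)"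
    using ij assms(1) by (intro sum.mono_neutral_right) auto
  also have "\<dots> = 0" using ij by simp
  finally show ?thesis using ij by (intro exI[of _ ?c]) auto
qed

lemma supported_power_bound:
  fixes x :: "nat \<times> nat \<Rightarrow>\<^sub>0 'k::field"
  assumes "x \<in> supported {u. fst u + snd u \<le> C}"
  shows "x ^ n \<in> supported {u. fst u + snd u \<le> C * n}"
proof (induction n)
  case 0
  then show ?case by (simp add: supported_def)
next
  case (Suc n)
  show ?case by (simp only: power_Suc) (rule supported_mult[OF assms Suc], auto)
qed

text \<open>The \<open>(N + 1)\<^sup>3\<close> monomials of bounded exponent
  live in a space of dimension \<open>O(N\<^sup>2)\<close>.\<close>

lemma algebraically_dependent:
  fixes x y z :: "nat \<times> nat \<Rightarrow>\<^sub>0 'k::field"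
  obtains N c where "\<exists>i\<le>N. \<exists>j\<le>N. \<exists>l\<le>N. c i j l \<noteq> 0"
    "(\<Sum>i\<le>N. (\<Sum>j\<le>N. (\<Sum>l\<le>N. Poly_Mapping.single 0 (c i j l) * z ^ l) * y ^ j) * x ^ i) = 0"
proof -
  \<comment> \<open>\<open>C\<close> bounds the total degree of x, y and z, so a product of at most
    N-th powers of them has total degree at most 3 * C * N. The inserted 0 covers x = y = z =
    0.\<close>
  define C where "C = Max (insert 0 ((\<lambda>u. fst u + snd u) `
    (Poly_Mapping.keys x \<union> Poly_Mapping.keys y \<union> Poly_Mapping.keys z)))"
  have C: "x \<in> supported {u. fst u + snd u \<le> C}" "y \<in> supported {u. fst u + snd u \<le> C}"
      "z \<in> supported {u. fst u + snd u \<le> C}"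
    by (auto simp: supported_def C_def intro!: Max_ge)
  \<comment> \<open>Chosen so that (3 * C * N + 1)^2 \<le> ((3 * C + 1) * (N + 1))^2 = N * (N +
    1)^2, which is below the number (N + 1)^3 of monomials.\<close>
  define N where "N = (3 * C + 1)\<^sup>2"
  define I where "I = {..N} \<times> {..N} \<times> {..N}"
  define B where "B = (\<lambda>u. Poly_Mapping.single u (1::'k)) ` ({..3 * C * N} \<times> {..3 * C * N})"
  define g where "g = (\<lambda>(i, j, l). z ^ l * y ^ j * x ^ i)"
  have "g p \<in> poly_mapping.span B" if "p \<in> I" for p
  proof -
    obtain i j l where ijl: "p = (i, j, l)" by (cases p)
    with that have p: "p = (i, j, l)" "i \<le> N" "j \<le> N" "l \<le> N" by (auto simp: I_def)
    have "z ^ l * y ^ j \<in> supported {u. fst u + snd u \<le> C * l + C * j}"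
      by (rule supported_mult[OF C(3)[THEN supported_power_bound] C(2)[THEN supported_power_bound]]) auto
    then have "z ^ l * y ^ j * x ^ i \<in> supported {u. fst u + snd u \<le> C * l + C * j + C * i}"
      by (rule supported_mult[OF _ C(1)[THEN supported_power_bound]]) auto
    moreover have "C * l + C * j + C * i \<le> 3 * C * N"
      using mult_le_mono2[OF p(2), of C] mult_le_mono2[OF p(3), of C] mult_le_mono2[OF p(4), of C]
      by linarith
    ultimately have "g p \<in> supported ({..3 * C * N} \<times> {..3 * C * N})"
      by (force simp: g_def p supported_def)
    then show ?thesis using supported_span by (auto simp: B_def)
  qed
  moreover have "card B < card I"
  proof -
    have "card B \<le> (3 * C * N + 1)\<^sup>2"
      unfolding B_def by (rule order_trans[OF card_image_le]) (auto simp: power2_eq_square)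
    also have "\<dots> \<le> ((3 * C + 1) * (N + 1))\<^sup>2"
      by (intro power_mono) (auto simp: algebra_simps)
    also have "\<dots> = N * (N + 1)\<^sup>2" by (simp only: N_def power_mult_distrib)
    also have "\<dots> < (N + 1) * (N + 1)\<^sup>2" by simp
    also have "\<dots> = card I" by (simp add: I_def power2_eq_square)
    finally show ?thesis .
  qed
  ultimately obtain c where c: "\<exists>p\<in>I. c p \<noteq> 0" "(\<Sum>p\<in>I. Poly_Mapping.single 0 (c p) * g p) = 0"
    using poly_mapping.family_dependent[of I B g] by (auto simp: I_def B_def)
  show thesis
  proof
    show "\<exists>i\<le>N. \<exists>j\<le>N. \<exists>l\<le>N. c (i, j, l) \<noteq> 0" using c(1) by (auto simp: I_def)
    have "0 = (\<Sum>(i, j, l)\<in>I. Poly_Mapping.single 0 (c (i, j, l)) * (z ^ l * y ^ j * x ^ i))"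
      using c(2) by (simp add: g_def case_prod_unfold)
    also have "\<dots> = (\<Sum>i\<le>N. \<Sum>j\<le>N. \<Sum>l\<le>N. Poly_Mapping.single 0 (c (i, j, l)) * (z ^ l * y ^ j * x ^ i))"
      by (simp add: I_def sum.cartesian_product)
    finally show "(\<Sum>i\<le>N. (\<Sum>j\<le>N. (\<Sum>l\<le>N. Poly_Mapping.single 0 (c (i, j, l)) * z ^ l) * y ^ j) * x ^ i) = 0"
      by (simp add: sum_distrib_right mult.assoc)
  qed
qed

locale plane_submonoid = submonoid_set S for S :: "(nat \<times> nat) set"
begin

text \<open>The lexicographically lowest monomial of an algebraic relation between three elements can be
  factored out, as in the Coquand--Lombardi characterisation of Krull dimension.\<close>

lemma lombardi_relation:
  fixes x y z :: "nat \<times> nat \<Rightarrow>\<^sub>0 'k::field"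
  assumes "x \<in> supported S" "y \<in> supported S" "z \<in> supported S"
  obtains i j l a b c and \<kappa> :: 'k
    where "\<kappa> \<noteq> 0" "a \<in> supported S" "b \<in> supported S" "c \<in> supported S"
    "x ^ i * (y ^ j * (z ^ l * (Poly_Mapping.single 0 \<kappa> + z * c) + y * b) + x * a) = 0"
proof -
  obtain N c where c: "\<exists>i\<le>N. \<exists>j\<le>N. \<exists>l\<le>N. c i j l \<noteq> 0"
    "(\<Sum>i\<le>N. (\<Sum>j\<le>N. (\<Sum>l\<le>N. Poly_Mapping.single 0 (c i j l) * z ^ l) * y ^ j) * x ^ i) = 0"
    using algebraically_dependent .
  define r where "r = (\<lambda>i j l. Poly_Mapping.single (0::nat \<times> nat) (c i j l))"
  define q where "q = (\<lambda>i j. \<Sum>l\<le>N. r i j l * z ^ l)"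
  define p where "p = (\<lambda>i. \<Sum>j\<le>N. q i j * y ^ j)"
  have r: "r i j l \<in> supported S" for i j l by (simp add: r_def supported_single)
  have q: "q i j \<in> supported S" for i j
    unfolding q_def using assms r by (intro supported_sum supported_mult_closed supported_power)
  have p: "p i \<in> supported S" for i
    unfolding p_def using assms q by (intro supported_sum supported_mult_closed supported_power)
  \<comment> \<open>The three minima are taken over the scalars \<open>c\<close>, not over the
    elements \<open>p i\<close> and \<open>q i j\<close>: these may vanish through dependence of y
    and z, whereas the constant \<open>r i j l\<close> reached at the end is certainly
    nonzero.\<close>
  define i where "i = (LEAST i. i \<le> N \<and> (\<exists>j\<le>N. \<exists>l\<le>N. c i j l \<noteq> 0))"
  have i: "i \<le> N \<and> (\<exists>j\<le>N. \<exists>l\<le>N. c i j l \<noteq> 0)"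
    unfolding i_def by (rule LeastI_ex) (use c in blast)
  define j where "j = (LEAST j. j \<le> N \<and> (\<exists>l\<le>N. c i j l \<noteq> 0))"
  have j: "j \<le> N \<and> (\<exists>l\<le>N. c i j l \<noteq> 0)"
    unfolding j_def by (rule LeastI_ex) (use i in blast)
  define l where "l = (LEAST l. l \<le> N \<and> c i j l \<noteq> 0)"
  have l: "l \<le> N \<and> c i j l \<noteq> 0"
    unfolding l_def by (rule LeastI_ex) (use j in blast)
  have i0: "p i' = 0" if "i' < i" for i'
    using not_less_Least[OF that[unfolded i_def]] that i
    by (auto simp: p_def q_def r_def intro!: sum.neutral)
  have j0: "q i j' = 0" if "j' < j" for j'
    using not_less_Least[OF that[unfolded j_def]] that j
    by (auto simp: q_def r_def intro!: sum.neutral)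
  have l0: "r i j l' = 0" if "l' < l" for l'
    using not_less_Least[OF that[unfolded l_def]] that l by (auto simp: r_def)
  obtain a where a: "a \<in> supported S" "(\<Sum>i\<le>N. p i * x ^ i) = x ^ i * (p i + x * a)"
    using factor_lowest_power[of p x i N] p assms i i0 by blast
  obtain b where b: "b \<in> supported S" "p i = y ^ j * (q i j + y * b)"
    using factor_lowest_power[of "q i" y j N] q assms j j0 unfolding p_def by blast
  obtain e where e: "e \<in> supported S" "q i j = z ^ l * (r i j l + z * e)"
    using factor_lowest_power[of "r i j" z l N] r assms l l0 unfolding q_def by blast
  have "(\<Sum>i\<le>N. p i * x ^ i) = 0" using c(2) by (simp add: p_def q_def r_def)
  then have "x ^ i * (y ^ j * (z ^ l * (Poly_Mapping.single 0 (c i j l) + z * e) + y * b) + x * a) = 0"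
    using a(2) b(2) e(2) by (simp add: r_def)
  then show thesis using that[of "c i j l" a b e i j l] a b e l by blast
qed

section \<open>Upper bounds for Krull dimension and depth\<close>

lemma ideal_add_cancel:
  fixes J :: "(nat \<times> nat \<Rightarrow>\<^sub>0 'k::field) set"
  assumes "ideal J R" "f + x * g \<in> J" "x \<in> J" "g \<in> supported S"
  shows "f \<in> J"
proof -
  have "(- 1 * g) \<otimes>\<^bsub>R\<^esub> x \<in> J"
    using assms(4) by (intro ideal.I_l_closed[OF assms(1,3)])
      (auto simp: carrier_semigroup_ring supported_uminus)
  with assms(2) have "(f + x * g) \<oplus>\<^bsub>R\<^esub> ((- 1 * g) \<otimes>\<^bsub>R\<^esub> x) \<in> J"
    using additive_subgroup.a_closed[OF ideal.axioms(1)[OF assms(1)]] by blast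
  then show ?thesis by (simp add: algebra_simps)
qed

text \<open>Both a chain of four primes and a regular sequence of length three would give such ideals.\<close>

lemma regular_ideal_chain_improper:
  fixes J :: "nat \<Rightarrow> (nat \<times> nat \<Rightarrow>\<^sub>0 'k::field) set"
  assumes J: "\<And>i. i \<le> 3 \<Longrightarrow> ideal (J i) R"
    and mono: "\<And>i. i < 3 \<Longrightarrow> J i \<subseteq> J (Suc i)"
    and x: "\<And>i. i < 3 \<Longrightarrow> x i \<in> J (Suc i)"
    and reg: "\<And>i r. i < 3 \<Longrightarrow> r \<in> supported S \<Longrightarrow> x i * r \<in> J i \<Longrightarrow> r \<in> J i"
  shows "1 \<in> J 3"
proof -
  have xS: "x i \<in> supported S" if "i < 3" for i
    using ideal.Icarr[OF J[of "Suc i"] x[of i]] that by (simp add: carrier_semigroup_ring)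
  have pow: "r \<in> J i" if "i < 3" "r \<in> supported S" "x i ^ n * r \<in> J i" for i n r
    using that(3)
  proof (induction n)
    case (Suc n)
    then show ?case
      using reg[of i "x i ^ n * r"] that xS by (simp add: supported_mult_closed supported_power mult.assoc)
  qed simp
  have x012: "x 0 \<in> supported S" "x 1 \<in> supported S" "x 2 \<in> supported S"
    by (auto intro: xS)
  obtain i j l a b c and \<kappa> :: 'k where \<kappa>: "\<kappa> \<noteq> 0"
    and S: "a \<in> supported S" "b \<in> supported S" "c \<in> supported S"
    and rel: "x 0 ^ i * (x 1 ^ j * (x 2 ^ l * (Poly_Mapping.single 0 \<kappa> + x 2 * c) + x 1 * b) + x 0 * a) = 0"
    using lombardi_relation[OF x012] by metis
  note closed = supported_add supported_mult_closed supported_power xS S supported_single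
  let ?h2 = "Poly_Mapping.single 0 \<kappa> + x 2 * c"
  let ?h1 = "x 2 ^ l * ?h2 + x 1 * b"
  let ?h0 = "x 1 ^ j * ?h1 + x 0 * a"
  have h2: "?h2 \<in> supported S" by (intro closed) auto
  have h1: "?h1 \<in> supported S" by (intro closed h2) auto
  have h0: "?h0 \<in> supported S" by (intro closed h1) auto
  have "\<zero>\<^bsub>R\<^esub> \<in> J 0" by (rule additive_subgroup.zero_closed[OF ideal.axioms(1)[OF J]]) simp
  then have "x 0 ^ i * ?h0 \<in> J 0" unfolding rel by simp
  \<comment> \<open>The relation is peeled from the outside: regularity modulo \<open>J 0\<close>
    cancels the power of \<open>x 0\<close>, and then the summand \<open>x 0 * a\<close> disappears
    modulo \<open>J 1\<close>. The same happens with \<open>x 1\<close> and \<open>x 2\<close>,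
    until a nonzero constant is left in \<open>J 3\<close>.\<close>
  then have "?h0 \<in> J 1" using pow[of 0 ?h0 i] h0 mono[of 0] by auto
  then have "x 1 ^ j * ?h1 \<in> J 1" using J[of 1] x[of 0] S by (elim ideal_add_cancel[rotated]) auto
  then have "?h1 \<in> J 2" using pow[of 1 ?h1 j] h1 mono[of 1] by (auto simp: numeral_2_eq_2)
  then have "x 2 ^ l * ?h2 \<in> J 2"
    using J[of 2] x[of 1] S by (elim ideal_add_cancel[rotated]) (auto simp: numeral_2_eq_2)
  then have "?h2 \<in> J 3" using pow[of 2 ?h2 l] h2 mono[of 2] by (auto simp: numeral_3_eq_3 numeral_2_eq_2)
  then have k: "Poly_Mapping.single 0 \<kappa> \<in> J 3"
    using J[of 3] x[of 2] S by (elim ideal_add_cancel[rotated]) (auto simp: numeral_3_eq_3 numeral_2_eq_2)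
  have "Poly_Mapping.single 0 (inverse \<kappa>) \<otimes>\<^bsub>R\<^esub> Poly_Mapping.single 0 \<kappa> \<in> J 3"
    by (rule ideal.I_l_closed[OF J k]) (auto simp: carrier_semigroup_ring supported_single)
  then show ?thesis using \<kappa> by (simp add: mult_single)
qed

lemma krull_dim_le: "krull_dim (R :: (nat \<times> nat \<Rightarrow>\<^sub>0 'k::field) ring) \<le> 2"
  unfolding krull_dim_def
proof (rule Sup_least, clarify)
  fix n and P :: "nat \<Rightarrow> (nat \<times> nat \<Rightarrow>\<^sub>0 'k) set"
  assume P: "\<forall>i\<le>n. primeideal (P i) R" "\<forall>i<n. P i \<subset> P (Suc i)"
  have "n \<le> 2"
  proof (rule ccontr)
    assume "\<not> n \<le> 2"
    then have n: "3 \<le> n" by simp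
    \<comment> \<open>An element of the next prime outside the current one is a nonzerodivisor
      modulo the current one; the first four primes of the chain suffice.\<close>
    have "\<forall>i. \<exists>x. i < 3 \<longrightarrow> x \<in> P (Suc i) - P i"
      using P(2) n by (meson DiffI order_less_le_trans psubset_imp_ex_mem)
    then obtain x where x: "\<And>i. i < 3 \<Longrightarrow> x i \<in> P (Suc i) - P i" by metis
    have prime: "primeideal (P i) R" if "i \<le> 3" for i using P(1) n that by simp
    have "1 \<in> P 3"
    proof (rule regular_ideal_chain_improper[of P x])
      fix i r assume i: "i < 3" "r \<in> supported S" "x i * r \<in> P i"
      have "x i \<in> carrier R"
        using x[OF i(1)] prime[of "Suc i"] i(1) ideal.Icarr[OF primeideal.axioms(1)] by fastforce
      then show "r \<in> P i"
        using primeideal.I_prime[OF prime, of i "x i" r] i x[OF i(1)] by (auto simp: carrier_semigroup_ring)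
    next
      fix i :: nat assume i: "i < 3"
      then show "P i \<subseteq> P (Suc i)" using P(2)[rule_format, of i] n by auto
    qed (use prime x in \<open>auto intro: primeideal.axioms\<close>)
    then have "P 3 = carrier R"
      using ideal.one_imp_carrier[OF primeideal.axioms(1)[OF prime[of 3]]] by simp
    then show False using primeideal.I_notcarr[OF prime[of 3]] by simp
  qed
  then show "enat n \<le> 2" by (simp add: numeral_eq_enat)
qed

lemma depth_le: "depth (R :: (nat \<times> nat \<Rightarrow>\<^sub>0 'k::field) ring) I \<le> 2"
  unfolding depth_def
proof (rule Sup_least, clarify)
  fix xs :: "(nat \<times> nat \<Rightarrow>\<^sub>0 'k) list"
  assume reg: "regular_sequence R xs"
  interpret R: cring "R :: (nat \<times> nat \<Rightarrow>\<^sub>0 'k) ring" by (rule cring_semigroup_ring)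
  have xs: "set xs \<subseteq> carrier R" using reg by (simp add: regular_sequence_def)
  have "length xs \<le> 2"
  proof (rule ccontr)
    assume "\<not> length xs \<le> 2"
    then have n: "3 \<le> length xs" by simp
    let ?J = "\<lambda>i. Idl\<^bsub>R\<^esub> (set (take i xs))"
    have sub: "set (take i xs) \<subseteq> carrier R" for i using xs set_take_subset by fast
    have "1 \<in> ?J 3"
    proof (rule regular_ideal_chain_improper[of ?J "\<lambda>i. xs ! i"])
      show "ideal (?J i) R" for i using sub by (rule R.genideal_ideal)
      show "?J i \<subseteq> ?J (Suc i)" for i
        using sub by (intro R.subset_Idl_subset) (auto dest: in_set_takeD
          intro: subsetD[OF set_take_subset_set_take[of i "Suc i" xs]])
      show "xs ! i \<in> ?J (Suc i)" if "i < 3" for i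
        using R.genideal_self[OF sub[of "Suc i"]] n that by (auto simp: take_Suc_conv_app_nth)
      show "r \<in> ?J i" if "i < 3" "r \<in> supported S" "xs ! i * r \<in> ?J i" for i r
        using reg that n by (auto simp: regular_sequence_def carrier_semigroup_ring)
    qed
    \<comment> \<open>A longer sequence is cut off after three terms; if these already generate the
      whole ring, so does the full sequence.\<close>
    moreover have "?J 3 \<subseteq> Idl\<^bsub>R\<^esub> (set xs)"
      using xs by (intro R.subset_Idl_subset set_take_subset)
    ultimately have "Idl\<^bsub>R\<^esub> (set xs) = carrier R"
      using ideal.one_imp_carrier[OF R.genideal_ideal[OF xs]] by auto
    then show False using reg by (simp add: regular_sequence_def)
  qed
  then show "enat (length xs) \<le> 2" by (simp add: numeral_eq_enat)
qed

text \<open>\<open>F\<close> cuts out a face of the monoid S, but may itself contain points outside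
  S. The whole of N^2, the ray \<open>snd u = 0\<close> and the origin give the chain of primes in
  \<open>krull_dim_eq\<close>.\<close>

definition face :: "(nat \<times> nat) set \<Rightarrow> bool" where
  "face F \<longleftrightarrow> 0 \<in> F \<and> (\<forall>u\<in>S. \<forall>v\<in>S. u + v \<in> F \<longleftrightarrow> u \<in> F \<and> v \<in> F)"

text \<open>Modulo this ideal each factor can be replaced by its part supported on \<open>F\<close>.
  The product of the two parts is supported both inside and outside \<open>F\<close>, so it is zero,
  and one part vanishes because K[N^2] is a domain.\<close>

lemma face_primeideal:
  assumes F: "face F"
  shows "primeideal (supported (S - F) :: (nat \<times> nat \<Rightarrow>\<^sub>0 'k::field) set) R"
proof (rule primeidealI)
  show "cring (R :: (nat \<times> nat \<Rightarrow>\<^sub>0 'k) ring)" by (rule cring_semigroup_ring)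
  then interpret R: cring "R :: (nat \<times> nat \<Rightarrow>\<^sub>0 'k) ring" .
  have mult: "f * g \<in> supported (S - F)" if "f \<in> supported (S - F)" "g \<in> supported S"
    for f g :: "nat \<times> nat \<Rightarrow>\<^sub>0 'k"
  proof (rule supported_mult[OF that])
    show "t + u \<in> S - F" if "t \<in> S - F" "u \<in> S" for t u
      using F that add_mem[of t u] unfolding face_def by blast
  qed
  show "ideal (supported (S - F) :: (nat \<times> nat \<Rightarrow>\<^sub>0 'k) set) R"
  proof (rule idealI)
    show "subgroup (supported (S - F) :: (nat \<times> nat \<Rightarrow>\<^sub>0 'k) set) (add_monoid R)"
    proof (rule R.add.subgroupI)
      fix f :: "nat \<times> nat \<Rightarrow>\<^sub>0 'k" assume f: "f \<in> supported (S - F)"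
      then have fS: "f \<in> supported S" by (auto simp: supported_def)
      then have "\<ominus>\<^bsub>R\<^esub> f = - f"
        by (intro R.minus_equality) (auto simp: carrier_semigroup_ring supported_uminus)
      then show "\<ominus>\<^bsub>R\<^esub> f \<in> supported (S - F)" using f by (simp add: supported_uminus)
    next
      show "supported (S - F) \<noteq> ({} :: (nat \<times> nat \<Rightarrow>\<^sub>0 'k) set)"
        using supported_zero by blast
      show "supported (S - F) \<subseteq> carrier (R :: (nat \<times> nat \<Rightarrow>\<^sub>0 'k) ring)"
        by (simp add: carrier_semigroup_ring supported_mono)
    qed (simp add: supported_add)
  qed (use mult R.ring_axioms in \<open>auto simp: carrier_semigroup_ring mult.commute\<close>)
  have "(1 :: nat \<times> nat \<Rightarrow>\<^sub>0 'k) \<notin> supported (S - F)"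
    using F by (simp add: supported_def face_def)
  then show "carrier (R :: (nat \<times> nat \<Rightarrow>\<^sub>0 'k) ring) \<noteq> supported (S - F)"
    using R.one_closed by auto
  fix f g :: "nat \<times> nat \<Rightarrow>\<^sub>0 'k"
  assume "f \<in> carrier R" "g \<in> carrier R" and fg: "f \<otimes>\<^bsub>R\<^esub> g \<in> supported (S - F)"
  then have S: "f \<in> supported S" "g \<in> supported S" by (auto simp: carrier_semigroup_ring)
  define f1 f2 where "f1 = restrict_to F f" and "f2 = restrict_to (- F) f"
  define g1 g2 where "g1 = restrict_to F g" and "g2 = restrict_to (- F) g"
  have f: "f = f1 + f2" and g: "g = g1 + g2"
    unfolding f1_def f2_def g1_def g2_def by (rule restrict_to_split)+
  have m1: "f1 \<in> supported (S \<inter> F)" "g1 \<in> supported (S \<inter> F)"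
    and m2: "f2 \<in> supported (S - F)" "g2 \<in> supported (S - F)"
    using S restrict_to_in_supported[of _ S F] restrict_to_in_supported[of _ S "- F"]
    by (auto simp: f1_def f2_def g1_def g2_def Diff_eq)
  have "f1 * g1 = f * g - (f2 * g + g2 * f1)" by (simp add: f g algebra_simps)
  moreover have "f1 \<in> supported S" using m1 by (auto simp: supported_def)
  ultimately have "f1 * g1 \<in> supported (S - F)"
    using fg by (auto intro!: supported_diff supported_add mult m2 S)
  moreover have "f1 * g1 \<in> supported F"
    by (rule supported_mult[OF m1]) (use F in \<open>auto simp: face_def\<close>)
  ultimately have "f1 * g1 = 0" by (rule supported_Int_disjoint) auto
  then have "f1 = 0 \<or> g1 = 0" by simp
  then show "f \<in> supported (S - F) \<or> g \<in> supported (S - F)" using m2 f g by auto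
qed

end

section \<open>The semigroup of a projective monomial curve\<close>

lemma generated_monoid_scale:
  fixes u :: "nat \<times> nat"
  shows "u \<in> generated_monoid B \<Longrightarrow> (n * fst u, n * snd u) \<in> generated_monoid B"
proof (induction n)
  case 0
  then show ?case using generated_monoid.zero[of B] by (simp add: zero_prod_def)
next
  case (Suc n)
  then show ?case using generated_monoid.add[of u B "(n * fst u, n * snd u)"] by (cases u) simp
qed

lemma generated_monoid_scale_nat:
  fixes u :: nat
  shows "u \<in> generated_monoid B \<Longrightarrow> n * u \<in> generated_monoid B"
  by (induction n) (auto intro: generated_monoid.intros)

lemma generated_monoid_sum:
  "(\<And>i. i \<in> I \<Longrightarrow> f i \<in> generated_monoid B) \<Longrightarrow> sum f I \<in> generated_monoid B"
  by (induction I rule: infinite_finite_induct) (auto intro: generated_monoid.intros)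

text \<open>The hypotheses are invariant under h -> d - h, so every lemma about the first coordinate
  becomes one about the second by interpreting the locale at \<open>A'\<close>.\<close>

locale monomial_curve =
  fixes A :: "nat set" and d :: nat
  assumes A_le: "h \<in> A \<Longrightarrow> h \<le> d" and zero_A: "0 \<in> A" and d_A: "d \<in> A" and d_pos: "0 < d"
    and Gcd_A: "Gcd A = 1"
begin

definition S :: "(nat \<times> nat) set" where "S = generated_monoid ((\<lambda>h. (h, d - h)) ` A)"

definition A' :: "nat set" where "A' = (\<lambda>h. d - h) ` A"

text \<open>The semigroup of all monomials that are multiplied into \<open>S\<close> by large powers of both
  \<open>(0, d)\<close> and \<open>(d, 0)\<close>.\<close>
definition saturation :: "(nat \<times> nat) set" where
  "saturation = {u. fst u \<in> generated_monoid A \<and> snd u \<in> generated_monoid A' \<and> d dvd fst u + snd u}"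

text \<open>Division in nat, which is exact on \<open>saturation\<close>; it replaces the
  real-valued degree wherever the degree is compared with \<open>delta\<close>.\<close>

definition level :: "nat \<times> nat \<Rightarrow> nat" where "level u = (fst u + snd u) div d"

lemma finite_A: "finite A"
  using A_le finite_nat_set_iff_bounded_le by blast

sublocale plane_submonoid S
  by unfold_locales (auto simp: S_def intro: generated_monoid.intros)

sublocale sat: plane_submonoid saturation
proof unfold_locales
  show "0 \<in> saturation" by (simp add: saturation_def generated_monoid.zero)
  fix u v assume uv: "u \<in> saturation" "v \<in> saturation"
  have "d dvd (fst u + snd u) + (fst v + snd v)"
    by (rule dvd_add) (use uv in \<open>auto simp: saturation_def\<close>)
  then show "u + v \<in> saturation"
    using uv by (auto simp: saturation_def ac_simps intro: generated_monoid.add)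
qed

lemma S_subset_saturation: "S \<subseteq> saturation"
proof
  fix u assume "u \<in> S"
  then show "u \<in> saturation"
    unfolding S_def
  proof (induction rule: generated_monoid.induct)
    case (gen u)
    then show ?case
      by (auto simp: saturation_def A'_def A_le intro: generated_monoid.gen)
  qed (use sat.zero_mem sat.add_mem in auto)
qed

lemma level_mult: "u \<in> saturation \<Longrightarrow> fst u + snd u = level u * d"
  by (simp add: saturation_def level_def)

lemma level_pos: "u \<in> saturation \<Longrightarrow> u \<noteq> 0 \<Longrightarrow> 0 < level u"
  using level_mult[of u] by (cases u; cases "level u = 0") (auto simp: zero_prod_def)

lemma level_add: "u \<in> saturation \<Longrightarrow> v \<in> saturation \<Longrightarrow> level (u + v) = level u + level v"
proof -
  assume uv: "u \<in> saturation" "v \<in> saturation"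
  have "fst (u + v) + snd (u + v) = (level u + level v) * d"
    using level_mult[OF uv(1)] level_mult[OF uv(2)] by (simp add: algebra_simps)
  then show ?thesis using d_pos by (simp add: level_def)
qed

lemma generator_mem: "h \<in> A \<Longrightarrow> (h, d - h) \<in> S"
  by (auto simp: S_def intro: generated_monoid.gen)

lemma e0_mem: "(0, n * d) \<in> S" and ed_mem: "(n * d, 0) \<in> S"
  using generated_monoid_scale[of "(0, d)" _ n] generated_monoid_scale[of "(d, 0)" _ n]
    generator_mem[OF zero_A] generator_mem[OF d_A] by (auto simp: S_def)

lemma S_representation:
  "u \<in> S \<longleftrightarrow> (\<exists>c. fst u = (\<Sum>h\<in>A. c h * h) \<and> snd u = (\<Sum>h\<in>A. c h * (d - h)))"
proof
  assume "u \<in> S"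
  then show "\<exists>c. fst u = (\<Sum>h\<in>A. c h * h) \<and> snd u = (\<Sum>h\<in>A. c h * (d - h))"
    unfolding S_def
  proof (induction rule: generated_monoid.induct)
    case zero
    show ?case by (rule exI[of _ "\<lambda>_. 0"]) simp
  next
    case (gen u)
    then obtain h where "h \<in> A" "u = (h, d - h)" by auto
    then show ?case
      by (intro exI[of _ "\<lambda>i. if i = h then 1 else 0"])
        (simp add: finite_A if_distrib[of "\<lambda>c. c * _"] cong: if_cong)
  next
    case (add u v)
    then obtain c c' where
      "fst u = (\<Sum>h\<in>A. c h * h)" "snd u = (\<Sum>h\<in>A. c h * (d - h))"
      "fst v = (\<Sum>h\<in>A. c' h * h)" "snd v = (\<Sum>h\<in>A. c' h * (d - h))" by blast
    then show ?case
      by (intro exI[of _ "\<lambda>h. c h + c' h"]) (simp add: algebra_simps sum.distrib)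
  qed
next
  assume "\<exists>c. fst u = (\<Sum>h\<in>A. c h * h) \<and> snd u = (\<Sum>h\<in>A. c h * (d - h))"
  then obtain c where c: "fst u = (\<Sum>h\<in>A. c h * h)" "snd u = (\<Sum>h\<in>A. c h * (d - h))" by blast
  have "u = (\<Sum>h\<in>A. (c h * h, c h * (d - h)))" by (rule prod_eqI) (simp_all add: fst_sum snd_sum c)
  also have "\<dots> \<in> S"
    using generated_monoid_scale[OF generator_mem[unfolded S_def]]
    by (auto simp: S_def intro!: generated_monoid_sum)
  finally show "u \<in> S" .
qed

text \<open>Every generator has coordinate sum d, so the level counts generators with multiplicity,
  copies of (0, d) included.\<close>

lemma representation_level:
  assumes "fst u = (\<Sum>h\<in>A. c h * h)" "snd u = (\<Sum>h\<in>A. c h * (d - h))"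
  shows "level u = (\<Sum>h\<in>A. c h)"
proof -
  have "fst u + snd u = (\<Sum>h\<in>A. c h * (h + (d - h)))"
    by (simp add: assms sum.distrib add_mult_distrib2)
  also have "\<dots> = (\<Sum>h\<in>A. c h) * d"
    by (simp add: A_le sum_distrib_right)
  finally show ?thesis using d_pos by (simp add: level_def)
qed

lemma fst_S: "generated_monoid A = fst ` S"
proof
  show "fst ` S \<subseteq> generated_monoid A"
    using S_subset_saturation by (auto simp: saturation_def)
  have "\<exists>u\<in>S. fst u = n" if "n \<in> generated_monoid A" for n
    using that
  proof (induction rule: generated_monoid.induct)
    case zero
    show ?case by (rule bexI[of _ 0]) simp_all
  next
    case (gen h)
    then show ?case using generator_mem by force
  next
    case (add m n)
    then obtain u v where "u \<in> S" "v \<in> S" "fst u = m" "fst v = n" by blast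
    then show ?case by (intro bexI[of _ "u + v"]) (auto intro: add_mem)
  qed
  then show "generated_monoid A \<subseteq> fst ` S" by blast
qed

text \<open>Dropping the copies of (0, d) from a sum of \<open>level u\<close> generators leaves a
  representation of \<open>fst u\<close> of at most that length. Conversely, a shortest
  representation is filled up with copies of (0, d) to exactly \<open>level u\<close> summands, and
  then the second coordinate is forced by the level.\<close>

lemma S_iff_delta:
  "u \<in> S \<longleftrightarrow> fst u \<in> generated_monoid A \<and> d dvd fst u + snd u \<and> delta A (fst u) \<le> level u"
proof (intro iffI conjI; (elim conjE)?)
  assume u: "u \<in> S"
  then show "fst u \<in> generated_monoid A" "d dvd fst u + snd u"
    using S_subset_saturation by (auto simp: saturation_def)
  obtain c where c: "fst u = (\<Sum>h\<in>A. c h * h)" "snd u = (\<Sum>h\<in>A. c h * (d - h))"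
    using u by (auto simp: S_representation)
  have split: "(\<Sum>h\<in>A. f h) = f 0 + (\<Sum>h\<in>A - {0}. f h)" for f :: "nat \<Rightarrow> nat"
    using finite_A zero_A by (simp add: sum.remove)
  have "delta A (fst u) \<le> (\<Sum>h\<in>A - {0}. c h)"
    unfolding delta_def by (rule Least_le) (use c(1) split in auto)
  also have "\<dots> \<le> level u" using representation_level[OF c] split[of c] by simp
  finally show "delta A (fst u) \<le> level u" .
next
  assume u: "fst u \<in> generated_monoid A" "d dvd fst u + snd u" "delta A (fst u) \<le> level u"
  have split: "(\<Sum>h\<in>A. f h) = f 0 + (\<Sum>h\<in>A - {0}. f h)" for f :: "nat \<Rightarrow> nat"
    using finite_A zero_A by (simp add: sum.remove)
  let ?P = "\<lambda>s. \<exists>x::nat \<Rightarrow> nat. fst u = (\<Sum>a\<in>A - {0}. x a * a) \<and> s = (\<Sum>a\<in>A - {0}. x a)"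
  obtain v where v: "v \<in> S" "fst v = fst u" using u(1) by (auto simp: fst_S)
  then obtain c where "fst u = (\<Sum>h\<in>A. c h * h)" by (auto simp: S_representation)
  then have "?P (\<Sum>h\<in>A - {0}. c h)" using split[of "\<lambda>h. c h * h"] by auto
  then have "?P (delta A (fst u))" unfolding delta_def by (rule LeastI)
  then obtain x where x: "fst u = (\<Sum>a\<in>A - {0}. x a * a)" "delta A (fst u) = (\<Sum>a\<in>A - {0}. x a)"
    by blast
  \<comment> \<open>The multiplicity of 0 does not affect the first coordinate, so it can take up
    the slack between \<open>delta\<close> and the level.\<close>
  define c where "c = x(0 := level u - delta A (fst u))"
  have c: "(\<Sum>a\<in>A - {0}. c a * a) = fst u" "(\<Sum>a\<in>A - {0}. c a) = delta A (fst u)"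
    unfolding x(2) by (auto simp: x(1) c_def intro!: sum.cong)
  have c1: "fst u = (\<Sum>h\<in>A. c h * h)" using split[of "\<lambda>h. c h * h"] c(1) by simp
  have c2: "level u = (\<Sum>h\<in>A. c h)" using split[of c] c(2) u(3) by (simp add: c_def)
  have "fst u + snd u = level u * d" using u(2) by (simp add: level_def)
  also have "\<dots> = (\<Sum>h\<in>A. c h * (h + (d - h)))" by (simp add: A_le c2 sum_distrib_right)
  also have "\<dots> = fst u + (\<Sum>h\<in>A. c h * (d - h))"
    by (simp add: c1 sum.distrib add_mult_distrib2)
  finally show "u \<in> S" using c1 by (auto simp: S_representation)
qed

section \<open>Exchange of the two coordinates\<close>

lemma mirror: "monomial_curve A' d"
proof
  show "h \<le> d" if "h \<in> A'" for h using that by (auto simp: A'_def)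
  show "0 \<in> A'" "d \<in> A'"
    using zero_A d_A by (auto simp: A'_def image_iff intro: bexI[of _ d] bexI[of _ 0])
  show "0 < d" by (rule d_pos)
  have "Gcd A' dvd h" if "h \<in> A" for h
  proof -
    have "Gcd A' dvd d" "Gcd A' dvd d - h"
      using that zero_A by (auto simp: A'_def intro!: Gcd_dvd image_eqI[of d _ 0])
    then show ?thesis using A_le[OF that] by (metis diff_diff_cancel dvd_diff_nat)
  qed
  then have "Gcd A' dvd Gcd A" by (rule Gcd_greatest)
  then show "Gcd A' = 1" by (simp add: Gcd_A)
qed

lemma mirror_S: "prod.swap u \<in> monomial_curve.S A' d \<longleftrightarrow> u \<in> S"
proof -
  interpret M: monomial_curve A' d by (rule mirror)
  have inj: "inj_on (\<lambda>h. d - h) A" using A_le by (auto simp: inj_on_def) (metis diff_diff_cancel)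
  have sum_A': "(\<Sum>h\<in>A'. f h) = (\<Sum>h\<in>A. f (d - h))" for f :: "nat \<Rightarrow> nat"
    by (simp add: A'_def sum.reindex[OF inj])
  have "u \<in> S" if u: "prod.swap u \<in> M.S" for u
  proof -
    obtain c where "snd u = (\<Sum>h\<in>A'. c h * h)" "fst u = (\<Sum>h\<in>A'. c h * (d - h))"
      using u by (auto simp: M.S_representation)
    then show ?thesis
      unfolding S_representation sum_A'
      by (intro exI[of _ "\<lambda>h. c (d - h)"]) (auto simp: A_le)
  qed
  moreover have "prod.swap u \<in> M.S" if u: "u \<in> S" for u
  proof -
    obtain c where "fst u = (\<Sum>h\<in>A. c h * h)" "snd u = (\<Sum>h\<in>A. c h * (d - h))"
      using u by (auto simp: S_representation)
    then show ?thesis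
      unfolding M.S_representation sum_A'
      by (intro exI[of _ "\<lambda>h. c (d - h)"]) (auto simp: A_le)
  qed
  ultimately show ?thesis by blast
qed

lemma S_iff_delta':
  "u \<in> S \<longleftrightarrow> snd u \<in> generated_monoid A' \<and> d dvd fst u + snd u \<and> delta A' (snd u) \<le> level u"
proof -
  interpret M: monomial_curve A' d by (rule mirror)
  have "M.level (prod.swap u) = level u" by (simp add: level_def M.level_def add.commute)
  then show ?thesis
    using M.S_iff_delta[of "prod.swap u"] by (simp add: mirror_S add.commute)
qed

text \<open>By induction over subsets B of A, the number Gcd B is congruent modulo d to an element
  of the monoid generated by A. For B = A this gives an element congruent to 1, whose multiples
  reach every residue.\<close>

lemma residue_exists: "\<exists>u\<in>S. fst u mod d = j mod d"
proof -
  have "\<exists>\<alpha>\<in>generated_monoid A. int d dvd int \<alpha> - int (Gcd B)" if "finite B" "B \<subseteq> A" for B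
    using that
  proof (induction B rule: finite_induct)
    case empty
    show ?case by (rule bexI[of _ 0]) (auto intro: generated_monoid.zero)
  next
    case (insert b B)
    then obtain \<alpha> where \<alpha>: "\<alpha> \<in> generated_monoid A" "int d dvd int \<alpha> - int (Gcd B)" by auto
    obtain x y where xy: "x * int b + y * int (Gcd B) = gcd (int b) (int (Gcd B))"
      using bezout_int by blast
    \<comment> \<open>Bezout coefficients may be negative, but only their residues modulo d matter,
      so nonnegative representatives are used.\<close>
    let ?x = "nat (x mod int d)" and ?y = "nat (y mod int d)"
    have mod: "int d dvd int ?x - x" "int d dvd int ?y - y"
      using d_pos by (simp_all add: mod_eq_dvd_iff[symmetric])
    have "int (?x * b + ?y * \<alpha>) - int (Gcd (insert b B))
        = (int ?x - x) * int b + (int ?y - y) * int \<alpha> + y * (int \<alpha> - int (Gcd B))"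
      using xy by (simp add: algebra_simps)
    moreover have "int d dvd \<dots>" using mod \<alpha>(2) by (intro dvd_add dvd_mult dvd_mult2)
    moreover have "?x * b + ?y * \<alpha> \<in> generated_monoid A"
      using insert.prems \<alpha>(1)
      by (intro generated_monoid.add generated_monoid_scale_nat) (auto intro: generated_monoid.gen)
    ultimately show ?case by metis
  qed
  from this[OF finite_A order_refl] obtain \<alpha> where
    \<alpha>: "\<alpha> \<in> generated_monoid A" "int d dvd int \<alpha> - 1" by (auto simp: Gcd_A)
  have "int d dvd int j * (int \<alpha> - 1)" using \<alpha>(2) by simp
  then have "int d dvd int (j * \<alpha>) - int j" by (simp add: algebra_simps)
  then have "int (j * \<alpha>) mod int d = int j mod int d" by (simp only: mod_eq_dvd_iff)
  then have "(j * \<alpha>) mod d = j mod d" by (simp only: of_nat_eq_iff flip: zmod_int)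
  moreover have "j * \<alpha> \<in> fst ` S" using generated_monoid_scale_nat[OF \<alpha>(1)] by (simp add: fst_S)
  then obtain u where "u \<in> S" "j * \<alpha> = fst u" by blast
  ultimately show ?thesis by auto
qed

section \<open>Minimal elements of the residue classes\<close>

lemma omega_mem: "omega d A j \<in> generated_monoid A" and omega_mod: "omega d A j mod d = j mod d"
proof -
  have "\<exists>\<alpha>. \<alpha> \<in> generated_monoid A \<and> \<alpha> mod d = j mod d"
    using residue_exists[of j] by (auto simp: fst_S)
  from LeastI_ex[OF this] show "omega d A j \<in> generated_monoid A" "omega d A j mod d = j mod d"
    by (auto simp: omega_def intro: generated_monoid.zero)
qed

lemma omega_le:
  assumes "\<alpha> \<in> generated_monoid A" "\<alpha> mod d = j mod d"
  shows "omega d A j \<le> \<alpha>"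
  using assms by (auto simp: omega_def intro: Least_le)

lemma omega_decompose:
  assumes "\<alpha> \<in> generated_monoid A" "\<alpha> mod d = j mod d"
  obtains n where "\<alpha> = omega d A j + n * d"
proof -
  have "d dvd \<alpha> - omega d A j"
    using assms(2) omega_mod[of j] omega_le[OF assms] by (metis mod_eq_dvd_iff_nat)
  then obtain n where "\<alpha> - omega d A j = n * d" by (metis dvd_def mult.commute)
  with omega_le[OF assms] show thesis by (intro that[of n]) simp
qed

lemma omega_zero: "omega d A 0 = 0"
  using omega_le[of 0 0] by (simp add: generated_monoid.zero)

lemma omega_generator:
  assumes "h \<in> A" "h < d"
  shows "omega d A h = h"
proof (rule antisym)
  show "omega d A h \<le> h" using assms by (intro omega_le generated_monoid.gen) auto
  show "h \<le> omega d A h" using omega_mod[of h] mod_less_eq_dividend[of "omega d A h" d] assms by simp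
qed

abbreviation w :: "nat \<Rightarrow> nat \<times> nat" where "w i \<equiv> (omega d A i, omega d A' (d - i))"

lemma w_saturation: "i \<le> d \<Longrightarrow> w i + (n1 * d, n2 * d) \<in> saturation"
proof -
  assume i: "i \<le> d"
  interpret M: monomial_curve A' d by (rule mirror)
  have "(omega d A i + omega d A' (d - i)) mod d = (i + (d - i)) mod d"
    by (intro mod_add_cong omega_mod M.omega_mod)
  then have "w i \<in> saturation"
    using i by (auto simp: saturation_def omega_mem M.omega_mem)
  moreover have "(n1 * d, n2 * d) \<in> saturation"
    using sat.add_mem[of "(0, n2 * d)" "(n1 * d, 0)"] e0_mem ed_mem S_subset_saturation by auto
  ultimately show ?thesis by (rule sat.add_mem)
qed

lemma w_level:
  assumes "i \<le> d"
  shows "level (w i + (n1 * d, n2 * d)) = level (w i) + n1 + n2"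
proof -
  have "(n1 * d, n2 * d) \<in> saturation"
    using sat.add_mem[of "(0, n2 * d)" "(n1 * d, 0)"] e0_mem ed_mem S_subset_saturation by auto
  moreover have "w i \<in> saturation"
    using w_saturation[OF assms, of 0 0] by (simp add: zero_prod_def[symmetric])
  moreover have "level (n1 * d, n2 * d) = n1 + n2"
    using d_pos by (simp add: level_def flip: add_mult_distrib)
  ultimately show ?thesis by (simp only: level_add add.assoc)
qed

text \<open>By \<open>S_iff_delta\<close> the last conjunct expresses that \<open>w i\<close> lies
  outside S.\<close>

definition gap_indices :: "nat set" where
  "gap_indices = {i. 1 \<le> i \<and> i \<le> d - 1 \<and> i \<notin> A \<and> level (w i) < delta A (omega d A i)}"

text \<open>That \<open>w i\<close> is outside S is given through the first coordinate and read off
  again through the second.\<close>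

lemma gap_index_bound:
  assumes "i \<in> gap_indices"
  shows "level (w i) < delta A' (omega d A' (d - i))"
proof -
  have "w i \<notin> S" using assms by (simp add: S_iff_delta gap_indices_def)
  moreover have "w i \<in> saturation"
    using w_saturation[of i 0 0] assms by (auto simp: gap_indices_def zero_prod_def[symmetric])
  ultimately show ?thesis by (simp add: S_iff_delta' saturation_def)
qed

text \<open>The same exchange in the other direction: moving from \<open>w i\<close> by (n1 * d, 0)
  raises the level by n1 and keeps the second coordinate, so the hypothesis says that the shifted
  point is outside S.\<close>

lemma gap_index_bound_shifted:
  assumes "i \<in> gap_indices" "level (w i) + n1 < delta A' (omega d A' (d - i))"
  shows "level (w i) + n1 < delta A (omega d A i + n1 * d)"
proof -
  have i: "i \<le> d" using assms(1) by (auto simp: gap_indices_def)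
  let ?u = "w i + (n1 * d, 0 * d)"
  have "?u \<notin> S" using assms(2) w_level[OF i, of n1 0] by (simp add: S_iff_delta')
  then show ?thesis
    using w_saturation[OF i, of n1 0] w_level[OF i, of n1 0] by (simp add: S_iff_delta saturation_def)
qed

text \<open>The residue of \<open>fst u\<close> modulo d determines that of \<open>snd u\<close>, so
  each u in \<open>saturation\<close> is some w i + (n1 * d, n2 * d). If u is outside S, then so are
  \<open>w i\<close> and w i + (n1 * d, 0), since u arises from them by adding elements of S. The
  first puts i into \<open>gap_indices\<close>; the second, read through the second coordinate,
  bounds n1.\<close>

lemma gaps_eq:
  "saturation - S = {w i + (n1 * d, n2 * d) | i n1 n2. i \<in> gap_indices
     \<and> level (w i) + n1 < delta A' (omega d A' (d - i))
     \<and> level (w i) + n1 + n2 < delta A (omega d A i + n1 * d)}" (is "_ = ?L")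
proof (intro Set.set_eqI iffI)
  fix u assume "u \<in> ?L"
  then obtain i n1 n2 where u: "u = w i + (n1 * d, n2 * d)" "i \<in> gap_indices"
    "level (w i) + n1 + n2 < delta A (omega d A i + n1 * d)" by blast
  have i: "i \<le> d" using u(2) by (auto simp: gap_indices_def)
  have "u \<notin> S" using u(3) w_level[OF i, of n1 n2] by (simp add: u(1) S_iff_delta)
  then show "u \<in> saturation - S" using w_saturation[OF i] u(1) by blast
next
  fix u assume "u \<in> saturation - S"
  then have u: "u \<in> saturation" "u \<notin> S" by auto
  interpret M: monomial_curve A' d by (rule mirror)
  define i where "i = fst u mod d"
  have i: "i < d" using d_pos by (simp add: i_def)
  obtain n1 where n1: "fst u = omega d A i + n1 * d"
    using omega_decompose[of "fst u" i] u(1) by (auto simp: saturation_def i_def)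
  \<comment> \<open>The residue of \<open>snd u\<close> is that of d - i; the computation runs over
    the integers to escape truncated subtraction.\<close>
  have "int d dvd int (fst u + snd u)" using u(1) by (simp only: saturation_def int_dvd_int_iff mem_Collect_eq)
  moreover have "int d dvd int (fst u) - int i"
    by (simp add: i_def mod_eq_dvd_iff[symmetric] zmod_int)
  ultimately have "int d dvd int (fst u + snd u) - (int (fst u) - int i)" by (rule dvd_diff)
  then have "int d dvd int (snd u) - int (d - i) + int d" using i by (simp add: of_nat_diff algebra_simps)
  then have "int d dvd int (snd u) - int (d - i)" by (simp add: dvd_add_left_iff)
  then have "int (snd u) mod int d = int (d - i) mod int d" by (simp only: mod_eq_dvd_iff)
  then have "snd u mod d = (d - i) mod d" by (simp only: of_nat_eq_iff flip: zmod_int)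
  then obtain n2 where n2: "snd u = omega d A' (d - i) + n2 * d"
    using M.omega_decompose[of "snd u" "d - i"] u(1) by (auto simp: saturation_def)
  have u_eq: "u = w i + (n1 * d, n2 * d)" using n1 n2 by (simp add: prod_eq_iff)
  have "(n1 * d, n2 * d) \<in> S" using add_mem[OF e0_mem[of n2] ed_mem[of n1]] by simp
  then have w: "w i \<notin> S" using u(2) add_mem u_eq by metis
  \<comment> \<open>For i = 0 the convention \<open>omega d A' d = 0\<close> makes
    \<open>w 0\<close> the origin, which lies in S.\<close>
  have "i \<noteq> 0"
  proof
    assume "i = 0"
    then have "w i = 0" by (simp add: omega_zero zero_prod_def) (simp add: omega_def)
    then show False using w by simp
  qed
  then have "1 \<le> i" by simp
  moreover have "i \<notin> A"
  proof
    assume "i \<in> A"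
    then have "w i = (i, d - i)"
      using omega_generator[of i] M.omega_generator[of "d - i"] i \<open>i \<noteq> 0\<close> by (simp add: A'_def)
    then show False using w generator_mem[OF \<open>i \<in> A\<close>] by simp
  qed
  moreover have "w i \<in> saturation"
    using w_saturation[of i 0 0] i by (auto simp: zero_prod_def[symmetric])
  ultimately have I: "i \<in> gap_indices"
    using i w by (auto simp: gap_indices_def S_iff_delta saturation_def)
  have "w i + (n1 * d, 0 * d) \<notin> S"
  proof
    assume "w i + (n1 * d, 0 * d) \<in> S"
    from add_mem[OF this e0_mem[of n2]] show False using u(2) u_eq by simp
  qed
  then have "level (w i) + n1 < delta A' (omega d A' (d - i))"
    using w_saturation[of i n1 0] w_level[of i n1 0] i by (simp add: S_iff_delta' saturation_def)
  moreover have "level (w i) + n1 + n2 < delta A (omega d A i + n1 * d)"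
    using u w_level[of i n1 n2] i u_eq n1 by (simp add: S_iff_delta saturation_def)
  ultimately show "u \<in> ?L" using I u_eq by blast
qed

text \<open>First n1 is bounded through \<open>delta A'\<close>; over these finitely many n1 the
  values of \<open>delta A\<close> then bound n2.\<close>

lemma finite_gaps: "finite (saturation - S)"
proof -
  define N where "N = Max (insert 0 ((\<lambda>i. delta A' (omega d A' (d - i))) ` {..d}))"
  define N' where "N' = Max (insert 0 ((\<lambda>(i, n). delta A (omega d A i + n * d)) ` ({..d} \<times> {..N})))"
  have "saturation - S \<subseteq> (\<lambda>(i, n1, n2). w i + (n1 * d, n2 * d)) ` ({..d} \<times> {..N} \<times> {..N'})"
  proof
    fix u assume "u \<in> saturation - S"
    then obtain i n1 n2 where u: "u = w i + (n1 * d, n2 * d)" "i \<in> gap_indices"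
      "level (w i) + n1 < delta A' (omega d A' (d - i))"
      "level (w i) + n1 + n2 < delta A (omega d A i + n1 * d)" unfolding gaps_eq by blast
    have i: "i \<le> d" using u(2) by (auto simp: gap_indices_def)
    have "delta A' (omega d A' (d - i)) \<le> N" unfolding N_def using i by (intro Max_ge) auto
    with u(3) have n1: "n1 \<le> N" by simp
    have "delta A (omega d A i + n1 * d) \<le> N'" unfolding N'_def
      using i n1 by (intro Max_ge) (auto intro!: image_eqI[of _ _ "(i, n1)"])
    with u(4) have "n2 \<le> N'" by simp
    with i n1 show "u \<in> (\<lambda>(i, n1, n2). w i + (n1 * d, n2 * d)) ` ({..d} \<times> {..N} \<times> {..N'})"
      by (intro image_eqI[of _ _ "(i, n1, n2)"]) (auto simp: u(1))
  qed
  then show ?thesis by (rule finite_subset) simp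
qed

text \<open>Adding (0, n * d) raises the level by n and fixes the first coordinate, hence also its
  \<open>delta A\<close>; symmetrically for (n * d, 0). One n serves all u because there are
  finitely many gaps, and the sum over them is a crude common bound.\<close>

lemma saturation_absorbed:
  obtains n where "\<And>u. u \<in> saturation \<Longrightarrow> u + (0, n * d) \<in> S" "\<And>u. u \<in> saturation \<Longrightarrow> u + (n * d, 0) \<in> S"
proof
  define n where "n = (\<Sum>u\<in>saturation - S. delta A (fst u) + delta A' (snd u))"
  fix u assume u: "u \<in> saturation"
  have e: "(0, n * d) \<in> saturation" "(n * d, 0) \<in> saturation" "level (0, n * d) = n" "level (n * d, 0) = n"
    using e0_mem ed_mem S_subset_saturation d_pos by (auto simp: level_def)
  show "u + (0, n * d) \<in> S"
  proof (cases "u \<in> S")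
    case True
    then show ?thesis by (intro add_mem e0_mem)
  next
    case False
    then have "delta A (fst u) + delta A' (snd u) \<le> n"
      unfolding n_def using u finite_gaps by (intro member_le_sum) auto
    then show ?thesis
      using u e sat.add_mem[OF u e(1)] by (auto simp: S_iff_delta level_add saturation_def)
  qed
  show "u + (n * d, 0) \<in> S"
  proof (cases "u \<in> S")
    case True
    then show ?thesis by (intro add_mem ed_mem)
  next
    case False
    then have "delta A (fst u) + delta A' (snd u) \<le> n"
      unfolding n_def using u finite_gaps by (intro member_le_sum) auto
    then show ?thesis
      using u e sat.add_mem[OF u e(2)] by (auto simp: S_iff_delta' level_add saturation_def)
  qed
qed

text \<open>The first point certifies u1 and the divisibility by d, the second certifies u2. This
  detects that a quotient by powers of t^d and s^d has its exponents in
  \<open>saturation\<close>.\<close>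

lemma saturationI:
  assumes "(u1, u2 + m * d) \<in> S" "(u1 + n * d, u2) \<in> S"
  shows "(u1, u2) \<in> saturation"
proof -
  have "d dvd (u1 + u2) + m * d"
    using assms(1) S_subset_saturation by (auto simp: saturation_def ac_simps)
  then have "d dvd u1 + u2" by (simp add: dvd_add_left_iff)
  then show ?thesis using assms S_subset_saturation by (auto simp: saturation_def)
qed

end

section \<open>Cohen--Macaulayness and torsion\<close>

context monomial_curve
begin

section \<open>The parameters t^d and s^d, and the irrelevant ideal\<close>

definition X0 :: "nat \<times> nat \<Rightarrow>\<^sub>0 'k::field" where "X0 = Poly_Mapping.single (0, d) 1"
definition X1 :: "nat \<times> nat \<Rightarrow>\<^sub>0 'k::field" where "X1 = Poly_Mapping.single (d, 0) 1"

lemma X0_power: "X0 ^ n = Poly_Mapping.single (0, n * d) 1"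
  by (induction n) (simp_all add: X0_def single_one_mult_single_one zero_prod_def[symmetric])

lemma X1_power: "X1 ^ n = Poly_Mapping.single (n * d, 0) 1"
  by (induction n) (simp_all add: X1_def single_one_mult_single_one zero_prod_def[symmetric])

lemma X0_supported: "X0 \<in> supported S" and X1_supported: "X1 \<in> supported S"
  using e0_mem[of 1] ed_mem[of 1] by (auto simp: X0_def X1_def intro: supported_single)

lemma face_zero: "face {0}" and face_UNIV: "face UNIV" and face_snd: "face {u. snd u = 0}"
  by (auto simp: face_def zero_prod_def)

text \<open>Membership in the generated ideal becomes a condition on supports. One inclusion holds
  because the complement of the face {0} spans an ideal, the other because an element is the sum of
  its terms.\<close>

lemma irrelevant_eq: "semigroup_ring_irrelevant S = (supported (S - {0}) :: (nat \<times> nat \<Rightarrow>\<^sub>0 'k::field) set)"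
proof
  interpret R: cring "R :: (nat \<times> nat \<Rightarrow>\<^sub>0 'k) ring" by (rule cring_semigroup_ring)
  let ?G = "(\<lambda>u. Poly_Mapping.single u (1::'k)) ` (S - {0})"
  have G: "?G \<subseteq> carrier R" by (auto simp: carrier_semigroup_ring intro: supported_single)
  show "semigroup_ring_irrelevant S \<subseteq> (supported (S - {0}) :: (nat \<times> nat \<Rightarrow>\<^sub>0 'k) set)"
    unfolding semigroup_ring_irrelevant_def
    by (rule R.genideal_minimal[OF primeideal.axioms(1)[OF face_primeideal[OF face_zero]]])
      (auto intro: supported_single)
  show "supported (S - {0}) \<subseteq> (semigroup_ring_irrelevant S :: (nat \<times> nat \<Rightarrow>\<^sub>0 'k) set)"
  proof
    fix f :: "nat \<times> nat \<Rightarrow>\<^sub>0 'k" assume f: "f \<in> supported (S - {0})"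
    have I: "ideal (Idl\<^bsub>R\<^esub> ?G) R" by (rule R.genideal_ideal[OF G])
    have term_mem: "Poly_Mapping.single u c \<in> Idl\<^bsub>R\<^esub> ?G" if "u \<in> S - {0}" for u c
    proof -
      have "Poly_Mapping.single 0 c \<otimes>\<^bsub>R\<^esub> Poly_Mapping.single u 1 \<in> Idl\<^bsub>R\<^esub> ?G"
        using that R.genideal_self[OF G]
        by (intro ideal.I_l_closed[OF I]) (auto simp: carrier_semigroup_ring supported_single)
      then show ?thesis by (simp add: mult_single)
    qed
    have sum_mem: "sum g U \<in> Idl\<^bsub>R\<^esub> ?G" if "\<And>u. u \<in> U \<Longrightarrow> g u \<in> Idl\<^bsub>R\<^esub> ?G" for g and U :: "(nat \<times> nat) set"
      using that
    proof (induction U rule: infinite_finite_induct)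
      case (insert u U)
      then show ?case using additive_subgroup.a_closed[OF ideal.axioms(1)[OF I], of "g u" "sum g U"] by simp
    qed (use additive_subgroup.zero_closed[OF ideal.axioms(1)[OF I]] in auto)
    show "f \<in> semigroup_ring_irrelevant S"
      unfolding semigroup_ring_irrelevant_def
      by (subst poly_mapping_sum_singles[of f], rule sum_mem, rule term_mem)
        (use f in \<open>auto simp: supported_def\<close>)
  qed
qed

lemma X0_irrelevant: "X0 \<in> semigroup_ring_irrelevant S" and X1_irrelevant: "X1 \<in> semigroup_ring_irrelevant S"
  using e0_mem[of 1] ed_mem[of 1] d_pos
  by (auto simp: irrelevant_eq X0_def X1_def zero_prod_def intro!: supported_single)

text \<open>The lower bound comes from the primes complementary to N^2, the ray and the origin; the
  inclusions are strict because (0, d) lies off the ray and (d, 0) is on the ray but not the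
  origin.\<close>

lemma krull_dim_eq: "krull_dim (R :: (nat \<times> nat \<Rightarrow>\<^sub>0 'k::field) ring) = 2"
proof (rule antisym[OF krull_dim_le])
  define P :: "nat \<Rightarrow> (nat \<times> nat \<Rightarrow>\<^sub>0 'k) set" where
    "P i = supported (S - (if i = 0 then UNIV else if i = 1 then {u. snd u = 0} else {0}))" for i
  have "primeideal (P i) R" for i
    unfolding P_def by (intro face_primeideal) (auto simp: face_zero face_UNIV face_snd)
  moreover have "P 0 \<subset> P 1"
  proof
    show "P 0 \<subseteq> P 1" by (auto simp: P_def intro!: supported_mono)
    have "X0 \<in> P 1" "X0 \<notin> P 0"
      using e0_mem[of 1] d_pos by (auto simp: P_def X0_def supported_def simp del: keys_eq_empty)
    then show "P 0 \<noteq> P 1" by blast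
  qed
  moreover have "P 1 \<subset> P 2"
  proof
    show "P 1 \<subseteq> P 2" by (auto simp: P_def intro!: supported_mono)
    have "X1 \<in> P 2" "X1 \<notin> P 1"
      using ed_mem[of 1] d_pos by (auto simp: P_def X1_def supported_def zero_prod_def simp del: keys_eq_empty)
    then show "P 1 \<noteq> P 2" by blast
  qed
  ultimately have "(\<forall>i\<le>2. primeideal (P i) R) \<and> (\<forall>i<2. P i \<subset> P (Suc i))"
    by (simp add: All_less_Suc numeral_2_eq_2)
  then show "2 \<le> krull_dim (R :: (nat \<times> nat \<Rightarrow>\<^sub>0 'k) ring)"
    unfolding krull_dim_def numeral_eq_enat by (intro Sup_upper) blast
qed

text \<open>The regularity of \<open>X1\<close> modulo \<open>X0\<close> is the point. If X1 * r =
  X0 * q, then each exponent u of r lies in S and u + (d, 0) - (0, d) does too. So u - (0, d) lies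
  in \<open>saturation\<close>, hence in S, and r is divisible by \<open>X0\<close>.\<close>

lemma cohen_macaulay_if_saturated:
  assumes sat: "saturation \<subseteq> S"
  shows "graded_cohen_macaulay (R :: (nat \<times> nat \<Rightarrow>\<^sub>0 'k::field) ring) (semigroup_ring_irrelevant S)"
  unfolding graded_cohen_macaulay_def krull_dim_eq
proof (rule antisym[OF depth_le])
  interpret R: cring "R :: (nat \<times> nat \<Rightarrow>\<^sub>0 'k) ring" by (rule cring_semigroup_ring)
  have X01: "X0 \<in> carrier (R :: (nat \<times> nat \<Rightarrow>\<^sub>0 'k) ring)" "X1 \<in> carrier (R :: (nat \<times> nat \<Rightarrow>\<^sub>0 'k) ring)"
    by (simp_all add: carrier_semigroup_ring X0_supported X1_supported)
  have Idl_empty: "Idl\<^bsub>R\<^esub> ({} :: (nat \<times> nat \<Rightarrow>\<^sub>0 'k) set) = {0}"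
    using R.genideal_minimal[OF R.zeroideal, of "{}"]
      additive_subgroup.zero_closed[OF ideal.axioms(1)[OF R.genideal_ideal[of "{}"]]] by auto
  have Idl_X0: "Idl\<^bsub>R\<^esub> {X0 :: nat \<times> nat \<Rightarrow>\<^sub>0 'k} = (\<lambda>f. f * X0) ` supported S"
    using R.cgenideal_eq_genideal[OF X01(1)] by (auto simp: cgenideal_def carrier_semigroup_ring)
  have "r \<in> Idl\<^bsub>R\<^esub> {X0}" if r: "r \<in> supported S" "X1 * r \<in> Idl\<^bsub>R\<^esub> {X0}" for r :: "nat \<times> nat \<Rightarrow>\<^sub>0 'k"
  proof -
    obtain q where q: "q \<in> supported S" "X1 * r = X0 * q"
      using r(2) by (auto simp: Idl_X0 mult.commute)
    have "r \<in> supported ((+) (0, d) ` S)"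
      unfolding supported_def
    proof safe
      fix u1 u2 assume u: "(u1, u2) \<in> Poly_Mapping.keys r"
      then have "(d + u1, u2) \<in> Poly_Mapping.keys (X0 * q)"
        by (force simp: q(2)[symmetric] X1_def keys_single_one_mult)
      then obtain v where v: "v \<in> Poly_Mapping.keys q" "v = (d + u1, u2 - d)" "d \<le> u2"
        by (auto simp: X0_def keys_single_one_mult)
      then have "(u1 + 1 * d, u2 - d) \<in> S" using q(1) by (auto simp: supported_def add.commute)
      moreover have "(u1, (u2 - d) + 1 * d) \<in> S" using u v(3) r(1) by (auto simp: supported_def)
      ultimately have "(u1, u2 - d) \<in> S" using saturationI sat by blast
      then show "(u1, u2) \<in> (+) (0, d) ` S" using v(3) by (intro image_eqI[of _ _ "(u1, u2 - d)"]) auto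
    qed
    then obtain g where "g \<in> supported S" "r = X0 * g"
      unfolding X0_def by (rule supported_translateE)
    then show ?thesis by (auto simp: Idl_X0 mult.commute)
  qed
  moreover have "r \<in> Idl\<^bsub>R\<^esub> {}" if "X0 * r \<in> Idl\<^bsub>R\<^esub> {}" for r :: "nat \<times> nat \<Rightarrow>\<^sub>0 'k"
    using that single_one_mult_cancel[of "(0, d)" r 0] by (simp add: Idl_empty X0_def)
  moreover have "Idl\<^bsub>R\<^esub> {X0, X1} \<noteq> carrier (R :: (nat \<times> nat \<Rightarrow>\<^sub>0 'k) ring)"
  proof
    assume "Idl\<^bsub>R\<^esub> {X0, X1} = carrier (R :: (nat \<times> nat \<Rightarrow>\<^sub>0 'k) ring)"
    moreover have "Idl\<^bsub>R\<^esub> {X0, X1 :: nat \<times> nat \<Rightarrow>\<^sub>0 'k} \<subseteq> supported (S - {0})"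
      using X0_irrelevant X1_irrelevant
      by (intro R.genideal_minimal primeideal.axioms(1)[OF face_primeideal[OF face_zero]])
        (auto simp: irrelevant_eq)
    ultimately have "(1 :: nat \<times> nat \<Rightarrow>\<^sub>0 'k) \<in> supported (S - {0})" using R.one_closed by auto
    then show False by (simp add: supported_def)
  qed
  ultimately have "regular_sequence R [X0, X1 :: nat \<times> nat \<Rightarrow>\<^sub>0 'k]"
    using X01 by (auto simp: regular_sequence_def less_Suc_eq carrier_semigroup_ring)
  then show "2 \<le> depth (R :: (nat \<times> nat \<Rightarrow>\<^sub>0 'k) ring) (semigroup_ring_irrelevant S)"
    unfolding depth_def numeral_eq_enat
    using X0_irrelevant X1_irrelevant by (intro Sup_upper) (auto intro!: exI[of _ "[X0, X1]"])
qed

section \<open>Torsion with respect to the irrelevant ideal\<close>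

text \<open>A monomial of large degree is divisible by a large power of one generator \<open>(h, d - h)\<close>,
  whose \<open>d\<close>-th power is a product of powers of \<open>(0, d)\<close> and \<open>(d, 0)\<close>.\<close>

lemma high_level_divisible:
  assumes "u \<in> S" "card A * (N * d) < level u"
  obtains v where "v \<in> S" "u = (0, N * d) + v \<or> u = (N * d, 0) + v"
proof -
  obtain c where c: "fst u = (\<Sum>h\<in>A. c h * h)" "snd u = (\<Sum>h\<in>A. c h * (d - h))"
    using assms(1) by (auto simp: S_representation)
  have "\<exists>h\<in>A. N * d < c h"
  proof (rule ccontr)
    assume "\<not> ?thesis"
    then have "(\<Sum>h\<in>A. c h) \<le> card A * (N * d)"
      using sum_bounded_above[of A c "N * d"] by (auto simp: not_less)
    with assms(2) show False using representation_level[OF c] by simp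
  qed
  then obtain h where h: "h \<in> A" "N * d < c h" by blast
  \<comment> \<open>N * d copies of (h, d - h) are removed; together they equal N * h copies of (d,
    0) and N * (d - h) copies of (0, d). For h = 0 the second number is at least N, otherwise the
    first is.\<close>
  define c' where "c' = c(h := c h - N * d)"
  define s where "s = ((\<Sum>h\<in>A. c' h * h), (\<Sum>h\<in>A. c' h * (d - h)))"
  have s: "s \<in> S" by (auto simp: s_def S_representation)
  have split: "(\<Sum>i\<in>A. f i) = f h + (\<Sum>i\<in>A - {h}. f i)" for f :: "nat \<Rightarrow> nat"
    using finite_A h(1) by (simp add: sum.remove)
  have c'_other: "(\<Sum>i\<in>A - {h}. c' i * g i) = (\<Sum>i\<in>A - {h}. c i * g i)" for g :: "nat \<Rightarrow> nat"
    by (intro sum.cong) (auto simp: c'_def)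
  have ch: "c h = c' h + N * d" using h(2) by (simp add: c'_def)
  have "fst u = fst s + N * h * d"
    using split[of "\<lambda>i. c i * i"] split[of "\<lambda>i. c' i * i"] c'_other[of "\<lambda>i. i"]
    by (simp add: s_def c ch add_mult_distrib)
  moreover have "snd u = snd s + N * (d - h) * d"
    using split[of "\<lambda>i. c i * (d - i)"] split[of "\<lambda>i. c' i * (d - i)"] c'_other[of "\<lambda>i. d - i"]
    by (simp add: s_def c ch add_mult_distrib)
  ultimately have "u = s + (N * h * d, N * (d - h) * d)" by (simp add: prod_eq_iff)
  then have u: "u = s + (N * h * d, 0) + (0, N * (d - h) * d)" by (simp add: add.assoc)
  show thesis
  proof (cases "h = 0")
    case True
    have *: "u = (0, N * d) + (s + (0, N * (d - 1) * d))"
      using d_pos by (simp add: u True prod_eq_iff algebra_simps flip: add_mult_distrib)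
    show thesis using * s e0_mem by (intro that[of "s + (0, N * (d - 1) * d)"]) (auto intro: add_mem)
  next
    case False
    then have *: "u = (N * d, 0) + (s + (N * (h - 1) * d, 0) + (0, N * (d - h) * d))"
      by (cases h) (simp_all add: u prod_eq_iff algebra_simps)
    show thesis using s e0_mem ed_mem
      by (intro that[OF _ disjI2[OF *]]) (auto intro!: add_mem)
  qed
qed

text \<open>Nonzero exponents have positive level, so every factor from m raises the level by at
  least one.\<close>

lemma ideal_power_level:
  "f \<in> ideal_power R (semigroup_ring_irrelevant S) n
    \<Longrightarrow> f \<in> supported {u \<in> S. n \<le> level u}" for f :: "nat \<times> nat \<Rightarrow>\<^sub>0 'k::field"
proof (induction n arbitrary: f)
  case 0
  then show ?case by (simp add: carrier_semigroup_ring)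
next
  case (Suc n)
  have "f \<in> semigroup_ring_irrelevant S \<cdot>\<^bsub>R\<^esub> ideal_power R (semigroup_ring_irrelevant S) n"
    using Suc.prems by simp
  then show ?case
  proof (induction rule: ideal_prod.induct)
    case (prod i j)
    have "i * j \<in> supported {u \<in> S. Suc n \<le> level u}"
    proof (rule supported_mult)
      show "i \<in> supported (S - {0})" using prod by (simp add: irrelevant_eq)
      show "j \<in> supported {u \<in> S. n \<le> level u}" by (rule Suc.IH) fact
      fix t u assume "t \<in> S - {0}" "u \<in> {u \<in> S. n \<le> level u}"
      then show "t + u \<in> {u \<in> S. Suc n \<le> level u}"
        using level_pos[of t] level_add[of t u] subsetD[OF S_subset_saturation] add_mem[of t u] by auto
    qed
    then show ?case by simp
  qed (simp add: supported_add)
qed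

lemma power_in_ideal_power:
  fixes f :: "nat \<times> nat \<Rightarrow>\<^sub>0 'k::field"
  shows "f \<in> semigroup_ring_irrelevant S \<Longrightarrow> f ^ n \<in> ideal_power R (semigroup_ring_irrelevant S) n"
  by (induction n) (auto simp: carrier_semigroup_ring intro: ideal_prod.prod[of _ _ _ _ R, simplified])

text \<open>\<open>X0\<close> and \<open>X1\<close> lie in m, which gives one direction. For the
  other, every monomial of sufficiently large level is divisible by \<open>X0 ^ N\<close> or
  \<open>X1 ^ N\<close>, so a high power of m annihilates t.\<close>

lemma torsion_iff:
  fixes M :: "(nat \<times> nat \<Rightarrow>\<^sub>0 'k::field, 'm) gmodule"
  assumes "module R M"
  shows "t \<in> torsion R (semigroup_ring_irrelevant S) M \<longleftrightarrow>
    t \<in> carrier M \<and> (\<exists>N. X0 ^ N \<odot>\<^bsub>M\<^esub> t = \<zero>\<^bsub>M\<^esub> \<and> X1 ^ N \<odot>\<^bsub>M\<^esub> t = \<zero>\<^bsub>M\<^esub>)"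
proof (intro iffI conjI; (elim conjE exE)?)
  interpret M: module R M by fact
  assume "t \<in> torsion R (semigroup_ring_irrelevant S) M"
  then show "t \<in> carrier M" "\<exists>N. X0 ^ N \<odot>\<^bsub>M\<^esub> t = \<zero>\<^bsub>M\<^esub> \<and> X1 ^ N \<odot>\<^bsub>M\<^esub> t = \<zero>\<^bsub>M\<^esub>"
    using power_in_ideal_power[OF X0_irrelevant] power_in_ideal_power[OF X1_irrelevant]
    by (auto simp: torsion_def)
next
  interpret M: module R M by fact
  fix N assume t: "t \<in> carrier M" "X0 ^ N \<odot>\<^bsub>M\<^esub> t = \<zero>\<^bsub>M\<^esub>" "X1 ^ N \<odot>\<^bsub>M\<^esub> t = \<zero>\<^bsub>M\<^esub>"
  have kill: "(g * p) \<odot>\<^bsub>M\<^esub> t = \<zero>\<^bsub>M\<^esub>" if "p \<odot>\<^bsub>M\<^esub> t = \<zero>\<^bsub>M\<^esub>" "g \<in> supported S" "p \<in> supported S" for g p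
    using M.smult_assoc1[of g p t] that t(1) by (simp add: carrier_semigroup_ring)
  have single: "Poly_Mapping.single u c \<odot>\<^bsub>M\<^esub> t = \<zero>\<^bsub>M\<^esub>" if u: "u \<in> S" "card A * (N * d) < level u" for u c
  proof -
    obtain v where v: "v \<in> S" "u = (0, N * d) + v \<or> u = (N * d, 0) + v"
      using high_level_divisible[OF u] by blast
    then have "Poly_Mapping.single u c = Poly_Mapping.single v c * X0 ^ N
        \<or> Poly_Mapping.single u c = Poly_Mapping.single v c * X1 ^ N"
      by (auto simp: X0_power X1_power mult_single add.commute)
    then show ?thesis
      using kill[OF t(2) supported_single[OF v(1)] supported_power[OF X0_supported]]
        kill[OF t(3) supported_single[OF v(1)] supported_power[OF X1_supported]] by auto
  qed
  have sum_kill: "sum g U \<odot>\<^bsub>M\<^esub> t = \<zero>\<^bsub>M\<^esub>" if "\<And>u. u \<in> U \<Longrightarrow> g u \<odot>\<^bsub>M\<^esub> t = \<zero>\<^bsub>M\<^esub> \<and> g u \<in> supported S" for g and U :: "(nat \<times> nat) set"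
    using that
  proof (induction U rule: infinite_finite_induct)
    case (insert u U)
    then show ?case
      using M.smult_l_distr[of "g u" "sum g U" t] t(1)
      by (simp add: carrier_semigroup_ring supported_sum)
  qed (use M.smult_l_null[OF t(1)] in simp_all)
  \<comment> \<open>The successor accounts for the strict inequality in
    \<open>high_level_divisible\<close>.\<close>
  have "f \<odot>\<^bsub>M\<^esub> t = \<zero>\<^bsub>M\<^esub>" if "f \<in> ideal_power R (semigroup_ring_irrelevant S) (Suc (card A * (N * d)))" for f
    using ideal_power_level[OF that] single
    by (subst poly_mapping_sum_singles[of f], intro sum_kill conjI)
      (auto simp: supported_def)
  then show "t \<in> torsion R (semigroup_ring_irrelevant S) M"
    using t(1) unfolding torsion_def by blast
qed

end

section \<open>Modules presented by the gaps\<close>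

context monomial_curve
begin

lemma degree_level: "u \<in> saturation \<Longrightarrow> monomial_degree d u = real (level u)"
  using level_mult[of u] d_pos by (simp add: monomial_degree_def flip: of_nat_add)

lemma homogeneous_part_eq:
  assumes "T \<subseteq> saturation"
  shows "homogeneous_part (monomial_degree d) T j = supported {u \<in> T. int (level u) = j}"
proof -
  have "monomial_degree d u = of_int j \<longleftrightarrow> int (level u) = j" if "u \<in> T" for u
  proof -
    have "monomial_degree d u = of_int (int (level u))" using degree_level[of u] subsetD[OF assms that] by simp
    then show ?thesis by (simp only: of_int_eq_iff)
  qed
  then show ?thesis by (auto simp: homogeneous_part_def supported_def)
qed

end

text \<open>An abstract presentation of H as K[saturation] / K[S] by a surjection \<open>G\<close>
  with kernel K[S]. The module axioms of H are derived by transport along \<open>G\<close>, so for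
  local cohomology, whose elements are cosets, it suffices to verify these five facts.\<close>

locale gap_module = monomial_curve A d for A d +
  fixes H :: "((nat \<times> nat) \<Rightarrow>\<^sub>0 'k::field, 'b) gmodule" and G :: "((nat \<times> nat) \<Rightarrow>\<^sub>0 'k) \<Rightarrow> 'b"
  assumes G_image: "G ` supported saturation = carrier H"
    and G_add: "p \<in> supported saturation \<Longrightarrow> q \<in> supported saturation \<Longrightarrow> G (p + q) = G p \<oplus>\<^bsub>H\<^esub> G q"
    and G_smult: "r \<in> supported S \<Longrightarrow> p \<in> supported saturation \<Longrightarrow> G (r * p) = r \<odot>\<^bsub>H\<^esub> G p"
    and G_kernel: "p \<in> supported saturation \<Longrightarrow> G p = \<zero>\<^bsub>H\<^esub> \<longleftrightarrow> p \<in> supported S"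
    and G_gpart: "gpart H j = G ` homogeneous_part (monomial_degree d) saturation j"
begin

abbreviation gaps :: "(nat \<times> nat) set" where "gaps \<equiv> saturation - S"

lemma supported_sat_mult:
  fixes r p :: "nat \<times> nat \<Rightarrow>\<^sub>0 'k"
  shows "r \<in> supported S \<Longrightarrow> p \<in> supported saturation \<Longrightarrow> r * p \<in> supported saturation"
  using S_subset_saturation by (elim supported_mult) (auto intro: sat.add_mem)

lemma G_zero: "G 0 = \<zero>\<^bsub>H\<^esub>"
  by (simp add: G_kernel)

lemma G_carrierE:
  assumes "x \<in> carrier H"
  obtains p where "p \<in> supported saturation" "x = G p"
  using assms G_image by blast

lemma G_carrier: "p \<in> supported saturation \<Longrightarrow> G p \<in> carrier H"
  using G_image by blast

lemma H_module: "module R H"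
proof (rule moduleI)
  show "cring (R :: (nat \<times> nat \<Rightarrow>\<^sub>0 'k) ring)" by (rule cring_semigroup_ring)
  show "abelian_group H"
  proof (rule abelian_groupI)
    show "\<zero>\<^bsub>H\<^esub> \<in> carrier H" using G_carrier[OF supported_zero] by (simp add: G_zero)
    fix x assume "x \<in> carrier H"
    then obtain p where p: "p \<in> supported saturation" "x = G p" by (rule G_carrierE)
    show "\<zero>\<^bsub>H\<^esub> \<oplus>\<^bsub>H\<^esub> x = x" using G_add[of 0 p] p by (simp add: G_zero)
    show "\<exists>y\<in>carrier H. y \<oplus>\<^bsub>H\<^esub> x = \<zero>\<^bsub>H\<^esub>"
      using p G_add[of "- p" p] by (intro bexI[of _ "G (- p)"]) (auto simp: G_zero supported_uminus G_carrier)
    fix y assume "y \<in> carrier H"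
    then obtain q where q: "q \<in> supported saturation" "y = G q" by (rule G_carrierE)
    show "x \<oplus>\<^bsub>H\<^esub> y \<in> carrier H" using p q by (simp add: G_carrier supported_add flip: G_add)
    show "x \<oplus>\<^bsub>H\<^esub> y = y \<oplus>\<^bsub>H\<^esub> x" using p q by (simp add: add.commute flip: G_add)
    fix z assume "z \<in> carrier H"
    then obtain r where r: "r \<in> supported saturation" "z = G r" by (rule G_carrierE)
    show "(x \<oplus>\<^bsub>H\<^esub> y) \<oplus>\<^bsub>H\<^esub> z = x \<oplus>\<^bsub>H\<^esub> (y \<oplus>\<^bsub>H\<^esub> z)"
      using p q r by (simp add: add.assoc supported_add flip: G_add)
  qed
  fix x assume "x \<in> carrier H"
  then obtain p where p: "p \<in> supported saturation" "x = G p" by (rule G_carrierE)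
  show "\<one>\<^bsub>R\<^esub> \<odot>\<^bsub>H\<^esub> x = x" using G_smult[of 1 p] p by simp
  fix a :: "nat \<times> nat \<Rightarrow>\<^sub>0 'k" assume "a \<in> carrier R"
  then have a: "a \<in> supported S" by (simp add: carrier_semigroup_ring)
  show "a \<odot>\<^bsub>H\<^esub> x \<in> carrier H" using a p by (simp add: G_carrier supported_sat_mult flip: G_smult)
  { fix y assume "y \<in> carrier H"
    then obtain q where q: "q \<in> supported saturation" "y = G q" by (rule G_carrierE)
    show "a \<odot>\<^bsub>H\<^esub> (x \<oplus>\<^bsub>H\<^esub> y) = a \<odot>\<^bsub>H\<^esub> x \<oplus>\<^bsub>H\<^esub> a \<odot>\<^bsub>H\<^esub> y"
      using p q a by (simp add: supported_add supported_sat_mult distrib_left flip: G_add G_smult) }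
  fix b :: "nat \<times> nat \<Rightarrow>\<^sub>0 'k" assume "b \<in> carrier R"
  then have b: "b \<in> supported S" by (simp add: carrier_semigroup_ring)
  show "(a \<oplus>\<^bsub>R\<^esub> b) \<odot>\<^bsub>H\<^esub> x = a \<odot>\<^bsub>H\<^esub> x \<oplus>\<^bsub>H\<^esub> b \<odot>\<^bsub>H\<^esub> x"
    using a b p by (simp add: supported_add supported_sat_mult distrib_right flip: G_add G_smult)
  show "(a \<otimes>\<^bsub>R\<^esub> b) \<odot>\<^bsub>H\<^esub> x = a \<odot>\<^bsub>H\<^esub> (b \<odot>\<^bsub>H\<^esub> x)"
    using a b p by (simp add: supported_mult_closed supported_sat_mult mult.assoc flip: G_smult)
qed

sublocale H: module "semigroup_ring S" H by (rule H_module)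

lemma G_eq_iff:
  assumes "p \<in> supported saturation" "q \<in> supported saturation"
  shows "G p = G q \<longleftrightarrow> p - q \<in> supported S"
proof -
  have "G p = G q \<longleftrightarrow> G (p - q) = \<zero>\<^bsub>H\<^esub>"
  proof
    assume "G p = G q"
    then have "G (p - q) = G q \<oplus>\<^bsub>H\<^esub> G (- q)"
      using G_add[of p "- q"] assms by (simp add: supported_uminus)
    also have "\<dots> = G (q + - q)" using assms by (intro G_add[symmetric]) (auto simp: supported_uminus)
    finally show "G (p - q) = \<zero>\<^bsub>H\<^esub>" by (simp add: G_zero)
  next
    assume "G (p - q) = \<zero>\<^bsub>H\<^esub>"
    then show "G p = G q" using G_add[of "p - q" q] assms by (simp add: supported_diff G_carrier)
  qed
  then show ?thesis using assms by (simp add: G_kernel supported_diff)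
qed

lemma G_restrict_gaps:
  assumes "p \<in> supported saturation"
  shows "G (restrict_to gaps p) = G p"
proof -
  have "p - restrict_to gaps p \<in> supported S"
    using assms by (auto simp: supported_def in_keys_iff lookup_minus lookup_restrict_to split: if_splits)
  moreover have "restrict_to gaps p \<in> supported saturation"
    using restrict_to_in_supported[OF assms, of gaps] by (auto simp: supported_def)
  ultimately show ?thesis using G_eq_iff[OF assms, of "restrict_to gaps p"] by simp
qed

lemma supported_gaps: "p \<in> supported gaps \<Longrightarrow> p \<in> supported saturation"
  by (auto simp: supported_def)

text \<open>Discarding the exponents in S does not change the class, and two representatives
  supported on the gaps differ by an element supported both on the gaps and on S, that is, by
  zero.\<close>

lemma G_bij: "bij_betw G (supported gaps) (carrier H)"
  unfolding bij_betw_def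
proof
  show "inj_on G (supported gaps)"
  proof (rule inj_onI)
    fix p q assume pq: "p \<in> supported gaps" "q \<in> supported gaps" "G p = G q"
    then have "p - q \<in> supported S" by (simp add: G_eq_iff supported_gaps flip: G_eq_iff)
    moreover have "p - q \<in> supported gaps" using pq by (simp add: supported_diff)
    ultimately have "p - q = 0" by (rule supported_Int_disjoint) auto
    then show "p = q" by simp
  qed
  show "G ` supported gaps = carrier H"
  proof
    show "G ` supported gaps \<subseteq> carrier H" by (auto intro: G_carrier supported_gaps)
    show "carrier H \<subseteq> G ` supported gaps"
    proof
      fix x assume "x \<in> carrier H"
      then obtain p where "p \<in> supported saturation" "x = G p" by (rule G_carrierE)
      then show "x \<in> G ` supported gaps"
        using G_restrict_gaps[of p] restrict_to_in_supported[of p saturation gaps]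
        by (intro image_eqI[of _ _ "restrict_to gaps p"]) (auto simp: Int_absorb1)
    qed
  qed
qed

lemma gpart_gaps: "gpart H j = G ` homogeneous_part (monomial_degree d) gaps j"
proof -
  have "G ` supported {u \<in> saturation. int (level u) = j} = G ` supported {u \<in> gaps. int (level u) = j}"
  proof
    show "G ` supported {u \<in> gaps. int (level u) = j} \<subseteq> G ` supported {u \<in> saturation. int (level u) = j}"
      by (intro image_mono supported_mono) auto
    show "G ` supported {u \<in> saturation. int (level u) = j} \<subseteq> G ` supported {u \<in> gaps. int (level u) = j}"
    proof safe
      fix p :: "nat \<times> nat \<Rightarrow>\<^sub>0 'k" assume p: "p \<in> supported {u \<in> saturation. int (level u) = j}"
      then have "G p = G (restrict_to gaps p)" by (subst G_restrict_gaps) (auto simp: supported_def)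
      moreover have "restrict_to gaps p \<in> supported {u \<in> gaps. int (level u) = j}"
        using p by (auto simp: supported_def keys_restrict_to)
      ultimately show "G p \<in> G ` supported {u \<in> gaps. int (level u) = j}" by blast
    qed
  qed
  then show ?thesis by (simp add: G_gpart homogeneous_part_eq)
qed

section \<open>Vector space structure, top degree and length\<close>

lemma graded_iso:
  "graded_isomorphic field_ring (as_vector_space H)
    (graded_vector_space_on (monomial_degree d) gaps :: ('k, nat \<times> nat \<Rightarrow>\<^sub>0 'k) gmodule)"
  (is "graded_isomorphic _ ?V ?W")
proof -
  let ?f = "inv_into (supported gaps) G"
  have W: "carrier ?W = supported gaps" "gpart ?W = homogeneous_part (monomial_degree d) gaps"
    by (simp_all add: graded_vector_space_on_def supported_def)
  have V: "carrier ?V = carrier H" "gpart ?V = gpart H" by (simp_all add: as_vector_space_def)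
  have f_G: "?f (G p) = p" if "p \<in> supported gaps" for p
    using G_bij that by (auto simp: bij_betw_def)
  have hom_sub: "homogeneous_part (monomial_degree d) gaps n \<subseteq> (supported gaps :: (nat \<times> nat \<Rightarrow>\<^sub>0 'k) set)" for n
    by (auto simp: homogeneous_part_def supported_def)
  have gp: "?f ` gpart ?V n = gpart ?W n" for n
    using hom_sub[of n] by (force simp: V W gpart_gaps image_image f_G)
  have bij: "bij_betw ?f (carrier ?V) (carrier ?W)"
    unfolding V W by (rule bij_betw_inv_into[OF G_bij])
  have ex: "\<exists>p\<in>supported gaps. x = G p" if "x \<in> carrier H" for x
    using that G_bij by (auto simp: bij_betw_def)
  have add: "?f (x \<oplus>\<^bsub>?V\<^esub> y) = ?f x \<oplus>\<^bsub>?W\<^esub> ?f y" if xy: "x \<in> carrier ?V" "y \<in> carrier ?V" for x y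
  proof -
    obtain p q where pq: "p \<in> supported gaps" "q \<in> supported gaps" "x = G p" "y = G q"
      using ex xy V by metis
    then have "x \<oplus>\<^bsub>H\<^esub> y = G (p + q)" by (simp add: G_add supported_gaps)
    then show ?thesis
      using pq by (simp add: as_vector_space_def graded_vector_space_on_def f_G supported_add)
  qed
  have smult: "?f (c \<odot>\<^bsub>?V\<^esub> x) = c \<odot>\<^bsub>?W\<^esub> ?f x" if x: "x \<in> carrier ?V" for c x
  proof -
    obtain p where p: "p \<in> supported gaps" "x = G p" using ex x V by metis
    then have "Poly_Mapping.single 0 c \<odot>\<^bsub>H\<^esub> x = G (Poly_Mapping.single 0 c * p)"
      by (simp add: G_smult supported_gaps supported_single)
    moreover have "Poly_Mapping.single 0 c * p \<in> supported gaps"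
      by (rule supported_mult[OF supported_single[of 0 "{0}"] p(1)]) auto
    ultimately show ?thesis
      using p by (simp add: as_vector_space_def graded_vector_space_on_def f_G mult_map_scale_conv_mult)
  qed
  have "?f \<in> graded_hom field_ring ?V ?W"
    unfolding graded_hom_def using add smult bij_betwE[OF bij] gp by auto
  with bij gp show ?thesis unfolding graded_isomorphic_def by blast
qed

lemma top_degree_eq:
  assumes "gaps \<noteq> {}"
  shows "top_degree H = ereal (Max (monomial_degree d ` gaps))"
proof -
  have nonzero: "gpart H n \<noteq> {\<zero>\<^bsub>H\<^esub>} \<longleftrightarrow> (\<exists>u\<in>gaps. int (level u) = n)" for n
  proof
    assume "gpart H n \<noteq> {\<zero>\<^bsub>H\<^esub>}"
    moreover have "\<zero>\<^bsub>H\<^esub> \<in> gpart H n"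
      unfolding G_gpart using G_zero by (auto simp: homogeneous_part_eq intro: image_eqI[of _ _ 0])
    ultimately obtain x where "x \<in> gpart H n" "x \<noteq> \<zero>\<^bsub>H\<^esub>" by blast
    then obtain p where "p \<in> supported {u \<in> gaps. int (level u) = n}" "x = G p"
      unfolding gpart_gaps by (auto simp: homogeneous_part_eq)
    moreover from this \<open>x \<noteq> \<zero>\<^bsub>H\<^esub>\<close> have "p \<noteq> 0" using G_zero by blast
    ultimately show "\<exists>u\<in>gaps. int (level u) = n"
      unfolding supported_def by (auto simp flip: keys_eq_empty)
  next
    assume "\<exists>u\<in>gaps. int (level u) = n"
    then obtain u where u: "u \<in> gaps" "int (level u) = n" by blast
    then have "G (Poly_Mapping.single u 1) \<in> gpart H n"
      unfolding gpart_gaps by (intro imageI) (auto simp: homogeneous_part_eq supported_single)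
    moreover have "G (Poly_Mapping.single u 1) \<noteq> \<zero>\<^bsub>H\<^esub>"
      using u by (subst G_kernel) (auto simp: supported_def)
    ultimately show "gpart H n \<noteq> {\<zero>\<^bsub>H\<^esub>}" by blast
  qed
  have fin: "finite (monomial_degree d ` gaps)" using finite_gaps by simp
  have eq: "{ereal (of_int n) | n. gpart H n \<noteq> {\<zero>\<^bsub>H\<^esub>}} = (\<lambda>u. ereal (monomial_degree d u)) ` gaps"
    unfolding nonzero using degree_level by force
  show ?thesis
    unfolding top_degree_def eq
  proof (rule Sup_eqI)
    fix y assume "y \<in> (\<lambda>u. ereal (monomial_degree d u)) ` gaps"
    then show "y \<le> ereal (Max (monomial_degree d ` gaps))" using fin by auto
  next
    fix y assume y: "\<And>z. z \<in> (\<lambda>u. ereal (monomial_degree d u)) ` gaps \<Longrightarrow> z \<le> y"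
    have "Max (monomial_degree d ` gaps) \<in> monomial_degree d ` gaps" using fin assms by (intro Max_in) auto
    then show "ereal (Max (monomial_degree d ` gaps)) \<le> y" using y by blast
  qed
qed

text \<open>Pulled back along \<open>G\<close>, a strict chain of submodules is a strict chain of
  K-subspaces of the space spanned by the gaps. A vector chosen anew at each step is independent of
  the earlier ones, so the dimension bounds the number of steps.\<close>

lemma chain_length_le:
  assumes N: "\<And>i. i \<le> n \<Longrightarrow> submodule (N i) R H" "\<And>i. i < n \<Longrightarrow> N i \<subset> N (Suc i)"
  shows "n \<le> card gaps"
proof -
  define W where "W = (\<lambda>i. {p \<in> supported gaps. G p \<in> N i})"
  have subspace: "poly_mapping.subspace (W i)" if "i \<le> n" for i
  proof (rule poly_mapping.subspaceI)
    interpret N: submodule "N i" R H by (rule N(1)[OF that])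
    show "0 \<in> W i" using N.one_closed by (simp add: W_def G_zero)
    show "p + q \<in> W i" if "p \<in> W i" "q \<in> W i" for p q
      using that N.m_closed by (auto simp: W_def supported_add G_add supported_gaps)
    show "Poly_Mapping.single 0 c * p \<in> W i" if p: "p \<in> W i" for c p
    proof -
      have "Poly_Mapping.single 0 c * p \<in> supported gaps"
        by (rule supported_mult[OF supported_single[of 0 "{0}"], of p gaps]) (use p in \<open>auto simp: W_def\<close>)
      moreover have "G (Poly_Mapping.single 0 c * p) = Poly_Mapping.single 0 c \<odot>\<^bsub>H\<^esub> G p"
        using p by (intro G_smult) (auto simp: W_def supported_gaps supported_single)
      ultimately show ?thesis
        using p N.smult_closed by (simp add: W_def carrier_semigroup_ring supported_single)
    qed
  qed
  have "\<forall>i. \<exists>p. i < n \<longrightarrow> p \<in> W (Suc i) - W i"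
  proof (intro allI)
    fix i
    show "\<exists>p. i < n \<longrightarrow> p \<in> W (Suc i) - W i"
    proof (cases "i < n")
      case True
      then obtain x where x: "x \<in> N (Suc i)" "x \<notin> N i" using N(2) by blast
      have "x \<in> carrier H" using H.submoduleE(1)[OF N(1), of "Suc i"] True x(1) by auto
      then obtain p where "p \<in> supported gaps" "x = G p" using G_bij by (auto simp: bij_betw_def)
      with x show ?thesis by (auto simp: W_def)
    qed simp
  qed
  then obtain p where p: "\<And>i. i < n \<Longrightarrow> p i \<in> W (Suc i) - W i" by metis
  have mono: "W i \<subseteq> W (Suc i)" if "i < n" for i using N(2)[OF that] by (auto simp: W_def)
  have chain: "poly_mapping.independent (p ` {..<i}) \<and> p ` {..<i} \<subseteq> W i \<and> card (p ` {..<i}) = i"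
    if "i \<le> n" for i
    using that
  proof (induction i)
    case 0
    then show ?case by (simp add: poly_mapping.independent_empty)
  next
    case (Suc i)
    then have IH: "poly_mapping.independent (p ` {..<i})" "p ` {..<i} \<subseteq> W i" "card (p ` {..<i}) = i"
      and i: "i < n" by auto
    have "poly_mapping.span (p ` {..<i}) \<subseteq> W i"
      using poly_mapping.span_minimal[OF IH(2) subspace] i by simp
    then have new: "p i \<notin> poly_mapping.span (p ` {..<i})" using p[OF i] by blast
    have "p i \<notin> p ` {..<i}"
    proof
      assume "p i \<in> p ` {..<i}"
      from poly_mapping.span_base[OF this] new show False by simp
    qed
    moreover have "p ` {..<Suc i} = insert (p i) (p ` {..<i})" by (simp add: lessThan_Suc)
    ultimately show ?case
      using poly_mapping.independent_insertI[OF new IH(1)] IH(2,3) p[OF i] mono[OF i] by auto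
  qed
  have "p ` {..<n} \<subseteq> supported gaps" using chain[of n] by (auto simp: W_def)
  also have "\<dots> \<subseteq> poly_mapping.span ((\<lambda>u. Poly_Mapping.single u (1::'k)) ` gaps)"
    by (rule supported_span)
  finally have "card (p ` {..<n}) \<le> card ((\<lambda>u. Poly_Mapping.single u (1::'k)) ` gaps)"
    using chain[of n] finite_gaps by (intro conjunct2[OF poly_mapping.independent_span_bound]) simp_all
  also have "\<dots> \<le> card gaps" using finite_gaps by (rule card_image_le)
  finally show ?thesis using chain[of n] by simp
qed

text \<open>Listing the gaps by decreasing degree, every initial segment together with \<open>S\<close> is stable
  under translation by \<open>S\<close>.\<close>

lemma composition_chain:
  "\<exists>N. (\<forall>i\<le>card gaps. submodule (N i) R H) \<and> (\<forall>i<card gaps. N i \<subset> N (Suc i))"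
proof -
  obtain ys where ys: "set ys = gaps" "distinct ys" using finite_distinct_list[OF finite_gaps] by blast
  define xs where "xs = sort_key (\<lambda>u. - int (level u)) ys"
  have xs: "set xs = gaps" "distinct xs" "length xs = card gaps"
    using ys distinct_card[OF ys(2)] by (simp_all add: xs_def)
  have sorted: "level (xs ! j) \<le> level (xs ! i)" if "i \<le> j" "j < length xs" for i j
    using sorted_nth_mono[OF sorted_sort_key[of "\<lambda>u. - int (level u)" ys], of i j] that
    by (simp add: xs_def[symmetric])
  define T where "T = (\<lambda>i. S \<union> set (take i xs))"
  have T_sat: "T i \<subseteq> saturation" for i
    using S_subset_saturation xs(1) by (auto simp: T_def dest: in_set_takeD)
  have T_closed: "s + u \<in> T i" if s: "s \<in> S" and u: "u \<in> T i" for s u i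
  proof (cases "s = 0 \<or> s + u \<in> S")
    case True
    then show ?thesis using u by (auto simp: T_def)
  next
    case False
    then have "u \<in> set (take i xs)" using u add_mem[OF s, of u] by (auto simp: T_def)
    then obtain l where l: "l < i" "l < length xs" "u = xs ! l" by (auto simp: in_set_conv_nth)
    have sat: "s \<in> saturation" "u \<in> saturation" using s S_subset_saturation u T_sat by auto
    then have "s + u \<in> gaps" using False sat.add_mem by auto
    then obtain j where j: "j < length xs" "s + u = xs ! j" by (metis xs(1) in_set_conv_nth)
    \<comment> \<open>Translation by a nonzero s strictly raises the level, so a translate that is
      still a gap occurs earlier in the list.\<close>
    have "0 < level s" using level_pos[OF sat(1)] False by simp
    then have "level u < level (s + u)" by (simp add: level_add sat)
    then have "j < i" using sorted[of l j] l j by (metis leI le_trans linorder_not_less order_less_imp_le)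
    then show ?thesis using j by (auto simp: T_def in_set_conv_nth)
  qed
  define N where "N = (\<lambda>i. G ` supported (T i))"
  have T_supp: "p \<in> supported (T i) \<Longrightarrow> p \<in> supported saturation" for p :: "nat \<times> nat \<Rightarrow>\<^sub>0 'k" and i
    using supported_mono[OF T_sat] by blast
  have "submodule (N i) R H" for i
  proof (rule H.submoduleI)
    show "N i \<subseteq> carrier H" by (auto simp: N_def intro: G_carrier T_supp)
    show "\<zero>\<^bsub>H\<^esub> \<in> N i" unfolding N_def using G_zero by (metis imageI supported_zero)
    fix x assume "x \<in> N i"
    then obtain p where p: "p \<in> supported (T i)" "x = G p" by (auto simp: N_def)
    have "\<ominus>\<^bsub>H\<^esub> x = G (- p)"
      using p G_add[of "- p" p]
      by (intro H.M.minus_equality) (auto simp: G_zero T_supp supported_uminus G_carrier)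
    then show "\<ominus>\<^bsub>H\<^esub> x \<in> N i" using p by (auto simp: N_def supported_uminus)
    { fix y assume "y \<in> N i"
      then obtain q where q: "q \<in> supported (T i)" "y = G q" by (auto simp: N_def)
      have "x \<oplus>\<^bsub>H\<^esub> y = G (p + q)" using p q by (simp add: G_add T_supp)
      then show "x \<oplus>\<^bsub>H\<^esub> y \<in> N i" using p q by (auto simp: N_def supported_add) }
    fix r :: "nat \<times> nat \<Rightarrow>\<^sub>0 'k" assume "r \<in> carrier R"
    then have r: "r \<in> supported S" by (simp add: carrier_semigroup_ring)
    have "r \<odot>\<^bsub>H\<^esub> x = G (r * p)" using r p by (simp add: G_smult T_supp)
    moreover have "r * p \<in> supported (T i)" using r p(1) T_closed by (rule supported_mult)
    ultimately show "r \<odot>\<^bsub>H\<^esub> x \<in> N i" by (auto simp: N_def)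
  qed
  moreover have "N i \<subset> N (Suc i)" if i: "i < card gaps" for i
  proof
    have len: "i < length xs" using i xs(3) by simp
    show "N i \<subseteq> N (Suc i)"
      unfolding N_def T_def using set_take_subset_set_take[of i "Suc i" xs]
      by (intro image_mono supported_mono) auto
    let ?p = "Poly_Mapping.single (xs ! i) (1::'k)"
    have "xs ! i \<in> gaps" using len xs(1) nth_mem by blast
    have p: "?p \<in> supported (T (Suc i))"
      using len by (intro supported_single) (auto simp: T_def take_Suc_conv_app_nth)
    have "G ?p \<notin> N i"
    proof
      assume "G ?p \<in> N i"
      then obtain q where q: "q \<in> supported (T i)" "G ?p = G q" by (auto simp: N_def)
      then have "?p - q \<in> supported S" using p T_supp by (simp flip: G_eq_iff)
      moreover have "xs ! i \<notin> T i"
        using \<open>xs ! i \<in> gaps\<close> len xs(2) by (auto simp: T_def in_set_conv_nth nth_eq_iff_index_eq)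
      then have "xs ! i \<notin> Poly_Mapping.keys q" using q(1) by (auto simp: supported_def)
      then have "xs ! i \<in> Poly_Mapping.keys (?p - q)" by (simp add: in_keys_iff lookup_minus)
      ultimately show False using \<open>xs ! i \<in> gaps\<close> by (auto simp: supported_def)
    qed
    moreover have "G ?p \<in> N (Suc i)" using p by (simp add: N_def)
    ultimately show "N i \<noteq> N (Suc i)" by blast
  qed
  ultimately show ?thesis by blast
qed

lemma module_length_eq: "module_length R H = enat (card gaps)"
proof (rule antisym)
  show "module_length R H \<le> enat (card gaps)"
    unfolding module_length_def
  proof (rule Sup_least, clarify)
    fix n N assume "\<forall>i\<le>n. submodule (N i) R H" "\<forall>i<n. N i \<subset> N (Suc i)"
    then show "enat n \<le> enat (card gaps)" using chain_length_le[of n N] by simp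
  qed
  show "enat (card gaps) \<le> module_length R H"
    unfolding module_length_def by (intro Sup_upper) (use composition_chain in blast)
qed

end

section \<open>Graded ideals inside an injective module\<close>

locale curve_embedding = monomial_curve A d for A d +
  fixes E :: "(nat \<times> nat \<Rightarrow>\<^sub>0 'k::field, 'm) gmodule" and \<epsilon> :: "(nat \<times> nat \<Rightarrow>\<^sub>0 'k) \<Rightarrow> 'm"
  assumes E_module: "module (semigroup_ring S) E"
    and eps_closed: "f \<in> supported S \<Longrightarrow> \<epsilon> f \<in> carrier E"
    and eps_add: "f \<in> supported S \<Longrightarrow> g \<in> supported S \<Longrightarrow> \<epsilon> (f + g) = \<epsilon> f \<oplus>\<^bsub>E\<^esub> \<epsilon> g"
    and eps_smult: "r \<in> supported S \<Longrightarrow> f \<in> supported S \<Longrightarrow> \<epsilon> (r * f) = r \<odot>\<^bsub>E\<^esub> \<epsilon> f"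
    and eps_inj: "inj_on \<epsilon> (supported S)"
begin

sublocale E: module "semigroup_ring S" E by (rule E_module)

lemma eps_zero: "\<epsilon> 0 = \<zero>\<^bsub>E\<^esub>"
  using eps_smult[of 0 0] eps_closed[of 0] E.smult_l_null[of "\<epsilon> 0"] by simp

lemma eps_eq_zero: "f \<in> supported S \<Longrightarrow> \<epsilon> f = \<zero>\<^bsub>E\<^esub> \<longleftrightarrow> f = 0"
  using inj_on_eq_iff[OF eps_inj, of f 0] by (simp add: eps_zero)

text \<open>The monomial ideal on T, copied into E so that its carrier has the type demanded of test
  modules. The shift by n makes multiplication by a monomial of level n a map of degree 0 into
  it.\<close>

definition shifted_ideal :: "(nat \<times> nat) set \<Rightarrow> int \<Rightarrow> (nat \<times> nat \<Rightarrow>\<^sub>0 'k, 'm) gmodule" where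
  "shifted_ideal T n = \<lparr>carrier = \<epsilon> ` supported T, monoid.mult = undefined, monoid.one = undefined,
    ring.zero = \<zero>\<^bsub>E\<^esub>, add = (\<oplus>\<^bsub>E\<^esub>), smult = (\<odot>\<^bsub>E\<^esub>),
    gpart = (\<lambda>j. \<epsilon> ` homogeneous_part (monomial_degree d) T (j + n))\<rparr>"

lemma shifted_ideal_simps [simp]:
  "carrier (shifted_ideal T n) = \<epsilon> ` supported T"
  "\<zero>\<^bsub>shifted_ideal T n\<^esub> = \<zero>\<^bsub>E\<^esub>"
  "x \<oplus>\<^bsub>shifted_ideal T n\<^esub> y = x \<oplus>\<^bsub>E\<^esub> y"
  "r \<odot>\<^bsub>shifted_ideal T n\<^esub> x = r \<odot>\<^bsub>E\<^esub> x"
  "gpart (shifted_ideal T n) j = \<epsilon> ` homogeneous_part (monomial_degree d) T (j + n)"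
  by (simp_all add: shifted_ideal_def)

context
  fixes T :: "(nat \<times> nat) set" and n :: int
  assumes T_S: "T \<subseteq> S" and T_closed: "\<And>s u. s \<in> S \<Longrightarrow> u \<in> T \<Longrightarrow> s + u \<in> T"
begin

lemma T_supp: "f \<in> supported T \<Longrightarrow> f \<in> supported S"
  using supported_mono[OF T_S] by blast

lemma T_sat: "T \<subseteq> saturation"
  using T_S S_subset_saturation by blast

lemma shifted_ideal_module: "module R (shifted_ideal T n)"
proof (rule moduleI)
  show "cring (R :: (nat \<times> nat \<Rightarrow>\<^sub>0 'k) ring)" by (rule cring_semigroup_ring)
  show "abelian_group (shifted_ideal T n)"
  proof (rule abelian_groupI)
    fix x assume "x \<in> carrier (shifted_ideal T n)"
    then obtain f where f: "f \<in> supported T" "x = \<epsilon> f" by auto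
    then show "\<exists>y\<in>carrier (shifted_ideal T n). y \<oplus>\<^bsub>shifted_ideal T n\<^esub> x = \<zero>\<^bsub>shifted_ideal T n\<^esub>"
      using eps_add[of "- f" f] by (auto intro!: bexI[of _ "- f"] simp: supported_uminus T_supp eps_zero)
  qed (auto simp: eps_closed T_supp eps_zero[symmetric] E.M.a_ac supported_add ac_simps
      simp flip: eps_add intro!: imageI simp del: E.M.l_zero)
next
  fix a :: "nat \<times> nat \<Rightarrow>\<^sub>0 'k" and x
  assume "a \<in> carrier R" "x \<in> carrier (shifted_ideal T n)"
  then show "a \<odot>\<^bsub>shifted_ideal T n\<^esub> x \<in> carrier (shifted_ideal T n)"
    using T_closed by (auto simp: carrier_semigroup_ring T_supp simp flip: eps_smult
        intro!: imageI supported_mult[of a S])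
qed (auto simp: eps_closed T_supp E.smult_r_distr E.smult_l_distr[simplified] E.smult_assoc1[simplified]
      E.smult_one[simplified])

lemma shifted_ideal_finsum:
  assumes "finite I" "\<And>i. i \<in> I \<Longrightarrow> g i \<in> supported T"
  shows "(\<Oplus>\<^bsub>shifted_ideal T n\<^esub>i\<in>I. \<epsilon> (g i)) = \<epsilon> (\<Sum>i\<in>I. g i)"
  using assms
proof (induction I rule: finite_induct)
  interpret N: module R "shifted_ideal T n" by (rule shifted_ideal_module)
  {
    case empty
    then show ?case by (simp add: eps_zero)
  next
    case (insert i I)
    then show ?case by (subst N.M.finsum_insert) (auto simp: eps_add T_supp supported_sum)
  }
qed

text \<open>Components are cut out by the level. For uniqueness, injectivity of \<epsilon> brings
  two decompositions back to K[S], where they are compared coefficientwise: each exponent belongs to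
  exactly one degree.\<close>

lemma shifted_ideal_graded:
  "graded_module R (homogeneous_part (monomial_degree d) S) (shifted_ideal T n)"
proof -
  interpret N: module R "shifted_ideal T n" by (rule shifted_ideal_module)
  let ?hom = "\<lambda>j. homogeneous_part (monomial_degree d) T (j + n) :: (nat \<times> nat \<Rightarrow>\<^sub>0 'k) set"
  have hom: "?hom j = supported {u \<in> T. int (level u) = j + n}" for j
    by (rule homogeneous_part_eq[OF T_sat])
  have hom_T: "f \<in> ?hom j \<Longrightarrow> f \<in> supported T" for f j by (auto simp: homogeneous_part_def supported_def)
  have "subgroup (gpart (shifted_ideal T n) j) (add_monoid (shifted_ideal T n))" for j
  proof (rule N.M.add.subgroupI)
    show "gpart (shifted_ideal T n) j \<subseteq> carrier (shifted_ideal T n)" by (auto intro: hom_T)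
    show "gpart (shifted_ideal T n) j \<noteq> {}" by (simp add: hom) (use supported_zero in blast)
    fix x assume "x \<in> gpart (shifted_ideal T n) j"
    then obtain f where f: "f \<in> ?hom j" "x = \<epsilon> f" by auto
    have "\<ominus>\<^bsub>shifted_ideal T n\<^esub> x = \<epsilon> (- f)"
      using f eps_add[of "- f" f] hom_T[OF f(1)]
      by (intro N.M.minus_equality) (auto simp: supported_uminus T_supp eps_zero)
    moreover have "- f \<in> ?hom j" using f(1) by (simp add: hom supported_uminus)
    ultimately show "\<ominus>\<^bsub>shifted_ideal T n\<^esub> x \<in> gpart (shifted_ideal T n) j" by simp
    fix y assume "y \<in> gpart (shifted_ideal T n) j"
    then obtain g where g: "g \<in> ?hom j" "y = \<epsilon> g" by auto
    have "x \<oplus>\<^bsub>E\<^esub> y = \<epsilon> (f + g)" using f g hom_T by (simp add: eps_add T_supp)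
    moreover have "f + g \<in> ?hom j" using f g by (simp add: hom supported_add)
    ultimately show "x \<oplus>\<^bsub>shifted_ideal T n\<^esub> y \<in> gpart (shifted_ideal T n) j" by simp
  qed
  moreover have "\<exists>!c. (\<forall>j. c j \<in> gpart (shifted_ideal T n) j) \<and> finite {j. c j \<noteq> \<zero>\<^bsub>shifted_ideal T n\<^esub>}
      \<and> x = (\<Oplus>\<^bsub>shifted_ideal T n\<^esub>j\<in>{j. c j \<noteq> \<zero>\<^bsub>shifted_ideal T n\<^esub>}. c j)" (is "\<exists>!c. ?dec c")
    if x: "x \<in> carrier (shifted_ideal T n)" for x
  proof -
    obtain f where f: "f \<in> supported T" "x = \<epsilon> f" using x by auto
    define p where "p j = restrict_to {u. int (level u) = j + n} f" for j
    have p: "p j \<in> ?hom j" for j using f(1) by (auto simp: p_def hom supported_def keys_restrict_to)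
    show ?thesis
    proof (rule ex1I)
      let ?J = "{j. \<epsilon> (p j) \<noteq> \<zero>\<^bsub>E\<^esub>}"
      have J: "?J = {j. p j \<noteq> 0}" by (simp add: eps_eq_zero T_supp[OF hom_T[OF p]])
      have "?J \<subseteq> (\<lambda>u. int (level u) - n) ` Poly_Mapping.keys f"
      proof
        fix j assume "j \<in> ?J"
        then have "Poly_Mapping.keys (p j) \<noteq> {}" unfolding J by simp
        then obtain u where "u \<in> Poly_Mapping.keys f" "int (level u) = j + n"
          unfolding p_def keys_restrict_to by auto
        then show "j \<in> (\<lambda>u. int (level u) - n) ` Poly_Mapping.keys f"
          by (intro image_eqI[of _ _ u]) auto
      qed
      then have fin: "finite ?J" by (rule finite_subset) simp
      have "f = (\<Sum>j\<in>?J. p j)"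
      proof (rule poly_mapping_eqI)
        fix u
        have "(\<Sum>j\<in>?J. Poly_Mapping.lookup (p j) u)
            = (\<Sum>j\<in>?J. if j = int (level u) - n then Poly_Mapping.lookup f u else 0)"
          by (intro sum.cong) (auto simp: p_def lookup_restrict_to)
        also have "\<dots> = (if int (level u) - n \<in> ?J then Poly_Mapping.lookup f u else 0)"
          using fin by simp
        also have "\<dots> = Poly_Mapping.lookup f u"
        proof (cases "Poly_Mapping.lookup f u = 0")
          case False
          then have "Poly_Mapping.lookup (p (int (level u) - n)) u \<noteq> 0"
            by (simp add: p_def lookup_restrict_to)
          then have "p (int (level u) - n) \<noteq> 0" by auto
          then show ?thesis unfolding J by simp
        qed simp
        finally show "Poly_Mapping.lookup f u = Poly_Mapping.lookup (\<Sum>j\<in>?J. p j) u"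
          by (simp add: lookup_sum)
      qed
      then have "\<epsilon> f = \<epsilon> (\<Sum>j\<in>?J. p j)" by (rule arg_cong)
      then have "x = (\<Oplus>\<^bsub>shifted_ideal T n\<^esub>j\<in>?J. \<epsilon> (p j))"
        unfolding f(2) by (simp only: shifted_ideal_finsum[OF fin hom_T[OF p]])
      then show "?dec (\<lambda>j. \<epsilon> (p j))" using p fin by simp
    next
      fix c assume c: "?dec c"
      then have "\<forall>j. \<exists>g. g \<in> ?hom j \<and> c j = \<epsilon> g" by auto
      then obtain g where g: "\<And>j. g j \<in> ?hom j" "\<And>j. c j = \<epsilon> (g j)" by metis
      let ?J = "{j. c j \<noteq> \<zero>\<^bsub>E\<^esub>}"
      have gT: "g j \<in> supported T" for j using g(1) by (rule hom_T)
      have fin: "finite ?J" using c by simp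
      have "\<epsilon> f = \<epsilon> (\<Sum>j\<in>?J. g j)"
        using c shifted_ideal_finsum[OF fin, of g] gT by (simp add: f(2) g(2))
      then have f_eq: "f = (\<Sum>j\<in>?J. g j)"
        by (rule inj_onD[OF eps_inj]) (auto simp: f(1) T_supp gT intro!: supported_sum)
      have "g j = p j" for j
      proof (rule poly_mapping_eqI)
        fix u
        have other: "Poly_Mapping.lookup (g i) u = 0" if "int (level u) \<noteq> i + n" for i
          using g(1)[of i] that by (auto simp: hom supported_def in_keys_iff)
        show "Poly_Mapping.lookup (g j) u = Poly_Mapping.lookup (p j) u"
        proof (cases "int (level u) = j + n")
          case True
          have "Poly_Mapping.lookup f u = (\<Sum>i\<in>?J. Poly_Mapping.lookup (g i) u)"
            by (subst f_eq) (simp add: lookup_sum)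
          also have "\<dots> = (\<Sum>i\<in>?J. if i = j then Poly_Mapping.lookup (g j) u else 0)"
            using other True by (intro sum.cong) auto
          also have "\<dots> = (if j \<in> ?J then Poly_Mapping.lookup (g j) u else 0)"
            using fin by simp
          also have "\<dots> = Poly_Mapping.lookup (g j) u"
            using eps_eq_zero[OF T_supp[OF gT[of j]]] by (auto simp: g(2))
          finally show ?thesis using True by (simp add: p_def lookup_restrict_to)
        next
          case False
          then show ?thesis using other[of j] by (simp add: p_def lookup_restrict_to)
        qed
      qed
      then show "c = (\<lambda>j. \<epsilon> (p j))" using g(2) by auto
    qed
  qed
  moreover have "r \<odot>\<^bsub>shifted_ideal T n\<^esub> x \<in> gpart (shifted_ideal T n) (i + j)"
    if r: "r \<in> homogeneous_part (monomial_degree d) S i" and x: "x \<in> gpart (shifted_ideal T n) j" for i j r x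
  proof -
    obtain f where f: "f \<in> ?hom j" "x = \<epsilon> f" using x by auto
    have r': "r \<in> supported {u \<in> S. int (level u) = i}"
      using r by (simp add: homogeneous_part_eq[OF S_subset_saturation])
    have "r * f \<in> ?hom (i + j)"
      unfolding hom
    proof (rule supported_mult[OF r' f(1)[unfolded hom]])
      fix s u assume su: "s \<in> {u \<in> S. int (level u) = i}" "u \<in> {u \<in> T. int (level u) = j + n}"
      then have "level (s + u) = level s + level u"
        using T_sat S_subset_saturation by (intro level_add) auto
      then show "s + u \<in> {u \<in> T. int (level u) = i + j + n}" using su T_closed by simp
    qed
    moreover have "r \<in> supported S" using r' by (auto simp: supported_def)
    then have "r \<odot>\<^bsub>E\<^esub> x = \<epsilon> (r * f)"
      using eps_smult[of r f] T_supp[OF hom_T[OF f(1)]] f(2) by simp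
    ultimately show ?thesis by simp
  qed
  ultimately show ?thesis unfolding graded_module_def using shifted_ideal_module by blast
qed

end

end

section \<open>Extending the augmentation\<close>

lemma graded_hom_finsum:
  assumes "module R M" "module R N" "\<phi> \<in> graded_hom R M N" "finite J" "\<And>j. j \<in> J \<Longrightarrow> c j \<in> carrier M"
  shows "\<phi> (\<Oplus>\<^bsub>M\<^esub>j\<in>J. c j) = (\<Oplus>\<^bsub>N\<^esub>j\<in>J. \<phi> (c j))"
proof -
  interpret M: module R M by fact
  interpret N: module R N by fact
  have closed: "x \<in> carrier M \<Longrightarrow> \<phi> x \<in> carrier N" for x
    using assms(3) by (auto simp: graded_hom_def)
  have add: "x \<in> carrier M \<Longrightarrow> y \<in> carrier M \<Longrightarrow> \<phi> (x \<oplus>\<^bsub>M\<^esub> y) = \<phi> x \<oplus>\<^bsub>N\<^esub> \<phi> y" for x y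
    using assms(3) by (simp add: graded_hom_def)
  have "\<phi> \<zero>\<^bsub>M\<^esub> = \<phi> \<zero>\<^bsub>M\<^esub> \<oplus>\<^bsub>N\<^esub> \<phi> \<zero>\<^bsub>M\<^esub>" using add[of "\<zero>\<^bsub>M\<^esub>" "\<zero>\<^bsub>M\<^esub>"] by simp
  then have zero: "\<phi> \<zero>\<^bsub>M\<^esub> = \<zero>\<^bsub>N\<^esub>" using closed[of "\<zero>\<^bsub>M\<^esub>"] by simp
  show ?thesis
    using assms(4,5)
  proof (induction J rule: finite_induct)
    case (insert j J)
    then have "c \<in> J \<rightarrow> carrier M" by auto
    then show ?case
      using insert closed by (simp add: M.M.finsum_insert N.M.finsum_insert add M.M.finsum_closed)
  qed (simp add: zero)
qed

lemma ex1_unique: "P a \<Longrightarrow> P b \<Longrightarrow> \<exists>!x. P x \<Longrightarrow> a = b"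
  by blast

lemma graded_module_gpart_subset:
  assumes "graded_module R G M" "x \<in> gpart M n"
  shows "x \<in> carrier M"
  using assms subgroup.subset[of "gpart M n" "add_monoid M"] by (auto simp: graded_module_def)

lemma graded_hom_gpart: "\<phi> \<in> graded_hom R M N \<Longrightarrow> x \<in> gpart M n \<Longrightarrow> \<phi> x \<in> gpart N n"
  unfolding graded_hom_def by blast

text \<open>The images of the components of x and the family concentrated in degree n both decompose
  \<phi> x. By uniqueness they agree, so the component of x in degree n is the desired
  preimage.\<close>

lemma graded_hom_homogeneous_preimage:
  assumes M: "graded_module R G M" and N: "graded_module R G N" and \<phi>: "\<phi> \<in> graded_hom R M N"
    and x: "x \<in> carrier M" "\<phi> x \<in> gpart N n"
  obtains x' where "x' \<in> gpart M n" "\<phi> x' = \<phi> x"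
proof -
  interpret M: module R M using M by (simp add: graded_module_def)
  interpret N: module R N using N by (simp add: graded_module_def)
  obtain c where c: "\<And>j. c j \<in> gpart M j" "finite {j. c j \<noteq> \<zero>\<^bsub>M\<^esub>}"
    "x = (\<Oplus>\<^bsub>M\<^esub>j\<in>{j. c j \<noteq> \<zero>\<^bsub>M\<^esub>}. c j)"
    using M x(1) unfolding graded_module_def by blast
  have cM: "c j \<in> carrier M" for j using graded_module_gpart_subset[OF M c(1)] .
  have \<phi>c: "\<phi> (c j) \<in> gpart N j" for j using graded_hom_gpart[OF \<phi> c(1)] .
  have \<phi>cN: "\<phi> (c j) \<in> carrier N" for j using graded_module_gpart_subset[OF N \<phi>c] .
  have \<phi>x: "\<phi> x \<in> carrier N" using graded_module_gpart_subset[OF N x(2)] .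
  have \<phi>0: "\<phi> \<zero>\<^bsub>M\<^esub> = \<zero>\<^bsub>N\<^esub>"
    using graded_hom_finsum[OF M.module_axioms N.module_axioms \<phi>, of "{}"] by simp
  have zero: "\<zero>\<^bsub>N\<^esub> \<in> gpart N j" for j
    using N subgroup.one_closed[of "gpart N j" "add_monoid N"] by (auto simp: graded_module_def)
  let ?dec = "\<lambda>c. (\<forall>j. c j \<in> gpart N j) \<and> finite {j. c j \<noteq> \<zero>\<^bsub>N\<^esub>} \<and> \<phi> x = (\<Oplus>\<^bsub>N\<^esub>j\<in>{j. c j \<noteq> \<zero>\<^bsub>N\<^esub>}. c j)"
  have sub: "{j. \<phi> (c j) \<noteq> \<zero>\<^bsub>N\<^esub>} \<subseteq> {j. c j \<noteq> \<zero>\<^bsub>M\<^esub>}" using \<phi>0 by auto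
  have "\<phi> x = (\<Oplus>\<^bsub>N\<^esub>j\<in>{j. c j \<noteq> \<zero>\<^bsub>M\<^esub>}. \<phi> (c j))"
    using graded_hom_finsum[OF M.module_axioms N.module_axioms \<phi> c(2)] cM c(3) by simp
  also have "\<dots> = (\<Oplus>\<^bsub>N\<^esub>j\<in>{j. \<phi> (c j) \<noteq> \<zero>\<^bsub>N\<^esub>}. \<phi> (c j))"
    using sub c(2) \<phi>cN by (intro N.M.add.finprod_mono_neutral_cong_right) auto
  finally have "?dec (\<lambda>j. \<phi> (c j))" using \<phi>c finite_subset[OF sub c(2)] by blast
  moreover have "?dec (\<lambda>j. if j = n then \<phi> x else \<zero>\<^bsub>N\<^esub>)"
  proof (cases "\<phi> x = \<zero>\<^bsub>N\<^esub>")
    case False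
    then have "{j. (if j = n then \<phi> x else \<zero>\<^bsub>N\<^esub>) \<noteq> \<zero>\<^bsub>N\<^esub>} = {n}" by auto
    then show ?thesis using zero x(2) \<phi>x by simp
  qed (use zero in simp)
  moreover have "\<exists>!c. ?dec c" using N \<phi>x unfolding graded_module_def by simp
  ultimately have "(\<lambda>j. \<phi> (c j)) = (\<lambda>j. if j = n then \<phi> x else \<zero>\<^bsub>N\<^esub>)" by (rule ex1_unique)
  from fun_cong[OF this, of n] have "\<phi> (c n) = \<phi> x" by simp
  then show thesis using that c(1) by blast
qed

section \<open>The resolution and its augmentation\<close>

locale curve_resolution = monomial_curve A d for A d +
  fixes \<epsilon> :: "(nat \<times> nat \<Rightarrow>\<^sub>0 'k::field) \<Rightarrow> 'm" and E D
  assumes resolution: "graded_injective_resolution (semigroup_ring S)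
    (gpart (semigroup_ring_module (monomial_degree d) S)) (semigroup_ring_module (monomial_degree d) S) \<epsilon> E D"
begin

abbreviation hom_part :: "(nat \<times> nat) set \<Rightarrow> int \<Rightarrow> (nat \<times> nat \<Rightarrow>\<^sub>0 'k) set" where
  "hom_part \<equiv> homogeneous_part (monomial_degree d)"

lemma RG_simps:
  "carrier (semigroup_ring_module (monomial_degree d) S) = supported S"
  "gpart (semigroup_ring_module (monomial_degree d) S) = hom_part S"
  "f \<oplus>\<^bsub>semigroup_ring_module (monomial_degree d) S\<^esub> g = f + g"
  "f \<odot>\<^bsub>semigroup_ring_module (monomial_degree d) S\<^esub> g = f * g"
  by (simp_all add: semigroup_ring_module_def supported_def)

lemma hom_part_S: "hom_part S j = supported {u \<in> S. int (level u) = j}"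
  by (rule homogeneous_part_eq[OF S_subset_saturation])

lemma hom_part_sat: "hom_part saturation j = supported {u \<in> saturation. int (level u) = j}"
  by (rule homogeneous_part_eq) simp

lemma E_injective: "graded_injective R (hom_part S) (E n)"
  using resolution by (simp add: graded_injective_resolution_def RG_simps)

lemma E_graded: "graded_module R (hom_part S) (E n)"
  using E_injective by (simp add: graded_injective_def)

lemma E_module: "module R (E n)"
  using E_graded by (simp add: graded_module_def)

lemma E_smult_gpart: "r \<in> hom_part S i \<Longrightarrow> x \<in> gpart (E n) j \<Longrightarrow> r \<odot>\<^bsub>E n\<^esub> x \<in> gpart (E n) (i + j)"
  using E_graded by (simp add: graded_module_def)

lemma D_hom: "D n \<in> graded_hom R (E n) (E (Suc n))"
  using resolution by (simp add: graded_injective_resolution_def)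

lemma D_closed: "x \<in> carrier (E n) \<Longrightarrow> D n x \<in> carrier (E (Suc n))"
  and D_add: "x \<in> carrier (E n) \<Longrightarrow> y \<in> carrier (E n) \<Longrightarrow> D n (x \<oplus>\<^bsub>E n\<^esub> y) = D n x \<oplus>\<^bsub>E (Suc n)\<^esub> D n y"
  and D_smult: "r \<in> supported S \<Longrightarrow> x \<in> carrier (E n) \<Longrightarrow> D n (r \<odot>\<^bsub>E n\<^esub> x) = r \<odot>\<^bsub>E (Suc n)\<^esub> D n x"
  using D_hom[of n] by (auto simp: graded_hom_def carrier_semigroup_ring)

lemma D_gpart: "x \<in> gpart (E n) j \<Longrightarrow> D n x \<in> gpart (E (Suc n)) j"
  by (rule graded_hom_gpart[OF D_hom])

lemma D_image: "D n ` carrier (E n) = {x \<in> carrier (E (Suc n)). D (Suc n) x = \<zero>\<^bsub>E (Suc (Suc n))\<^esub>}"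
  using resolution by (simp add: graded_injective_resolution_def)

lemma eps_hom: "\<epsilon> \<in> graded_hom R (semigroup_ring_module (monomial_degree d) S) (E 0)"
  using resolution by (simp add: graded_injective_resolution_def)

lemma eps_gpart: "f \<in> hom_part S j \<Longrightarrow> \<epsilon> f \<in> gpart (E 0) j"
  using graded_hom_gpart[OF eps_hom, of f j] by (simp add: RG_simps)

lemma eps_image: "\<epsilon> ` supported S = {x \<in> carrier (E 0). D 0 x = \<zero>\<^bsub>E (Suc 0)\<^esub>}"
  using resolution by (simp add: graded_injective_resolution_def RG_simps)

sublocale emb: curve_embedding A d "E 0" \<epsilon>
proof (intro curve_embedding.intro curve_embedding_axioms.intro)
  show "monomial_curve A d" by (rule monomial_curve_axioms)
  show "module R (E 0)" by (rule E_module)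
  show "inj_on \<epsilon> (supported S)"
    using resolution by (simp add: graded_injective_resolution_def RG_simps)
qed (use eps_hom in \<open>auto simp: graded_hom_def RG_simps carrier_semigroup_ring\<close>)

sublocale E1: module "semigroup_ring S" "E (Suc 0)"
  by (rule E_module)

text \<open>A graded homomorphism is only required to map components into components. For \<epsilon>
  the converse follows by taking a homogeneous preimage under the inclusion of its image and using
  injectivity.\<close>

lemma eps_homogeneous:
  assumes "f \<in> supported S" "\<epsilon> f \<in> gpart (E 0) j"
  shows "f \<in> hom_part S j"
proof -
  have M: "graded_module R (hom_part S) (emb.shifted_ideal S 0)"
    by (rule emb.shifted_ideal_graded) (auto intro: add_mem)
  have i: "(\<lambda>x. x) \<in> graded_hom R (emb.shifted_ideal S 0) (E 0)"
    by (auto simp: graded_hom_def emb.eps_closed eps_gpart)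
  obtain x where "x \<in> gpart (emb.shifted_ideal S 0) j" "x = \<epsilon> f"
    using graded_hom_homogeneous_preimage[OF M E_graded i, of "\<epsilon> f" j] assms by auto
  then obtain g where g: "g \<in> hom_part S j" "\<epsilon> g = \<epsilon> f" by auto
  moreover have "g \<in> supported S" using g(1) by (auto simp: hom_part_S supported_def)
  ultimately show ?thesis using assms(1) inj_onD[OF emb.eps_inj] by metis
qed

definition extends_eps :: "((nat \<times> nat \<Rightarrow>\<^sub>0 'k) \<Rightarrow> 'm) \<Rightarrow> bool" where
  "extends_eps h \<longleftrightarrow> (\<forall>p\<in>supported saturation. h p \<in> carrier (E 0))
    \<and> (\<forall>p\<in>supported saturation. \<forall>q\<in>supported saturation. h (p + q) = h p \<oplus>\<^bsub>E 0\<^esub> h q)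
    \<and> (\<forall>r\<in>supported S. \<forall>p\<in>supported saturation. h (r * p) = r \<odot>\<^bsub>E 0\<^esub> h p)
    \<and> (\<forall>f\<in>supported S. h f = \<epsilon> f)
    \<and> (\<forall>j. \<forall>p\<in>hom_part saturation j. h p \<in> gpart (E 0) j)"

text \<open>Multiplication by a large power of \<open>X0\<close> moves \<open>K[saturation]\<close> into \<open>K[S]\<close>, which makes it
  available as a test module inside \<open>E 0\<close>.\<close>

lemma extension_exists: "\<exists>h. extends_eps h"
proof -
  obtain n where n: "\<And>u. u \<in> saturation \<Longrightarrow> u + (0, n * d) \<in> S" using saturation_absorbed by metis
  define e where "e = (0::nat, n * d)"
  have e: "e \<in> S" "e \<in> saturation" "level e = n"
    using e0_mem S_subset_saturation d_pos by (auto simp: e_def level_def)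
  define Z where "Z = Poly_Mapping.single e (1::'k)"
  have Z: "Z \<in> supported S" using e(1) by (simp add: Z_def supported_single)
  \<comment> \<open>The exponents of t^(nd) K[S] and of t^(nd) K[S'], both ideals of K[S];
    injectivity is applied to the inclusion of the first into the second.\<close>
  define T1 T2 where "T1 = (+) e ` S" and "T2 = (+) e ` saturation"
  have T2S: "T2 \<subseteq> S" using n by (auto simp: T2_def e_def add.commute)
  have T12: "T1 \<subseteq> T2" using S_subset_saturation by (auto simp: T1_def T2_def)
  have T1c: "s + u \<in> T1" if su: "s \<in> S" "u \<in> T1" for s u
  proof -
    obtain v where "v \<in> S" "u = e + v" using su(2) by (auto simp: T1_def)
    then show ?thesis
      unfolding T1_def using add_mem[OF su(1)]
      by (intro image_eqI[of _ _ "s + v"]) (simp_all add: add.left_commute)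
  qed
  have T2c: "s + u \<in> T2" if su: "s \<in> S" "u \<in> T2" for s u
  proof -
    obtain v where "v \<in> saturation" "u = e + v" using su(2) by (auto simp: T2_def)
    then show ?thesis
      unfolding T2_def using sat.add_mem[of s v] su(1) S_subset_saturation
      by (intro image_eqI[of _ _ "s + v"]) (auto simp: add.left_commute)
  qed
  \<comment> \<open>The shift is n = level e, so that multiplication and division by
    \<open>Z\<close> preserve degrees.\<close>
  define N M where "N = emb.shifted_ideal T1 (int n)" and "M = emb.shifted_ideal T2 (int n)"
  have N: "graded_module R (hom_part S) N"
    unfolding N_def using T12 T2S T1c by (intro emb.shifted_ideal_graded) auto
  have M: "graded_module R (hom_part S) M"
    unfolding M_def using T2S T2c by (intro emb.shifted_ideal_graded) auto
  have hom_T: "hom_part T1 j = supported {u \<in> T1. int (level u) = j}"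
    "hom_part T2 j = supported {u \<in> T2. int (level u) = j}" for j
    using T12 T2S S_subset_saturation by (auto intro!: homogeneous_part_eq)
  have i: "(\<lambda>x. x) \<in> graded_hom R N M"
    using T12 supported_mono[OF T12]
    by (auto simp: graded_hom_def N_def M_def hom_T intro!: imageI elim: subsetD[OF supported_mono, rotated])
  have Z_S: "Z * f \<in> supported T1" if "f \<in> supported S" for f
    unfolding Z_def by (rule supported_mult[OF supported_single[of e "{e}"] that]) (auto simp: T1_def)
  have Z_sat: "Z * f \<in> supported T2" if "f \<in> supported saturation" for f
    unfolding Z_def by (rule supported_mult[OF supported_single[of e "{e}"] that]) (auto simp: T2_def)
  have N_ex: "\<exists>f\<in>supported S. x = \<epsilon> (Z * f)" if x: "x \<in> carrier N" for x
  proof -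
    obtain q where "q \<in> supported T1" "x = \<epsilon> q" using x by (auto simp: N_def)
    then show ?thesis unfolding T1_def Z_def by (metis supported_translateE)
  qed
  have inj: "inj_on (\<lambda>f. \<epsilon> (Z * f)) (supported S)"
  proof (rule inj_onI)
    fix f g assume fg: "f \<in> supported S" "g \<in> supported S" "\<epsilon> (Z * f) = \<epsilon> (Z * g)"
    then have "Z * f = Z * g"
      using inj_onD[OF emb.eps_inj fg(3)] Z by (simp add: supported_mult_closed)
    then show "f = g" unfolding Z_def by (rule single_one_mult_cancel)
  qed
  \<comment> \<open>Division by \<open>Z\<close>: the value at \<epsilon> (Z * f) is \<epsilon>
    f.\<close>
  define g where "g x = \<epsilon> (inv_into (supported S) (\<lambda>f. \<epsilon> (Z * f)) x)" for x
  have g: "g (\<epsilon> (Z * f)) = \<epsilon> f" if "f \<in> supported S" for f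
    unfolding g_def using inv_into_f_f[OF inj that] by simp
  have "g \<in> graded_hom R N (E 0)"
    unfolding graded_hom_def
  proof (intro CollectI conjI ballI allI)
    show "g \<in> carrier N \<rightarrow> carrier (E 0)" using N_ex g emb.eps_closed by fastforce
    fix x assume "x \<in> carrier N"
    then obtain f where f: "f \<in> supported S" "x = \<epsilon> (Z * f)" using N_ex by blast
    { fix y assume "y \<in> carrier N"
      then obtain f' where f': "f' \<in> supported S" "y = \<epsilon> (Z * f')" using N_ex by blast
      have "x \<oplus>\<^bsub>N\<^esub> y = \<epsilon> (Z * (f + f'))"
        using f f' Z by (simp add: N_def distrib_left emb.eps_add supported_mult_closed)
      then show "g (x \<oplus>\<^bsub>N\<^esub> y) = g x \<oplus>\<^bsub>E 0\<^esub> g y"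
        using f f' by (simp add: g emb.eps_add supported_add) }
    fix r :: "nat \<times> nat \<Rightarrow>\<^sub>0 'k" assume "r \<in> carrier R"
    then have r: "r \<in> supported S" by (simp add: carrier_semigroup_ring)
    have "r \<odot>\<^bsub>N\<^esub> x = \<epsilon> (Z * (r * f))"
      using f r Z by (simp add: N_def mult.left_commute[of Z] emb.eps_smult supported_mult_closed)
    then show "g (r \<odot>\<^bsub>N\<^esub> x) = r \<odot>\<^bsub>E 0\<^esub> g x"
      using f r by (simp add: g emb.eps_smult supported_mult_closed)
  next
    fix j
    show "g ` gpart N j \<subseteq> gpart (E 0) j"
    proof
      fix y assume "y \<in> g ` gpart N j"
      then obtain q where q: "q \<in> supported {u \<in> T1. int (level u) = j + int n}" "y = g (\<epsilon> q)"
        by (auto simp: N_def hom_T)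
      have "{u \<in> T1. int (level u) = j + int n} \<subseteq> (+) e ` {u \<in> S. int (level u) = j}"
        using e S_subset_saturation by (auto simp: T1_def level_add subset_iff)
      then have "q \<in> supported ((+) e ` {u \<in> S. int (level u) = j})"
        using q(1) supported_mono by blast
      then obtain f where f: "f \<in> supported {u \<in> S. int (level u) = j}" "q = Z * f"
        unfolding Z_def by (rule supported_translateE)
      then have "f \<in> supported S" by (auto simp: supported_def)
      then have "y = \<epsilon> f" using f(2) q(2) g by simp
      then show "y \<in> gpart (E 0) j" using f(1) eps_gpart by (simp add: hom_part_S)
    qed
  qed
  then obtain h' where h': "h' \<in> graded_hom R M (E 0)" "\<And>x. x \<in> carrier N \<Longrightarrow> h' x = g x"
    using E_injective[of 0, unfolded graded_injective_def, THEN conjunct2, rule_format, of M N "\<lambda>x. x" g]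
      M N i by auto
  have h'_M: "\<epsilon> (Z * p) \<in> carrier M" if "p \<in> supported saturation" for p
    using Z_sat[OF that] by (auto simp: M_def)
  have ZpS: "Z * p \<in> supported S" if "p \<in> supported saturation" for p
    using Z_sat[OF that] supported_mono[OF T2S] by blast
  \<comment> \<open>On K[S] the map h' agrees with g, which divides out the factor \<open>Z\<close>
    again; hence this composite extends \<epsilon>.\<close>
  have "extends_eps (\<lambda>p. h' (\<epsilon> (Z * p)))"
    unfolding extends_eps_def
  proof (intro conjI ballI allI)
    fix p :: "nat \<times> nat \<Rightarrow>\<^sub>0 'k" assume p: "p \<in> supported saturation"
    show "h' (\<epsilon> (Z * p)) \<in> carrier (E 0)" using h'(1) h'_M[OF p] by (auto simp: graded_hom_def)
    { fix q :: "nat \<times> nat \<Rightarrow>\<^sub>0 'k" assume q: "q \<in> supported saturation"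
      have "\<epsilon> (Z * (p + q)) = \<epsilon> (Z * p) \<oplus>\<^bsub>M\<^esub> \<epsilon> (Z * q)"
        using p q by (simp add: M_def distrib_left emb.eps_add ZpS)
      then show "h' (\<epsilon> (Z * (p + q))) = h' (\<epsilon> (Z * p)) \<oplus>\<^bsub>E 0\<^esub> h' (\<epsilon> (Z * q))"
        using h'(1) h'_M[OF p] h'_M[OF q] by (simp add: graded_hom_def) }
  next
    fix r p :: "nat \<times> nat \<Rightarrow>\<^sub>0 'k" assume r: "r \<in> supported S" and p: "p \<in> supported saturation"
    have "\<epsilon> (Z * (r * p)) = r \<odot>\<^bsub>M\<^esub> \<epsilon> (Z * p)"
      using r p by (simp add: M_def mult.left_commute[of Z] emb.eps_smult ZpS)
    then show "h' (\<epsilon> (Z * (r * p))) = r \<odot>\<^bsub>E 0\<^esub> h' (\<epsilon> (Z * p))"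
      using h'(1) h'_M[OF p] r by (simp add: graded_hom_def carrier_semigroup_ring)
  next
    fix f :: "nat \<times> nat \<Rightarrow>\<^sub>0 'k" assume f: "f \<in> supported S"
    then show "h' (\<epsilon> (Z * f)) = \<epsilon> f" using h'(2)[of "\<epsilon> (Z * f)"] Z_S[OF f] g by (simp add: N_def)
  next
    fix j p assume "p \<in> hom_part saturation j"
    then have p: "p \<in> supported {u \<in> saturation. int (level u) = j}" by (simp add: hom_part_sat)
    have "Z * p \<in> hom_part T2 (j + int n)"
      unfolding hom_T Z_def
      by (rule supported_mult[OF supported_single[of e "{e}"] p]) (auto simp: T2_def level_add e)
    then have "\<epsilon> (Z * p) \<in> gpart M j" by (simp add: M_def)
    then show "h' (\<epsilon> (Z * p)) \<in> gpart (E 0) j" by (rule graded_hom_gpart[OF h'(1)])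
  qed
  then show ?thesis by blast
qed

end

section \<open>The first local cohomology module\<close>

context curve_resolution
begin

definition h :: "(nat \<times> nat \<Rightarrow>\<^sub>0 'k) \<Rightarrow> 'm" where "h = (SOME h. extends_eps h)"

lemma h_closed: "p \<in> supported saturation \<Longrightarrow> h p \<in> carrier (E 0)"
  and h_add: "p \<in> supported saturation \<Longrightarrow> q \<in> supported saturation \<Longrightarrow> h (p + q) = h p \<oplus>\<^bsub>E 0\<^esub> h q"
  and h_smult: "r \<in> supported S \<Longrightarrow> p \<in> supported saturation \<Longrightarrow> h (r * p) = r \<odot>\<^bsub>E 0\<^esub> h p"
  and h_eps: "f \<in> supported S \<Longrightarrow> h f = \<epsilon> f"
  and h_gpart: "p \<in> hom_part saturation j \<Longrightarrow> h p \<in> gpart (E 0) j"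
  using someI_ex[OF extension_exists, folded h_def] by (simp_all add: extends_eps_def)

abbreviation m :: "(nat \<times> nat \<Rightarrow>\<^sub>0 'k) set" where "m \<equiv> semigroup_ring_irrelevant S"

section \<open>Torsion classes and the module structure of the cohomology\<close>

definition cocycles :: "'m set" where
  "cocycles = {x \<in> torsion R m (E (Suc 0)). D (Suc 0) x = \<zero>\<^bsub>E (Suc (Suc 0))\<^esub>}"

definition coboundaries :: "'m set" where
  "coboundaries = D 0 ` torsion R m (E 0)"

definition coh_class :: "'m \<Rightarrow> 'm set" where "coh_class x = coboundaries +>\<^bsub>E (Suc 0)\<^esub> x"

definition H1 :: "(nat \<times> nat \<Rightarrow>\<^sub>0 'k, 'm set) gmodule" where "H1 = local_cohomology R m E D 1"

lemma H1_simps: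
  "carrier H1 = coh_class ` cocycles" "\<zero>\<^bsub>H1\<^esub> = coboundaries"
  "C \<oplus>\<^bsub>H1\<^esub> C' = C <+>\<^bsub>E (Suc 0)\<^esub> C'" "r \<odot>\<^bsub>H1\<^esub> C = (\<Union>x\<in>C. coh_class (r \<odot>\<^bsub>E (Suc 0)\<^esub> x))"
  "gpart H1 j = coh_class ` (cocycles \<inter> gpart (E (Suc 0)) j)"
  by (simp_all add: H1_def local_cohomology_def graded_subquotient_def cocycles_def coboundaries_def
      coh_class_def)

lemma X_power_supported: "X0 ^ N \<in> supported S" "X1 ^ N \<in> supported S"
  by (simp_all add: supported_power X0_supported X1_supported)

lemma torsion_E: "t \<in> torsion R m (E n) \<longleftrightarrow>
    t \<in> carrier (E n) \<and> (\<exists>N. X0 ^ N \<odot>\<^bsub>E n\<^esub> t = \<zero>\<^bsub>E n\<^esub> \<and> X1 ^ N \<odot>\<^bsub>E n\<^esub> t = \<zero>\<^bsub>E n\<^esub>)"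
  by (rule torsion_iff[OF E_module])

text \<open>A threshold valid for all larger exponents lets two torsion elements share one
  exponent.\<close>

lemma torsion_E_bound:
  assumes "t \<in> torsion R m (E n)"
  obtains N where "\<And>M. N \<le> M \<Longrightarrow> X0 ^ M \<odot>\<^bsub>E n\<^esub> t = \<zero>\<^bsub>E n\<^esub>" "\<And>M. N \<le> M \<Longrightarrow> X1 ^ M \<odot>\<^bsub>E n\<^esub> t = \<zero>\<^bsub>E n\<^esub>"
proof -
  interpret En: module R "E n" by (rule E_module)
  obtain N where t: "t \<in> carrier (E n)" and N: "X0 ^ N \<odot>\<^bsub>E n\<^esub> t = \<zero>\<^bsub>E n\<^esub>" "X1 ^ N \<odot>\<^bsub>E n\<^esub> t = \<zero>\<^bsub>E n\<^esub>"
    using assms by (auto simp: torsion_E)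
  have "f ^ M \<odot>\<^bsub>E n\<^esub> t = \<zero>\<^bsub>E n\<^esub>" if "f ^ N \<odot>\<^bsub>E n\<^esub> t = \<zero>\<^bsub>E n\<^esub>" "f \<in> supported S" "N \<le> M" for f M
  proof -
    have "f ^ M = f ^ (M - N) * f ^ N" using that(3) by (simp flip: power_add)
    then show ?thesis
      using En.smult_assoc1[of "f ^ (M - N)" "f ^ N" t] that t
      by (simp add: carrier_semigroup_ring supported_power)
  qed
  then show thesis using that N X0_supported X1_supported by blast
qed

lemma torsion_submodule: "submodule (torsion R m (E n)) R (E n)"
proof -
  interpret En: module R "E n" by (rule E_module)
  show ?thesis
  proof (rule En.submoduleI)
    show "torsion R m (E n) \<subseteq> carrier (E n)" by (auto simp: torsion_def)
    show "\<zero>\<^bsub>E n\<^esub> \<in> torsion R m (E n)"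
      by (auto simp: torsion_E En.smult_r_null carrier_semigroup_ring X_power_supported)
    fix s assume s: "s \<in> torsion R m (E n)"
    then have sE: "s \<in> carrier (E n)" by (simp add: torsion_E)
    obtain N where N: "\<And>M. N \<le> M \<Longrightarrow> X0 ^ M \<odot>\<^bsub>E n\<^esub> s = \<zero>\<^bsub>E n\<^esub>" "\<And>M. N \<le> M \<Longrightarrow> X1 ^ M \<odot>\<^bsub>E n\<^esub> s = \<zero>\<^bsub>E n\<^esub>"
      using torsion_E_bound[OF s] by blast
    show "\<ominus>\<^bsub>E n\<^esub> s \<in> torsion R m (E n)"
      using sE N[of N] unfolding torsion_E
      by (auto simp: En.smult_r_minus carrier_semigroup_ring X_power_supported intro!: exI[of _ N])
    { fix t assume t: "t \<in> torsion R m (E n)"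
      then have tE: "t \<in> carrier (E n)" by (simp add: torsion_E)
      obtain N' where N': "\<And>M. N' \<le> M \<Longrightarrow> X0 ^ M \<odot>\<^bsub>E n\<^esub> t = \<zero>\<^bsub>E n\<^esub>" "\<And>M. N' \<le> M \<Longrightarrow> X1 ^ M \<odot>\<^bsub>E n\<^esub> t = \<zero>\<^bsub>E n\<^esub>"
        using torsion_E_bound[OF t] by blast
      show "s \<oplus>\<^bsub>E n\<^esub> t \<in> torsion R m (E n)"
        using sE tE N[of "N + N'"] N'[of "N + N'"] unfolding torsion_E
        by (auto simp: En.smult_r_distr carrier_semigroup_ring X_power_supported intro!: exI[of _ "N + N'"]) }
    fix r :: "nat \<times> nat \<Rightarrow>\<^sub>0 'k" assume r: "r \<in> carrier R"
    have "f \<odot>\<^bsub>E n\<^esub> (r \<odot>\<^bsub>E n\<^esub> s) = r \<odot>\<^bsub>E n\<^esub> (f \<odot>\<^bsub>E n\<^esub> s)" if "f \<in> supported S" for f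
      using En.smult_assoc1[of f r s] En.smult_assoc1[of r f s] r that sE
      by (simp add: carrier_semigroup_ring mult.commute)
    then show "r \<odot>\<^bsub>E n\<^esub> s \<in> torsion R m (E n)"
      using sE r N[of N] unfolding torsion_E
      by (auto simp: X_power_supported En.smult_r_null intro!: exI[of _ N])
  qed
qed

lemma torsion_carrier: "t \<in> torsion R m (E n) \<Longrightarrow> t \<in> carrier (E n)"
  by (simp add: torsion_E)

lemma D_zero: "D n \<zero>\<^bsub>E n\<^esub> = \<zero>\<^bsub>E (Suc n)\<^esub>"
proof -
  interpret En: module R "E n" by (rule E_module)
  interpret En': module R "E (Suc n)" by (rule E_module)
  show ?thesis
    using D_smult[of 0 "\<zero>\<^bsub>E n\<^esub>" n] En.smult_l_null[of "\<zero>\<^bsub>E n\<^esub>"]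
      En'.smult_l_null[OF D_closed[OF En.M.zero_closed]] by simp
qed

lemma D_minus: "x \<in> carrier (E n) \<Longrightarrow> D n (\<ominus>\<^bsub>E n\<^esub> x) = \<ominus>\<^bsub>E (Suc n)\<^esub> D n x"
proof -
  assume x: "x \<in> carrier (E n)"
  interpret En: module R "E n" by (rule E_module)
  interpret En': module R "E (Suc n)" by (rule E_module)
  show ?thesis
    using D_add[of "\<ominus>\<^bsub>E n\<^esub> x" n x] x D_zero[of n]
    by (intro En'.M.minus_equality[symmetric]) (auto simp: D_closed En.M.l_neg)
qed

lemma D_eps: "f \<in> supported S \<Longrightarrow> D 0 (\<epsilon> f) = \<zero>\<^bsub>E (Suc 0)\<^esub>"
  using eps_image by blast

lemma coboundaries_submodule: "submodule coboundaries R (E (Suc 0))"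
proof -
  interpret T: submodule "torsion R m (E 0)" R "E 0" by (rule torsion_submodule)
  show ?thesis
  proof (rule E1.submoduleI)
    show "coboundaries \<subseteq> carrier (E (Suc 0))"
      using D_closed[of _ 0] torsion_carrier by (auto simp: coboundaries_def)
    show "\<zero>\<^bsub>E (Suc 0)\<^esub> \<in> coboundaries"
      using T.one_closed D_zero[of 0] unfolding coboundaries_def by (force intro: image_eqI)
    fix x assume "x \<in> coboundaries"
    then obtain s where s: "s \<in> torsion R m (E 0)" "x = D 0 s" by (auto simp: coboundaries_def)
    have "\<ominus>\<^bsub>E 0\<^esub> s \<in> torsion R m (E 0)" using emb.E.submoduleE(3)[OF torsion_submodule s(1)] .
    then show "\<ominus>\<^bsub>E (Suc 0)\<^esub> x \<in> coboundaries"
      using s D_minus[of s 0] torsion_carrier unfolding coboundaries_def by (intro image_eqI) auto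
    { fix y assume "y \<in> coboundaries"
      then obtain t where t: "t \<in> torsion R m (E 0)" "y = D 0 t" by (auto simp: coboundaries_def)
      show "x \<oplus>\<^bsub>E (Suc 0)\<^esub> y \<in> coboundaries"
        using s t D_add[of s 0 t] torsion_carrier T.m_closed[of s t]
        unfolding coboundaries_def by (intro image_eqI[of _ _ "s \<oplus>\<^bsub>E 0\<^esub> t"]) auto }
    fix r :: "nat \<times> nat \<Rightarrow>\<^sub>0 'k" assume "r \<in> carrier R"
    then show "r \<odot>\<^bsub>E (Suc 0)\<^esub> x \<in> coboundaries"
      using s D_smult[of r s 0] torsion_carrier T.smult_closed[of r s]
      unfolding coboundaries_def
      by (intro image_eqI[of _ _ "r \<odot>\<^bsub>E 0\<^esub> s"]) (auto simp: carrier_semigroup_ring)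
  qed
qed

lemma coboundaries_abelian_subgroup: "abelian_subgroup coboundaries (E (Suc 0))"
  by (intro abelian_subgroupI3 additive_subgroup.intro submodule.axioms(1)[OF coboundaries_submodule]
      E1.M.abelian_group_axioms)

lemma coh_class_add:
  "x \<in> carrier (E (Suc 0)) \<Longrightarrow> y \<in> carrier (E (Suc 0)) \<Longrightarrow> coh_class (x \<oplus>\<^bsub>E (Suc 0)\<^esub> y) = coh_class x <+>\<^bsub>E (Suc 0)\<^esub> coh_class y"
  by (simp add: coh_class_def abelian_subgroup.a_rcos_sum[OF coboundaries_abelian_subgroup])

lemma coh_class_shift:
  assumes "b \<in> coboundaries" "x \<in> carrier (E (Suc 0))"
  shows "coh_class (b \<oplus>\<^bsub>E (Suc 0)\<^esub> x) = coh_class x"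
proof -
  have "b \<oplus>\<^bsub>E (Suc 0)\<^esub> x \<in> coboundaries +>\<^bsub>E (Suc 0)\<^esub> x" using assms(1) by (auto simp: a_r_coset_def')
  then show ?thesis
    unfolding coh_class_def
    using E1.M.a_repr_independence[OF _ assms(2) submodule.axioms(1)[OF coboundaries_submodule]] by simp
qed

lemma coh_class_mem: "y \<in> coh_class x \<longleftrightarrow> (\<exists>b\<in>coboundaries. y = b \<oplus>\<^bsub>E (Suc 0)\<^esub> x)"
  by (auto simp: coh_class_def a_r_coset_def')

lemma coh_class_eq_zero: "x \<in> carrier (E (Suc 0)) \<Longrightarrow> coh_class x = coboundaries \<longleftrightarrow> x \<in> coboundaries"
proof
  interpret B: submodule coboundaries R "E (Suc 0)" by (rule coboundaries_submodule)
  assume x: "x \<in> carrier (E (Suc 0))"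
  { assume "coh_class x = coboundaries"
    moreover have "x \<in> coh_class x" using x B.one_closed by (auto simp: coh_class_mem intro!: bexI[of _ "\<zero>\<^bsub>E (Suc 0)\<^esub>"])
    ultimately show "x \<in> coboundaries" by simp }
  assume "x \<in> coboundaries"
  then show "coh_class x = coboundaries"
    unfolding coh_class_def using x by (intro E1.M.a_coset_join2) (auto intro: B.subgroup_axioms)
qed

text \<open>The scalar product of a subquotient is a union of cosets over all representatives; these
  cosets coincide because r maps coboundaries to coboundaries.\<close>

lemma coh_class_smult:
  assumes "r \<in> supported S" "x \<in> carrier (E (Suc 0))"
  shows "coh_class (r \<odot>\<^bsub>E (Suc 0)\<^esub> x) = (\<Union>y\<in>coh_class x. coh_class (r \<odot>\<^bsub>E (Suc 0)\<^esub> y))"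
proof -
  interpret B: submodule coboundaries R "E (Suc 0)" by (rule coboundaries_submodule)
  have r: "r \<in> carrier R" using assms(1) by (simp add: carrier_semigroup_ring)
  have "coh_class (r \<odot>\<^bsub>E (Suc 0)\<^esub> y) = coh_class (r \<odot>\<^bsub>E (Suc 0)\<^esub> x)" if y: "y \<in> coh_class x" for y
  proof -
    obtain b where b: "b \<in> coboundaries" "y = b \<oplus>\<^bsub>E (Suc 0)\<^esub> x" using y by (auto simp: coh_class_mem)
    have "b \<in> carrier (E (Suc 0))" using b(1) B.subset by auto
    then have "r \<odot>\<^bsub>E (Suc 0)\<^esub> y = r \<odot>\<^bsub>E (Suc 0)\<^esub> b \<oplus>\<^bsub>E (Suc 0)\<^esub> r \<odot>\<^bsub>E (Suc 0)\<^esub> x"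
      using b(2) r assms(2) by (simp add: E1.smult_r_distr)
    then show ?thesis using coh_class_shift[of "r \<odot>\<^bsub>E (Suc 0)\<^esub> b" "r \<odot>\<^bsub>E (Suc 0)\<^esub> x"] r b(1) assms(2) by simp
  qed
  moreover have "x \<in> coh_class x"
    using assms(2) B.one_closed by (auto simp: coh_class_mem intro!: bexI[of _ "\<zero>\<^bsub>E (Suc 0)\<^esub>"])
  ultimately show ?thesis by blast
qed

text \<open>If \<open>X0 ^ N\<close> and \<open>X1 ^ N\<close> map \<open>y\<close> to \<open>\<epsilon> f\<close> and \<open>\<epsilon> g\<close>, then \<open>f / X0 ^ N = g / X1 ^ N\<close> lies in
  \<open>K[saturation]\<close>, and \<open>y\<close> agrees with its image under \<open>h\<close> up to torsion.\<close>

lemma preimage_of_torsion: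
  assumes y: "y \<in> carrier (E 0)" "D 0 y \<in> torsion R m (E (Suc 0))"
  obtains p t where "p \<in> supported saturation" "t \<in> torsion R m (E 0)" "y = h p \<oplus>\<^bsub>E 0\<^esub> t"
    "\<And>j. y \<in> gpart (E 0) j \<Longrightarrow> p \<in> hom_part saturation j"
proof -
  obtain N where N: "X0 ^ N \<odot>\<^bsub>E (Suc 0)\<^esub> D 0 y = \<zero>\<^bsub>E (Suc 0)\<^esub>" "X1 ^ N \<odot>\<^bsub>E (Suc 0)\<^esub> D 0 y = \<zero>\<^bsub>E (Suc 0)\<^esub>"
    using y(2) by (auto simp: torsion_E)
  have smult_closed: "f \<odot>\<^bsub>E 0\<^esub> z \<in> carrier (E 0)" if "f \<in> supported S" "z \<in> carrier (E 0)" for f z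
    using that by (simp add: carrier_semigroup_ring)
  have in_image: "f \<odot>\<^bsub>E 0\<^esub> y \<in> \<epsilon> ` supported S" if "f \<odot>\<^bsub>E (Suc 0)\<^esub> D 0 y = \<zero>\<^bsub>E (Suc 0)\<^esub>" "f \<in> supported S" for f
    using that y(1) D_smult[of f y 0] by (simp add: eps_image smult_closed)
  obtain f where f: "f \<in> supported S" "X0 ^ N \<odot>\<^bsub>E 0\<^esub> y = \<epsilon> f"
    using in_image[OF N(1) X_power_supported(1)] by blast
  obtain g where g: "g \<in> supported S" "X1 ^ N \<odot>\<^bsub>E 0\<^esub> y = \<epsilon> g"
    using in_image[OF N(2) X_power_supported(2)] by blast
  have assoc: "a \<odot>\<^bsub>E 0\<^esub> (b \<odot>\<^bsub>E 0\<^esub> z) = (a * b) \<odot>\<^bsub>E 0\<^esub> z"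
    if "a \<in> supported S" "b \<in> supported S" "z \<in> carrier (E 0)" for a b z
    using emb.E.smult_assoc1[of a b z] that by (simp add: carrier_semigroup_ring)
  \<comment> \<open>The two powers commute on y, and injectivity of \<epsilon> turns this into the
    compatibility of the fractions f / X0^N and g / X1^N.\<close>
  have "\<epsilon> (X1 ^ N * f) = X1 ^ N \<odot>\<^bsub>E 0\<^esub> (X0 ^ N \<odot>\<^bsub>E 0\<^esub> y)"
    using f by (simp add: emb.eps_smult X_power_supported)
  also have "\<dots> = X0 ^ N \<odot>\<^bsub>E 0\<^esub> (X1 ^ N \<odot>\<^bsub>E 0\<^esub> y)"
    using y(1) by (simp add: assoc X_power_supported mult.commute)
  also have "\<dots> = \<epsilon> (X0 ^ N * g)" using g by (simp add: emb.eps_smult X_power_supported)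
  finally have fg: "X1 ^ N * f = X0 ^ N * g"
    by (rule inj_onD[OF emb.eps_inj]) (intro supported_mult_closed X_power_supported f(1) g(1))+
  have "f \<in> supported ((+) (0, N * d) ` saturation)"
    unfolding supported_def
  proof safe
    fix u1 u2 assume u: "(u1, u2) \<in> Poly_Mapping.keys f"
    then have "(N * d, 0) + (u1, u2) \<in> Poly_Mapping.keys (X1 ^ N * f)"
      unfolding X1_power keys_single_one_mult by (rule imageI)
    then obtain v1 v2 where "(v1, v2) \<in> Poly_Mapping.keys g" "(N * d, 0) + (u1, u2) = (0, N * d) + (v1, v2)"
      unfolding fg X0_power keys_single_one_mult by auto
    then have v: "(u1 + N * d, u2 - N * d) \<in> Poly_Mapping.keys g" "N * d \<le> u2"
      by (simp_all add: add.commute)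
    have "(u1, (u2 - N * d) + N * d) \<in> S" "(u1 + N * d, u2 - N * d) \<in> S"
      using u v f(1) g(1) by (auto simp: supported_def)
    then have "(u1, u2 - N * d) \<in> saturation" by (rule saturationI)
    then show "(u1, u2) \<in> (+) (0, N * d) ` saturation"
      using v(2) by (intro image_eqI[of _ _ "(u1, u2 - N * d)"]) auto
  qed
  then obtain p where p: "p \<in> supported saturation" "f = X0 ^ N * p"
    unfolding X0_power by (rule supported_translateE)
  have "X0 ^ N * (X1 ^ N * p) = X0 ^ N * g" using fg p(2) by (simp add: mult.left_commute)
  then have g_eq: "g = X1 ^ N * p" unfolding X0_power by (metis single_one_mult_cancel)
  have hp: "h p \<in> carrier (E 0)" by (rule h_closed[OF p(1)])
  have eq: "X0 ^ N \<odot>\<^bsub>E 0\<^esub> h p = X0 ^ N \<odot>\<^bsub>E 0\<^esub> y" "X1 ^ N \<odot>\<^bsub>E 0\<^esub> h p = X1 ^ N \<odot>\<^bsub>E 0\<^esub> y"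
    using h_smult[OF X_power_supported(1) p(1)] h_smult[OF X_power_supported(2) p(1)]
      h_eps[OF f(1)] h_eps[OF g(1)] f(2) g(2) p(2) g_eq by simp_all
  define t where "t = y \<oplus>\<^bsub>E 0\<^esub> (\<ominus>\<^bsub>E 0\<^esub> h p)"
  have "f \<odot>\<^bsub>E 0\<^esub> t = \<zero>\<^bsub>E 0\<^esub>" if "f \<odot>\<^bsub>E 0\<^esub> h p = f \<odot>\<^bsub>E 0\<^esub> y" "f \<in> supported S" for f
    using that y(1) hp smult_closed[OF that(2) y(1)]
    by (simp add: t_def emb.E.smult_r_distr emb.E.smult_r_minus carrier_semigroup_ring emb.E.M.r_neg)
  then have "t \<in> torsion R m (E 0)"
    using eq X_power_supported y(1) hp by (auto simp: torsion_E t_def)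
  moreover have "y = h p \<oplus>\<^bsub>E 0\<^esub> t"
    using y(1) hp by (simp add: t_def emb.E.M.a_lcomm emb.E.M.r_neg)
  \<comment> \<open>Here \<epsilon> f has degree N + j, hence so has f by
    \<open>eps_homogeneous\<close>, and division by \<open>X0 ^ N\<close> lowers the degree by
    N.\<close>
  moreover have "p \<in> hom_part saturation j" if yj: "y \<in> gpart (E 0) j" for j
  proof -
    have lev: "level (0, N * d) = N" "(0, N * d) \<in> saturation"
      using d_pos e0_mem S_subset_saturation by (auto simp: level_def)
    have "X0 ^ N \<in> hom_part S (int N)"
      using e0_mem lev by (auto simp: X0_power hom_part_S intro!: supported_single)
    then have "\<epsilon> f \<in> gpart (E 0) (int N + j)" using E_smult_gpart yj f(2) by metis
    then have fj: "f \<in> hom_part S (int N + j)" by (rule eps_homogeneous[OF f(1)])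
    have "int (level u) = j" if u: "u \<in> Poly_Mapping.keys p" for u
    proof -
      have "u \<in> saturation" using u p(1) by (auto simp: supported_def)
      then have "level ((0, N * d) + u) = N + level u" using level_add[OF lev(2), of u] lev(1) by simp
      moreover have "(0, N * d) + u \<in> Poly_Mapping.keys f"
        unfolding p(2) X0_power keys_single_one_mult using u by (rule imageI)
      then have "int (level ((0, N * d) + u)) = int N + j"
        using fj unfolding hom_part_S supported_def by blast
      ultimately show ?thesis by simp
    qed
    then show ?thesis using p(1) by (auto simp: hom_part_sat supported_def)
  qed
  ultimately show thesis using that p(1) by blast
qed

lemma absorbing_power:
  obtains n where "\<And>p :: nat \<times> nat \<Rightarrow>\<^sub>0 'k. p \<in> supported saturation \<Longrightarrow> X0 ^ n * p \<in> supported S"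
    "\<And>p :: nat \<times> nat \<Rightarrow>\<^sub>0 'k. p \<in> supported saturation \<Longrightarrow> X1 ^ n * p \<in> supported S"
proof -
  obtain n where n: "\<And>u. u \<in> saturation \<Longrightarrow> u + (0, n * d) \<in> S" "\<And>u. u \<in> saturation \<Longrightarrow> u + (n * d, 0) \<in> S"
    using saturation_absorbed by metis
  show thesis
  proof
    fix p :: "nat \<times> nat \<Rightarrow>\<^sub>0 'k" assume p: "p \<in> supported saturation"
    show "X0 ^ n * p \<in> supported S" unfolding X0_power
      by (rule supported_mult[OF supported_single[of _ "{(0, n * d)}"] p]) (use n in \<open>auto simp: add.commute\<close>)
    show "X1 ^ n * p \<in> supported S" unfolding X1_power
      by (rule supported_mult[OF supported_single[of _ "{(n * d, 0)}"] p]) (use n in \<open>auto simp: add.commute\<close>)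
  qed
qed

text \<open>Powers of \<open>X0\<close> and \<open>X1\<close> carry p into K[S], where h is
  \<epsilon> and is killed by \<open>D 0\<close>. So \<open>D 0 (h p)\<close> is torsion although
  \<open>h p\<close> need not be.\<close>

lemma D_h_cocycle:
  assumes p: "p \<in> supported saturation"
  shows "D 0 (h p) \<in> cocycles"
proof -
  obtain n where n: "X0 ^ n * p \<in> supported S" "X1 ^ n * p \<in> supported S"
    using absorbing_power p by metis
  have "f \<odot>\<^bsub>E (Suc 0)\<^esub> D 0 (h p) = \<zero>\<^bsub>E (Suc 0)\<^esub>" if "f * p \<in> supported S" "f \<in> supported S" for f
    using D_smult[of f "h p" 0] h_smult[of f p] h_eps[of "f * p"] D_eps[of "f * p"] that p h_closed
    by simp
  then have "D 0 (h p) \<in> torsion R m (E (Suc 0))"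
    using n X_power_supported D_closed[OF h_closed[OF p]] by (auto simp: torsion_E)
  moreover have "D (Suc 0) (D 0 (h p)) = \<zero>\<^bsub>E (Suc (Suc 0))\<^esub>"
    using D_image[of 0] h_closed[OF p] by auto
  ultimately show ?thesis by (simp add: cocycles_def)
qed

text \<open>Exactness at \<open>E 1\<close> lifts x to \<open>E 0\<close>. The homogeneous clause
  allows a different element q, because it starts from a homogeneous lift, which may differ from the
  first one.\<close>

lemma cocycle_class:
  assumes "x \<in> cocycles"
  obtains p where "p \<in> supported saturation" "coh_class x = coh_class (D 0 (h p))"
    "\<And>j. x \<in> gpart (E (Suc 0)) j \<Longrightarrow> \<exists>q\<in>hom_part saturation j. coh_class x = coh_class (D 0 (h q))"
proof -
  have x: "x \<in> carrier (E (Suc 0))" "x \<in> torsion R m (E (Suc 0))" "D (Suc 0) x = \<zero>\<^bsub>E (Suc (Suc 0))\<^esub>"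
    using assms torsion_carrier by (auto simp: cocycles_def)
  have y_class: "\<exists>p\<in>supported saturation. coh_class x = coh_class (D 0 (h p))
      \<and> (\<forall>j. y \<in> gpart (E 0) j \<longrightarrow> p \<in> hom_part saturation j)"
    if y: "y \<in> carrier (E 0)" "x = D 0 y" for y
  proof -
    obtain p t where pt: "p \<in> supported saturation" "t \<in> torsion R m (E 0)" "y = h p \<oplus>\<^bsub>E 0\<^esub> t"
      "\<And>j. y \<in> gpart (E 0) j \<Longrightarrow> p \<in> hom_part saturation j"
      using preimage_of_torsion[OF y(1)] x(2) y(2) by blast
    have "x = D 0 t \<oplus>\<^bsub>E (Suc 0)\<^esub> D 0 (h p)"
      using D_add[of "h p" 0 t] D_closed[of _ 0] h_closed[OF pt(1)] torsion_carrier[OF pt(2)]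
      by (simp add: y(2) pt(3) E1.M.a_comm)
    moreover have "D 0 t \<in> coboundaries" using pt(2) by (simp add: coboundaries_def)
    ultimately have "coh_class x = coh_class (D 0 (h p))"
      using coh_class_shift[of "D 0 t" "D 0 (h p)"] D_closed[OF h_closed[OF pt(1)]] by simp
    then show ?thesis using pt by blast
  qed
  obtain y where y: "y \<in> carrier (E 0)" "x = D 0 y" using x(1,3) D_image[of 0] by auto
  then obtain p where p: "p \<in> supported saturation" "coh_class x = coh_class (D 0 (h p))"
    using y_class by blast
  have "\<exists>q\<in>hom_part saturation j. coh_class x = coh_class (D 0 (h q))" if "x \<in> gpart (E (Suc 0)) j" for j
  proof -
    have "D 0 y \<in> gpart (E (Suc 0)) j" using that y(2) by simp
    then obtain y' where y': "y' \<in> gpart (E 0) j" "D 0 y' = D 0 y"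
      using graded_hom_homogeneous_preimage[OF E_graded E_graded D_hom y(1)] by blast
    then show ?thesis
      using y_class[of y'] y(2) graded_module_gpart_subset[OF E_graded y'(1)] by metis
  qed
  then show thesis using that p by blast
qed

text \<open>If \<open>D 0 (h p)\<close> is the image of a torsion element t, then h p - t =
  \<epsilon> r by exactness at \<open>E 0\<close>. A high power of \<open>X0\<close> removes t and
  leaves X0^M * p = X0^M * r, from which the monomial cancels.\<close>

lemma D_h_coboundary:
  assumes p: "p \<in> supported saturation"
  shows "D 0 (h p) \<in> coboundaries \<longleftrightarrow> p \<in> supported S"
proof
  assume "p \<in> supported S"
  then have "D 0 (h p) = \<zero>\<^bsub>E (Suc 0)\<^esub>" by (simp add: h_eps D_eps)
  then show "D 0 (h p) \<in> coboundaries"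
    using submodule.axioms(1)[OF coboundaries_submodule, THEN subgroup.one_closed] by simp
next
  assume "D 0 (h p) \<in> coboundaries"
  then obtain t where t: "t \<in> torsion R m (E 0)" "D 0 (h p) = D 0 t" by (auto simp: coboundaries_def)
  note carr = h_closed[OF p] torsion_carrier[OF t(1)]
  define z where "z = h p \<oplus>\<^bsub>E 0\<^esub> (\<ominus>\<^bsub>E 0\<^esub> t)"
  have "D 0 z = \<zero>\<^bsub>E (Suc 0)\<^esub>"
    using D_add[of "h p" 0 "\<ominus>\<^bsub>E 0\<^esub> t"] D_minus[of t 0] carr t(2) D_closed[OF carr(2)]
    by (simp add: z_def E1.M.r_neg)
  then have "z \<in> \<epsilon> ` supported S" using carr by (simp add: eps_image z_def)
  then obtain r where r: "r \<in> supported S" "z = \<epsilon> r" by blast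
  obtain n where n: "X0 ^ n * p \<in> supported S" using absorbing_power p by metis
  obtain N where N: "\<And>M. N \<le> M \<Longrightarrow> X0 ^ M \<odot>\<^bsub>E 0\<^esub> t = \<zero>\<^bsub>E 0\<^esub>" using torsion_E_bound[OF t(1)] by metis
  \<comment> \<open>The part N kills t, and the part n moves p into K[S], where h coincides with the
    injective \<epsilon>.\<close>
  define M where "M = N + n"
  have Mp: "X0 ^ M * p \<in> supported S"
    unfolding M_def power_add mult.assoc by (intro supported_mult_closed X_power_supported n)
  have "\<epsilon> (X0 ^ M * p) = X0 ^ M \<odot>\<^bsub>E 0\<^esub> h p"
    using h_eps[OF Mp] h_smult[OF X_power_supported(1) p] by simp
  also have "\<dots> = X0 ^ M \<odot>\<^bsub>E 0\<^esub> z"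
    using N[of M] carr
    by (simp add: X_power_supported z_def M_def emb.E.smult_r_distr emb.E.smult_r_minus carrier_semigroup_ring)
  also have "\<dots> = \<epsilon> (X0 ^ M * r)" using r by (simp add: emb.eps_smult X_power_supported)
  finally have "X0 ^ M * p = X0 ^ M * r"
    by (rule inj_onD[OF emb.eps_inj]) (intro supported_mult_closed X_power_supported r(1) Mp)+
  then have "p = r" unfolding X0_power by (rule single_one_mult_cancel)
  then show "p \<in> supported S" using r by simp
qed

text \<open>The identification of H^1 with K[saturation] / K[S]; the basis, top degree and length
  found for such modules now apply to it.\<close>

sublocale H1: gap_module A d H1 "\<lambda>p. coh_class (D 0 (h p))"
proof (intro gap_module.intro gap_module_axioms.intro)
  show "monomial_curve A d" by (rule monomial_curve_axioms)
  show "(\<lambda>p. coh_class (D 0 (h p))) ` supported saturation = carrier H1"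
    unfolding H1_simps
  proof
    show "(\<lambda>p. coh_class (D 0 (h p))) ` supported saturation \<subseteq> coh_class ` cocycles"
      using D_h_cocycle by blast
    show "coh_class ` cocycles \<subseteq> (\<lambda>p. coh_class (D 0 (h p))) ` supported saturation"
    proof (rule image_subsetI)
      fix x assume "x \<in> cocycles"
      then obtain p where "p \<in> supported saturation" "coh_class x = coh_class (D 0 (h p))"
        by (rule cocycle_class)
      then show "coh_class x \<in> (\<lambda>p. coh_class (D 0 (h p))) ` supported saturation" by simp
    qed
  qed
next
  fix p :: "nat \<times> nat \<Rightarrow>\<^sub>0 'k" assume p: "p \<in> supported saturation"
  have Dp: "D 0 (h p) \<in> carrier (E (Suc 0))" using D_closed[OF h_closed[OF p]] by simp
  show "coh_class (D 0 (h p)) = \<zero>\<^bsub>H1\<^esub> \<longleftrightarrow> p \<in> supported S"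
    unfolding H1_simps using coh_class_eq_zero[OF Dp] D_h_coboundary[OF p] by simp
  { fix q :: "nat \<times> nat \<Rightarrow>\<^sub>0 'k" assume q: "q \<in> supported saturation"
    show "coh_class (D 0 (h (p + q))) = coh_class (D 0 (h p)) \<oplus>\<^bsub>H1\<^esub> coh_class (D 0 (h q))"
      using D_add[of "h p" 0 "h q"] coh_class_add[OF Dp, of "D 0 (h q)"] D_closed[OF h_closed[OF q]] p q
      by (simp add: H1_simps h_add h_closed) }
  fix r :: "nat \<times> nat \<Rightarrow>\<^sub>0 'k" assume r: "r \<in> supported S"
  show "coh_class (D 0 (h (r * p))) = r \<odot>\<^bsub>H1\<^esub> coh_class (D 0 (h p))"
    using D_smult[of r "h p" 0] coh_class_smult[OF r Dp] r p by (simp add: H1_simps h_smult h_closed)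
next
  fix j
  show "gpart H1 j = (\<lambda>p. coh_class (D 0 (h p))) ` hom_part saturation j"
  proof
    show "gpart H1 j \<subseteq> (\<lambda>p. coh_class (D 0 (h p))) ` hom_part saturation j"
      unfolding H1_simps
    proof (rule image_subsetI)
      fix x assume x: "x \<in> cocycles \<inter> gpart (E (Suc 0)) j"
      then have "\<exists>q\<in>hom_part saturation j. coh_class x = coh_class (D 0 (h q))"
        using cocycle_class[of x] by (metis IntD1 IntD2)
      then show "coh_class x \<in> (\<lambda>p. coh_class (D 0 (h p))) ` hom_part saturation j" by auto
    qed
    show "(\<lambda>p. coh_class (D 0 (h p))) ` hom_part saturation j \<subseteq> gpart H1 j"
    proof (rule image_subsetI)
      fix p assume p: "p \<in> hom_part saturation j"
      then have "p \<in> supported saturation" by (auto simp: hom_part_sat supported_def)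
      then have "D 0 (h p) \<in> cocycles" by (rule D_h_cocycle)
      moreover have "D 0 (h p) \<in> gpart (E (Suc 0)) j" using D_gpart[OF h_gpart[OF p]] by simp
      ultimately show "coh_class (D 0 (h p)) \<in> gpart H1 j" unfolding H1_simps by blast
    qed
  qed
qed

end

section \<open>Translation to the sets L and L'\<close>

theorem theorem4p4:
  fixes a :: "nat \<Rightarrow> nat" and k d :: nat
    and A\<^sub>1 A\<^sub>2 :: "nat set" and S :: "(nat \<times> nat) set"
    and R :: "((nat \<times> nat) \<Rightarrow>\<^sub>0 'k::field) ring"
    and m :: "((nat \<times> nat) \<Rightarrow>\<^sub>0 'k) set"
    and RG :: "((nat \<times> nat) \<Rightarrow>\<^sub>0 'k, (nat \<times> nat) \<Rightarrow>\<^sub>0 'k) gmodule"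
    and deg :: "nat \<times> nat \<Rightarrow> real"
    and \<omega>\<^sub>1 \<omega>\<^sub>2 :: "nat \<Rightarrow> nat" and w :: "nat \<Rightarrow> nat \<times> nat"
    and \<delta>\<^sub>1 \<delta>\<^sub>2 :: "nat \<Rightarrow> nat"
    and \<I> :: "nat set" and L L' :: "(nat \<times> nat) set"
  assumes "k \<ge> 3" and "a 0 = 0" and "strict_mono_on {0..k} a" and "a k = d"
    and "Gcd (a ` {1..k}) = 1" and "k < d"
  defines "A\<^sub>1 \<equiv> a ` {0..k}"
    and "A\<^sub>2 \<equiv> (\<lambda>i. d - a i) ` {0..k}"
    and "S \<equiv> generated_monoid ((\<lambda>i. (a i, d - a i)) ` {0..k})"
    and "R \<equiv> semigroup_ring S"
    and "m \<equiv> semigroup_ring_irrelevant S"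
    and "deg \<equiv> monomial_degree d"
    and "RG \<equiv> semigroup_ring_module deg S"
    and "\<omega>\<^sub>1 \<equiv> omega d A\<^sub>1" and "\<omega>\<^sub>2 \<equiv> omega d A\<^sub>2"
    and "\<delta>\<^sub>1 \<equiv> delta A\<^sub>1" and "\<delta>\<^sub>2 \<equiv> delta A\<^sub>2"
    and "w \<equiv> (\<lambda>j. (\<omega>\<^sub>1 j, \<omega>\<^sub>2 (d - j)))"
    and "\<I> \<equiv> {i. 1 \<le> i \<and> i \<le> d - 1 \<and> i \<notin> a ` {1..k - 1} \<and> real (\<delta>\<^sub>1 (\<omega>\<^sub>1 i)) > deg (w i)}"
    and "L \<equiv> {w i + (n\<^sub>1 * d, n\<^sub>2 * d) | i n\<^sub>1 n\<^sub>2. i \<in> \<I>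
           \<and> real n\<^sub>1 \<le> real (\<delta>\<^sub>2 (\<omega>\<^sub>2 (d - i))) - deg (w i) - 1
           \<and> real n\<^sub>2 = real (\<delta>\<^sub>1 (\<omega>\<^sub>1 i + n\<^sub>1 * d)) - deg (w i) - real n\<^sub>1 - 1}"
    and "L' \<equiv> {w i + (n\<^sub>1 * d, n\<^sub>2 * d) | i n\<^sub>1 n\<^sub>2. i \<in> \<I>
           \<and> real n\<^sub>1 \<le> real (\<delta>\<^sub>2 (\<omega>\<^sub>2 (d - i))) - deg (w i) - 1
           \<and> real n\<^sub>2 \<le> real (\<delta>\<^sub>1 (\<omega>\<^sub>1 i + n\<^sub>1 * d)) - deg (w i) - real n\<^sub>1 - 1}"
  assumes "\<not> graded_cohen_macaulay R m"
  shows "(\<forall>i\<in>\<I>. real (\<delta>\<^sub>2 (\<omega>\<^sub>2 (d - i))) - deg (w i) - 1 \<ge> 0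
            \<and> (\<forall>n\<^sub>1 :: nat. real n\<^sub>1 \<le> real (\<delta>\<^sub>2 (\<omega>\<^sub>2 (d - i))) - deg (w i) - 1
                 \<longrightarrow> real (\<delta>\<^sub>1 (\<omega>\<^sub>1 i + n\<^sub>1 * d)) - deg (w i) - real n\<^sub>1 - 1 \<ge> 0))
       \<and> finite L \<and> L \<noteq> {} \<and> finite L'
       \<and> (\<forall>(\<epsilon> :: ((nat \<times> nat) \<Rightarrow>\<^sub>0 'k) \<Rightarrow> 'm) E D.
            graded_injective_resolution R (gpart RG) RG \<epsilon> E D \<longrightarrow>
              graded_isomorphic field_ring
                (as_vector_space (local_cohomology R m E D 1)) (graded_vector_space_on deg L')
            \<and> top_degree (local_cohomology R m E D 1) = ereal (Max (deg ` L))
            \<and> module_length R (local_cohomology R m E D 1) = enat (card L'))"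
proof -
  note S_eq_generated = S_def
  interpret monomial_curve A\<^sub>1 d
  proof
    show "h \<le> d" if "h \<in> A\<^sub>1" for h
      using that \<open>a k = d\<close> strict_mono_on_leD[OF \<open>strict_mono_on {0..k} a\<close>, of _ k]
      by (auto simp: A\<^sub>1_def)
    show "0 \<in> A\<^sub>1" "d \<in> A\<^sub>1" using \<open>a 0 = 0\<close> \<open>a k = d\<close> by (force simp: A\<^sub>1_def)+
    show "0 < d" using \<open>k < d\<close> by simp
    have "{0..k} = insert 0 {1..k}" by auto
    then have "A\<^sub>1 = insert 0 (a ` {1..k})" using \<open>a 0 = 0\<close> by (simp add: A\<^sub>1_def)
    then show "Gcd A\<^sub>1 = 1" using \<open>Gcd (a ` {1..k}) = 1\<close> by simp
  qed
  have A2: "A\<^sub>2 = A'" unfolding A'_def by (simp add: A\<^sub>1_def A\<^sub>2_def image_image)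
  have S_eq: "S = monomial_curve.S A\<^sub>1 d"
    unfolding monomial_curve.S_def[OF monomial_curve_axioms] by (simp add: S_eq_generated A\<^sub>1_def image_image)
  have w_eq: "w i = (omega d A\<^sub>1 i, omega d A' (d - i))" for i
    by (simp add: w_def \<omega>\<^sub>1_def \<omega>\<^sub>2_def A2)
  have deg: "deg u = real (level u)" if "u \<in> saturation" for u
    using degree_level[OF that] by (simp add: deg_def)
  have deg_w: "deg (w i) = real (level (w i))" if "i \<le> d" for i
    using deg w_saturation[OF that, of 0 0] by (simp add: w_eq zero_prod_def[symmetric])
  have deg_w_shift: "deg (w i + (n1 * d, n2 * d)) = deg (w i) + real n1 + real n2" if "i \<le> d" for i n1 n2
    using deg[OF w_saturation[OF that, of n1 n2]] deg_w[OF that] w_level[OF that, of n1 n2]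
    by (simp add: w_eq)
  have mem_A: "i \<in> a ` {1..k - 1} \<longleftrightarrow> i \<in> A\<^sub>1" if "1 \<le> i" "i \<le> d - 1" for i
  proof
    show "i \<in> a ` {1..k - 1} \<Longrightarrow> i \<in> A\<^sub>1" unfolding A\<^sub>1_def by auto
    assume "i \<in> A\<^sub>1"
    then obtain j where j: "j \<le> k" "i = a j" by (auto simp: A\<^sub>1_def)
    with that \<open>a 0 = 0\<close> \<open>a k = d\<close> \<open>k < d\<close> have "j \<noteq> 0" "j \<noteq> k" by (auto intro: gr0I)
    with j show "i \<in> a ` {1..k - 1}" by auto
  qed
  have I: "\<I> = gap_indices"
    using mem_A deg_w unfolding \<I>_def gap_indices_def \<delta>\<^sub>1_def \<omega>\<^sub>1_def w_eq by auto
  have I_le: "i \<le> d" if "i \<in> \<I>" for i using that by (auto simp: \<I>_def)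
  \<comment> \<open>The degree of \<open>w i\<close> is the natural number
    \<open>level (w i)\<close>, so a real bound with 1 subtracted is a strict inequality in
    nat.\<close>
  have bound2: "real n \<le> real (\<delta>\<^sub>2 (\<omega>\<^sub>2 (d - i))) - deg (w i) - 1
      \<longleftrightarrow> level (w i) + n < delta A' (omega d A' (d - i))" if "i \<in> \<I>" for i n
    using deg_w[OF I_le[OF that]] by (simp add: \<delta>\<^sub>2_def \<omega>\<^sub>2_def A2) linarith
  have bound1: "real n2 \<le> real (\<delta>\<^sub>1 (\<omega>\<^sub>1 i + n1 * d)) - deg (w i) - real n1 - 1
      \<longleftrightarrow> level (w i) + n1 + n2 < delta A\<^sub>1 (omega d A\<^sub>1 i + n1 * d)" if "i \<in> \<I>" for i n1 n2
    using deg_w[OF I_le[OF that]] by (simp add: \<delta>\<^sub>1_def \<omega>\<^sub>1_def) linarith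
  have L'_eq: "L' = saturation - S"
    unfolding S_eq gaps_eq L'_def I[symmetric]
    using bound1 bound2 by (simp add: w_eq cong: conj_cong)
  have first: "0 \<le> real (\<delta>\<^sub>2 (\<omega>\<^sub>2 (d - i))) - deg (w i) - 1" if "i \<in> \<I>" for i
    using bound2[OF that, of 0] gap_index_bound[of i] that by (simp add: I w_eq)
  have second: "0 \<le> real (\<delta>\<^sub>1 (\<omega>\<^sub>1 i + n1 * d)) - deg (w i) - real n1 - 1"
    if "i \<in> \<I>" "real n1 \<le> real (\<delta>\<^sub>2 (\<omega>\<^sub>2 (d - i))) - deg (w i) - 1" for i n1
    using bound1[OF that(1), of 0 n1] gap_index_bound_shifted[of i n1] bound2[OF that(1), of n1] that
    by (simp add: I w_eq)
  have finite_L': "finite L'" unfolding L'_eq S_eq by (rule finite_gaps)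
  have L_L': "L \<subseteq> L'" unfolding L_def L'_def by force
  have L_top: "\<exists>v\<in>L. deg u \<le> deg v" if "u \<in> L'" for u
  proof -
    obtain i n1 n2 where u: "u = w i + (n1 * d, n2 * d)" and i: "i \<in> \<I>"
      and n1: "real n1 \<le> real (\<delta>\<^sub>2 (\<omega>\<^sub>2 (d - i))) - deg (w i) - 1"
      and n2: "real n2 \<le> real (\<delta>\<^sub>1 (\<omega>\<^sub>1 i + n1 * d)) - deg (w i) - real n1 - 1"
      using \<open>u \<in> L'\<close> unfolding L'_def by blast
    \<comment> \<open>The largest n2 allowed for the given i and n1, so that the raised point lies
      in \<open>L\<close>; \<open>second\<close> ensures that the subtraction in nat does not
      truncate.\<close>
    define N where "N = \<delta>\<^sub>1 (\<omega>\<^sub>1 i + n1 * d) - level (w i) - n1 - 1"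
    have N: "real N = real (\<delta>\<^sub>1 (\<omega>\<^sub>1 i + n1 * d)) - deg (w i) - real n1 - 1"
      using second[OF i n1] deg_w[OF I_le[OF i]] by (simp add: N_def)
    show ?thesis
    proof
      show "w i + (n1 * d, N * d) \<in> L" unfolding L_def using i n1 N by blast
      show "deg u \<le> deg (w i + (n1 * d, N * d))"
        unfolding u deg_w_shift[OF I_le[OF i]] using n2 N by linarith
    qed
  qed
  \<comment> \<open>Failure of Cohen-Macaulayness enters here; it guarantees that the maxima over
    \<open>L\<close> and \<open>L'\<close> are taken over nonempty sets.\<close>
  have L'_ne: "L' \<noteq> {}"
  proof
    assume "L' = {}"
    then have "saturation \<subseteq> monomial_curve.S A\<^sub>1 d" using L'_eq S_eq by blast
    then have "graded_cohen_macaulay R m" unfolding R_def m_def S_eq by (rule cohen_macaulay_if_saturated)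
    then show False using \<open>\<not> graded_cohen_macaulay R m\<close> by contradiction
  qed
  then have L_ne: "L \<noteq> {}" using L_top by blast
  have Max_eq: "Max (deg ` L) = Max (deg ` L')"
  proof (rule antisym)
    have fin: "finite (deg ` L)" "finite (deg ` L')" using finite_L' finite_subset[OF L_L'] by auto
    show "Max (deg ` L) \<le> Max (deg ` L')" using L_L' L_ne fin by (intro Max_mono) auto
    have "Max (deg ` L') \<in> deg ` L'" using fin L'_ne by (intro Max_in) auto
    then obtain u where "u \<in> L'" "Max (deg ` L') = deg u" by blast
    then obtain v where "v \<in> L" "Max (deg ` L') \<le> deg v" using L_top by metis
    moreover have "deg v \<le> Max (deg ` L)" using \<open>v \<in> L\<close> fin by (intro Max_ge) auto
    ultimately show "Max (deg ` L') \<le> Max (deg ` L)" by linarith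
  qed
  have "graded_isomorphic field_ring
          (as_vector_space (local_cohomology R m E D 1))
          (graded_vector_space_on deg L' :: ('k, nat \<times> nat \<Rightarrow>\<^sub>0 'k) gmodule)
      \<and> top_degree (local_cohomology R m E D 1) = ereal (Max (deg ` L))
      \<and> module_length R (local_cohomology R m E D 1) = enat (card L')"
    if res: "graded_injective_resolution R (gpart RG) RG \<epsilon> E D" for \<epsilon> :: "((nat \<times> nat) \<Rightarrow>\<^sub>0 'k) \<Rightarrow> 'm" and E D
  proof -
    interpret res: curve_resolution A\<^sub>1 d \<epsilon> E D
      by (intro curve_resolution.intro curve_resolution_axioms.intro monomial_curve_axioms)
        (use res in \<open>simp add: R_def RG_def S_eq deg_def\<close>)
    have H: "res.H1 = local_cohomology R m E D 1" by (simp add: res.H1_def R_def m_def S_eq)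
    show ?thesis
      using res.H1.graded_iso res.H1.top_degree_eq res.H1.module_length_eq L'_ne
      unfolding H Max_eq L'_eq by (simp add: R_def S_eq deg_def)
  qed
  then show ?thesis using first second finite_L' finite_subset[OF L_L' finite_L'] L_ne by blast
qed

end
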